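(* Let $A=KQ_n/I$ be a Nakayama algebra with $Q$-set $\mathscr{X}=\mathscr{X}_A$, partitioned as $\mathscr{X}=\mathscr{X}^0\cup\mathscr{X}^1\cup\mathscr{X}^2$. Then $$q(A)=\frac{1}{n}\Big[\sum_{x\in\mathscr{X}^0}q(A)+\sum_{x\in\mathscr{X}^1}q(KQ_n/I_{\hat{x}})+\sum_{x\in\mathscr{X}^2}q(KQ_n/I_{\hat{x}})\Big].$$
   Context: $K$ is an algebraically closed field and $n\ge 2$. $Q_n$ denotes either the linear quiver $A_n$ with vertices $1,\dots,n$ and arrows $\alpha_j:j\to j+1$ ($1\le j\le n-1$), or the cyclic quiver $\widetilde{A}_n$ with vertices $1,\dots,n$ and arrows $\alpha_j:j\to j+1$ ($1\le j\le n-1$) and $\alpha_n:n\to 1$. A Nakayama algebra means a finite-dimensional algebra $A=KQ_n/I$ with $I$ an admissible two-sided ideal; $I$ is generated by a minimal set of paths, and writing $I=\langle g_1,\dots,g_k\rangle$ always means that $\{g_1,\dots,g_k\}$ is this minimal set of paths. Vertices are read modulo $n$ in the cyclic case. Paths compose from right to left, and modules are such that the indecomposable projective $P(j)$ with top $j$ is uniserial with composition factors $j,j+1,j+2,\dots$ from top to socle. The simple module at vertex $x$ is denoted by $x$, and $\mathcal{S}$ is the set of all simple $A$-modules, i.e. of vertices ($|\mathcal{S}|=n$). Length of a path means number of arrows plus $1$. For a path $g=\alpha_{d(g)-1}\cdots\alpha_{h(g)}$ of length $\ell_g\ge 3$ from vertex $h(g)$ (the hook) to vertex $d(g)=h(g)+\ell_g-1$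 (the denouement), $Hod(g)$ (the hood) is the multiset $\{h(g),h(g)+1,\dots,d(g)\}$ of the $\ell_g$ vertices visited by $g$, and $Int(g)$ is the multiset obtained from $Hod(g)$ by removing the first and last entries (one occurrence each). For $I=\langle g_1,\dots,g_k\rangle$, $\mathscr{X}_A=\mathcal{S}\setminus\bigcup_{i=1}^k Int(g_i)$. $\mathscr{X}^0$ is the set of $x\in\mathscr{X}_A$ lying in no $Hod(g_i)$; $\mathscr{X}^1$ is the set of $x\in\mathscr{X}_A$ that are a hook of some $g_i$ or a denouement of some $g_i$, but not both a hook and a denouement; $\mathscr{X}^2$ is the set of $x\in\mathscr{X}_A$ that are both a hook of some generator and a denouement of some generator. For $x\in\mathscr{X}_A$ the ideal $I_{\hat x}$ is defined by: $I_{\hat x}=I$ if $x\in\mathscr{X}^0$; if $x\in\mathscr{X}^1$ with $x=h(g_i)$ or $x=d(g_i)$, $I_{\hat x}$ is generated by $\{g_1,\dots,g_k\}\setminus\{g_i\}$; if $x\in\mathscr{X}^2$ with $x=d(g_i)=h(g_j)$, $I_{\hat x}$ is generated by $\{g_1,\dots,g_k\}\setminus\{g_i,g_j\}$ (possibly $i=j$). Given a total ordering $\preceq$ on $\mathcal{S}$, the Weyl module $\Delta(x)$ is the maximal factor module of $P(x)$ all of whose composition factors $y$ satisfy $y\preceq x$. A module is good if it has a finite filtration whose successive quotients are Weyl modules. The ordering $\preceq$ is a quasi-hereditary ordering ($q$-ordering) of $A$ if for every $x\in\mathcal{S}$: (1) $\mathrm{End}_A(\Delta(x))\simeq K$, and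 (2) $P(x)$ is good. $q(A)$ denotes the number of total orderings on $\mathcal{S}$ that are $q$-orderings of $A$. Convention: when $I_{\hat x}=0$, $q(KQ_n/I_{\hat x})=q(KQ_n)$ is taken to be $n!$ (also for the cyclic quiver, where $KQ_n$ is infinite-dimensional). *)

theory Defs
  imports
    "HOL-Algebra.Ideal_Product"
    "HOL-Algebra.Algebraic_Closure_Type"
begin

section \<open>Left modules over a (noncommutative) ring\<close>

text \<open>
  The library record for modules and its \<^locale>\<open>submodule\<close> locale make sense over every ring; only
  the locale \<^locale>\<open>module\<close> insists on a commutative one.  The fields \<^const>\<open>monoid.mult\<close> and \<^const>\<open>monoid.one\<close>
  of a module record are irrelevant here.
\<close>

definition quot_module :: "('a, 'm, 's) module_scheme \<Rightarrow> 'm set \<Rightarrow> ('a, 'm set) module" where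
  "quot_module M N =
    \<lparr> carrier = a_rcosets\<^bsub>M\<^esub> N, monoid.mult = undefined, one = undefined,
      zero = N, add = set_add M,
      module.smult = (\<lambda>a C. \<Union>m\<in>C. N +>\<^bsub>M\<^esub> (a \<odot>\<^bsub>M\<^esub> m)) \<rparr>"

definition subquot :: "('a, 'm) module \<Rightarrow> 'm set \<Rightarrow> 'm set \<Rightarrow> ('a, 'm set) module" where
  "subquot M N\<^sub>1 N\<^sub>2 = quot_module (M\<lparr>carrier := N\<^sub>1\<rparr>) N\<^sub>2"

definition module_homs ::
    "('a, 'r) ring_scheme \<Rightarrow> ('a, 'm) module \<Rightarrow> ('a, 'l) module \<Rightarrow> ('m \<Rightarrow> 'l) set" where
  "module_homs A M N =
    {f \<in> hom (add_monoid M) (add_monoid N).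
       \<forall>a\<in>carrier A. \<forall>m\<in>carrier M. f (a \<odot>\<^bsub>M\<^esub> m) = a \<odot>\<^bsub>N\<^esub> f m}"

definition module_iso ::
    "('a, 'r) ring_scheme \<Rightarrow> ('a, 'm) module \<Rightarrow> ('a, 'l) module \<Rightarrow> bool" where
  "module_iso A M N \<longleftrightarrow> (\<exists>f\<in>module_homs A M N. bij_betw f (carrier M) (carrier N))"

definition End_ring :: "('a, 'r) ring_scheme \<Rightarrow> ('a, 'm) module \<Rightarrow> ('m \<Rightarrow> 'm) ring" where
  "End_ring A M =
    \<lparr> carrier = module_homs A M M \<inter> extensional (carrier M),
      monoid.mult = compose (carrier M),
      one = (\<lambda>m\<in>carrier M. m),
      zero = (\<lambda>m\<in>carrier M. \<zero>\<^bsub>M\<^esub>),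
      add = (\<lambda>f g. \<lambda>m\<in>carrier M. f m \<oplus>\<^bsub>M\<^esub> g m) \<rparr>"

text \<open>
  The \<open>K\<close>-algebra structure of \<open>A\<close> is given by its structure map \<open>\<iota> : K \<rightarrow> A\<close>, and \<open>K\<close> acts on
  \<open>A\<close>-modules (hence on their endomorphisms) through \<open>\<iota>\<close>.  The isomorphism \<open>End\<^sub>A(M) \<simeq> K\<close> is
  one of \<open>K\<close>-algebras.
\<close>
definition End_iso_field ::
    "('a, 'r) ring_scheme \<Rightarrow> ('k::field \<Rightarrow> 'a) \<Rightarrow> ('a, 'm) module \<Rightarrow> bool" where
  "End_iso_field A \<iota> M \<longleftrightarrow>
    (\<exists>\<phi>\<in>ring_iso (ring_of_type_algebra :: 'k ring) (End_ring A M).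
       \<forall>c d. \<forall>m\<in>carrier M. \<phi> (c * d) m = \<iota> c \<odot>\<^bsub>M\<^esub> \<phi> d m)"

definition module_filtration ::
    "('a, 'r) ring_scheme \<Rightarrow> ('a, 'm) module \<Rightarrow> 'm set list \<Rightarrow> bool" where
  "module_filtration A M Ns \<longleftrightarrow>
    Ns \<noteq> [] \<and> hd Ns = {\<zero>\<^bsub>M\<^esub>} \<and> last Ns = carrier M \<and>
    (\<forall>N\<in>set Ns. submodule N A M) \<and>
    (\<forall>i. Suc i < length Ns \<longrightarrow> Ns ! i \<subseteq> Ns ! Suc i)"

definition simple_module :: "('a, 'r) ring_scheme \<Rightarrow> ('a, 'm) module \<Rightarrow> bool" where
  "simple_module A M \<longleftrightarrow>
    carrier M \<noteq> {\<zero>\<^bsub>M\<^esub>} \<and> (\<forall>N. submodule N A M \<longrightarrow> N = {\<zero>\<^bsub>M\<^esub>} \<or> N = carrier M)"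

definition composition_series ::
    "('a, 'r) ring_scheme \<Rightarrow> ('a, 'm) module \<Rightarrow> 'm set list \<Rightarrow> bool" where
  "composition_series A M Ns \<longleftrightarrow>
    module_filtration A M Ns \<and>
    (\<forall>i. Suc i < length Ns \<longrightarrow> simple_module A (subquot M (Ns ! Suc i) (Ns ! i)))"


section \<open>Weyl modules and quasi-hereditary orderings\<close>

text \<open>
  Throughout, \<open>A\<close> is a ring with structure map \<open>\<iota> : K \<rightarrow> A\<close> and \<open>e j\<close> is the primitive idempotent
  at the vertex \<open>j \<in> V\<close>.  The simple module at \<open>y\<close> is the simple module not annihilated by \<open>e y\<close>.
\<close>

definition simple_at ::
    "('a, 'r) ring_scheme \<Rightarrow> (nat \<Rightarrow> 'a) \<Rightarrow> nat \<Rightarrow> ('a, 'm) module \<Rightarrow> bool" where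
  "simple_at A e y M \<longleftrightarrow> simple_module A M \<and> (\<exists>m\<in>carrier M. e y \<odot>\<^bsub>M\<^esub> m \<noteq> \<zero>\<^bsub>M\<^esub>)"

definition composition_factor ::
    "('a, 'r) ring_scheme \<Rightarrow> (nat \<Rightarrow> 'a) \<Rightarrow> ('a, 'm) module \<Rightarrow> nat \<Rightarrow> bool" where
  "composition_factor A e M y \<longleftrightarrow>
    (\<exists>Ns i. composition_series A M Ns \<and> Suc i < length Ns \<and>
       simple_at A e y (subquot M (Ns ! Suc i) (Ns ! i)))"

definition proj_module :: "('a, 'r) ring_scheme \<Rightarrow> (nat \<Rightarrow> 'a) \<Rightarrow> nat \<Rightarrow> ('a, 'a) module" where
  "proj_module A e j =
    \<lparr> carrier = {a \<otimes>\<^bsub>A\<^esub> e j | a. a \<in> carrier A}, monoid.mult = undefined, one = undefined,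
      zero = \<zero>\<^bsub>A\<^esub>, add = add A, module.smult = monoid.mult A \<rparr>"

text \<open>
  Below, \<open>(y, x) \<in> r\<close> means \<open>y \<preceq> x\<close>.  The maximal factor module of \<open>P(x)\<close> with the required
  property is the quotient by the least submodule whose quotient has the property.
\<close>
definition weyl_candidates ::
    "('a, 'r) ring_scheme \<Rightarrow> (nat \<Rightarrow> 'a) \<Rightarrow> nat set \<Rightarrow> nat rel \<Rightarrow> nat \<Rightarrow> 'a set set" where
  "weyl_candidates A e V r x =
    {U. submodule U A (proj_module A e x) \<and>
        (\<forall>y\<in>V. composition_factor A e (quot_module (proj_module A e x) U) y \<longrightarrow> (y, x) \<in> r)}"

definition weyl_module ::
    "('a, 'r) ring_scheme \<Rightarrow> (nat \<Rightarrow> 'a) \<Rightarrow> nat set \<Rightarrow> nat rel \<Rightarrow> nat \<Rightarrow> ('a, 'a set) module" where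
  "weyl_module A e V r x =
    quot_module (proj_module A e x)
      (THE U. U \<in> weyl_candidates A e V r x \<and> (\<forall>W\<in>weyl_candidates A e V r x. U \<subseteq> W))"

definition good_module ::
    "('a, 'r) ring_scheme \<Rightarrow> (nat \<Rightarrow> 'a) \<Rightarrow> nat set \<Rightarrow> nat rel \<Rightarrow> ('a, 'm) module \<Rightarrow> bool" where
  "good_module A e V r M \<longleftrightarrow>
    (\<exists>Ns. module_filtration A M Ns \<and>
       (\<forall>i. Suc i < length Ns \<longrightarrow>
          (\<exists>y\<in>V. module_iso A (subquot M (Ns ! Suc i) (Ns ! i)) (weyl_module A e V r y))))"

definition q_ordering ::
    "('a, 'r) ring_scheme \<Rightarrow> ('k::field \<Rightarrow> 'a) \<Rightarrow> (nat \<Rightarrow> 'a) \<Rightarrow> nat set \<Rightarrow> nat rel \<Rightarrow> bool" where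
  "q_ordering A \<iota> e V r \<longleftrightarrow>
    linear_order_on V r \<and>
    (\<forall>x\<in>V. End_iso_field A \<iota> (weyl_module A e V r x) \<and>
             good_module A e V r (proj_module A e x))"


section \<open>The quivers and their path algebras\<close>

text \<open>
  Every vertex has at most one outgoing arrow, so a path is determined by its first vertex \<open>i\<close> and
  its number \<open>m\<close> of arrows; it is encoded as \<open>(i, m)\<close>.  In particular \<open>(i, 0)\<close> is the trivial path
  at \<open>i\<close> and \<open>(i, 1)\<close> is the arrow \<open>\<alpha>\<^sub>i\<close>.  The vertices are \<open>1, \<dots>, n\<close>.
\<close>

datatype quiver = Linear | Cyclic

type_synonym qpath = "nat \<times> nat"

fun qpaths :: "quiver \<Rightarrow> nat \<Rightarrow> qpath set" where
  "qpaths Linear n = {(i, m). 1 \<le> i \<and> i + m \<le> n}"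
| "qpaths Cyclic n = {(i, m). 1 \<le> i \<and> i \<le> n}"

text \<open>The vertex reached from \<open>i\<close> after \<open>r\<close> arrows, reduced modulo \<open>n\<close> into \<open>{1..n}\<close>\<close>
definition vertex_after :: "nat \<Rightarrow> nat \<Rightarrow> nat \<Rightarrow> nat" where
  "vertex_after n i r = (i + r - 1) mod n + 1"

text \<open>
  Since paths compose from right to left, the factorisations \<open>p = q q'\<close> of \<open>p = (i, m)\<close> are those
  with \<open>q' = (i, r)\<close> and \<open>q = (vertex_after n i r, m - r)\<close> for \<open>r \<le> m\<close>.
\<close>
definition path_algebra :: "quiver \<Rightarrow> nat \<Rightarrow> (qpath \<Rightarrow> 'k::field) ring" where
  "path_algebra Q n =
    \<lparr> carrier = {f. finite {p. f p \<noteq> 0} \<and> {p. f p \<noteq> 0} \<subseteq> qpaths Q n},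
      monoid.mult = (\<lambda>f g (i, m). \<Sum>r\<le>m. f (vertex_after n i r, m - r) * g (i, r)),
      one = (\<lambda>(i, m). if i \<in> {1..n} \<and> m = 0 then 1 else 0),
      zero = (\<lambda>_. 0),
      add = (\<lambda>f g p. f p + g p) \<rparr>"

definition path_elem :: "qpath \<Rightarrow> qpath \<Rightarrow> 'k::field" where
  "path_elem p = (\<lambda>q. if q = p then 1 else 0)"

definition arrow_ideal :: "quiver \<Rightarrow> nat \<Rightarrow> (qpath \<Rightarrow> 'k::field) set" where
  "arrow_ideal Q n =
    Idl\<^bsub>path_algebra Q n\<^esub> (path_elem ` {p \<in> qpaths Q n. snd p = 1})"

primrec arrow_ideal_power :: "quiver \<Rightarrow> nat \<Rightarrow> nat \<Rightarrow> (qpath \<Rightarrow> 'k::field) set" where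
  "arrow_ideal_power Q n 0 = carrier (path_algebra Q n)"
| "arrow_ideal_power Q n (Suc m) =
    ideal_prod (path_algebra Q n) (arrow_ideal Q n) (arrow_ideal_power Q n m)"

definition admissible_ideal :: "quiver \<Rightarrow> nat \<Rightarrow> (qpath \<Rightarrow> 'k::field) set \<Rightarrow> bool" where
  "admissible_ideal Q n I \<longleftrightarrow>
    ideal I (path_algebra Q n) \<and>
    I \<subseteq> arrow_ideal_power Q n 2 \<and>
    (\<exists>m\<ge>2. arrow_ideal_power Q n m \<subseteq> I)"

definition path_ideal :: "quiver \<Rightarrow> nat \<Rightarrow> qpath set \<Rightarrow> (qpath \<Rightarrow> 'k::field) set" where
  "path_ideal Q n G = Idl\<^bsub>path_algebra Q n\<^esub> (path_elem ` G)"

definition minimal_path_generators ::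
    "quiver \<Rightarrow> nat \<Rightarrow> (qpath \<Rightarrow> 'k::field) set \<Rightarrow> qpath set \<Rightarrow> bool" where
  "minimal_path_generators Q n I G \<longleftrightarrow>
    G \<subseteq> qpaths Q n \<and> I = path_ideal Q n G \<and> (\<forall>G'. G' \<subset> G \<longrightarrow> I \<noteq> path_ideal Q n G')"

definition q_number :: "quiver \<Rightarrow> nat \<Rightarrow> (qpath \<Rightarrow> 'k::field) set \<Rightarrow> nat" where
  "q_number Q n I =
    card {r. q_ordering (path_algebra Q n Quot I)
               (\<lambda>c. I +>\<^bsub>path_algebra Q n\<^esub> (\<lambda>p. c * \<one>\<^bsub>path_algebra Q n\<^esub> p))
               (\<lambda>j. I +>\<^bsub>path_algebra Q n\<^esub> path_elem (j, 0))
               {1..n} r}"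

text \<open>The convention \<open>q(K Q\<^sub>n) = n!\<close>, used also when \<open>K Q\<^sub>n\<close> is infinite-dimensional\<close>
definition q_number_conv :: "quiver \<Rightarrow> nat \<Rightarrow> (qpath \<Rightarrow> 'k::field) set \<Rightarrow> nat" where
  "q_number_conv Q n I =
    (if I = {\<zero>\<^bsub>path_algebra Q n\<^esub>} then fact n else q_number Q n I)"


section \<open>The Q-set\<close>

definition hook :: "qpath \<Rightarrow> nat" where
  "hook g = fst g"

definition denouement :: "nat \<Rightarrow> qpath \<Rightarrow> nat" where
  "denouement n g = vertex_after n (fst g) (snd g)"

definition Hod :: "nat \<Rightarrow> qpath \<Rightarrow> nat multiset" where
  "Hod n g = image_mset (vertex_after n (fst g)) (mset_set {0..snd g})"

definition Int_mset :: "nat \<Rightarrow> qpath \<Rightarrow> nat multiset" where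
  "Int_mset n g = Hod n g - {#hook g, denouement n g#}"

definition Q_set :: "nat \<Rightarrow> qpath set \<Rightarrow> nat set" where
  "Q_set n G = {1..n} - (\<Union>g\<in>G. set_mset (Int_mset n g))"

definition Q_set0 :: "nat \<Rightarrow> qpath set \<Rightarrow> nat set" where
  "Q_set0 n G = {x \<in> Q_set n G. \<forall>g\<in>G. x \<notin># Hod n g}"

definition Q_set1 :: "nat \<Rightarrow> qpath set \<Rightarrow> nat set" where
  "Q_set1 n G = {x \<in> Q_set n G. (x \<in> hook ` G \<or> x \<in> denouement n ` G) \<and>
                                \<not> (x \<in> hook ` G \<and> x \<in> denouement n ` G)}"

definition Q_set2 :: "nat \<Rightarrow> qpath set \<Rightarrow> nat set" where
  "Q_set2 n G = {x \<in> Q_set n G. x \<in> hook ` G \<and> x \<in> denouement n ` G}"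

text \<open>
  Distinct elements of a minimal generating set have distinct hooks and distinct denouements, so at
  most one generator is removed for each of the two reasons, and both may be the same one.
\<close>
definition ideal_hat ::
    "quiver \<Rightarrow> nat \<Rightarrow> (qpath \<Rightarrow> 'k::field) set \<Rightarrow> qpath set \<Rightarrow> nat \<Rightarrow> (qpath \<Rightarrow> 'k) set" where
  "ideal_hat Q n I G x =
    (if x \<in> Q_set0 n G then I
     else path_ideal Q n (G - {g \<in> G. hook g = x \<or> denouement n g = x}))"

end

theory Submission
  imports Defs
begin

text \<open>
  Every module in sight is uniserial, so it is determined by its top \<open>j\<close> and its length \<open>L\<close>.  In these
  terms \<open>P(x)\<close> is good iff splitting off Weyl modules greedily from the top exhausts it exactly.
  The tops of the successive layers increase in the ordering, so the greedy process overshoots the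
  end of some \<open>P(x)\<close> iff some generator has its largest vertex in its interior; the same condition
  detects Weyl modules with repeated composition factors, i.e. with too many endomorphisms.  Hence
  an ordering is a \<open>q\<close>-ordering iff no generator \<open>g\<close> attains the maximum of \<open>Hod(g)\<close> in \<open>Int(g)\<close>.

  Now sort the \<open>q\<close>-orderings by their largest vertex \<open>x\<close>.  There are none if \<open>x\<close> is interior to a
  generator.  Otherwise the generators starting or ending at \<open>x\<close> impose no condition, and the
  remaining ones do not involve \<open>x\<close>, so that \<open>x\<close> is the largest vertex in exactly one \<open>n\<close>-th of the
  orderings which they allow.
\<close>

section \<open>Vertices and nonzero paths\<close>

text \<open>Modules and ideals are turned into numbers before any ordering is discussed. Since the
  ideal is spanned by paths, the paths avoiding every generator give a basis of the algebra; the
  lengths of the \<open>P(j)\<close> and the coefficients along these paths are all that the module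
  theory uses, so it is carried out for an abstract algebra with such coefficients. The ideals
  obtained by removing generators come from subsets of the minimal set. A nonempty subset again
  satisfies the combinatorial conditions extracted from admissibility and minimality, so the
  criterion applies to it directly; the empty subset leaves all n! orderings, which agrees with the
  convention even where the projectives are infinite-dimensional. The recursion is proved for n q(A)
  in the natural numbers, and division occurs only at the very end.\<close>

lemma vertex_after_0: "i \<in> {1..n} \<Longrightarrow> vertex_after n i 0 = i"
  by (auto simp: vertex_after_def)

lemma vertex_after_add:
  assumes "i \<ge> 1" shows "vertex_after n (vertex_after n i r) s = vertex_after n i (r + s)"
proof -
  have "(i + r - 1) mod n + 1 + s - 1 = (i + r - 1) mod n + s" by simp
  moreover have "i + (r + s) - 1 = (i + r - 1) + s" using assms by simp
  ultimately show ?thesis unfolding vertex_after_def by (simp add: mod_add_left_eq)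
qed

lemma vertex_after_range: "n \<ge> 1 \<Longrightarrow> vertex_after n i r \<in> {1..n}"
  by (auto simp: vertex_after_def Suc_le_eq)

lemma vertex_after_period: "i \<ge> 1 \<Longrightarrow> vertex_after n i (r + n) = vertex_after n i r"
proof -
  assume "i \<ge> 1"
  then have "i + (r + n) - 1 = (i + r - 1) + n" by simp
  then show ?thesis unfolding vertex_after_def by simp
qed

text \<open>Depths carrying the same vertex are congruent modulo \<open>n\<close>. This turns a
  repeated composition factor into a lower bound on the length.\<close>

lemma vertex_after_eqD:
  assumes "i \<ge> 1" "vertex_after n i k = vertex_after n i p" "k < p"
  shows "n \<le> p - k"
proof -
  have "(i + k - 1) mod n = (i + p - 1) mod n" using assms by (simp add: vertex_after_def)
  then have "n dvd (i + p - 1) - (i + k - 1)"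
    using assms mod_eq_dvd_iff_nat[of "i + k - 1" "i + p - 1" n] by simp
  moreover have "(i + p - 1) - (i + k - 1) = p - k" using assms by simp
  ultimately show ?thesis using assms by (auto dest: dvd_imp_le)
qed

text \<open>On paths of the linear quiver the reduction modulo \<open>n\<close> never takes effect,
  so \<open>vertex_after\<close> serves both quivers.\<close>

lemma vertex_after_linear: "1 \<le> i \<Longrightarrow> i + r \<le> n \<Longrightarrow> vertex_after n i r = i + r"
  by (simp add: vertex_after_def)

lemma vertex_after_surj:
  assumes "x \<in> {1..n}" "y \<in> {1..n}" shows "\<exists>t<n. vertex_after n x t = y"
proof (cases "x \<le> y")
  case True
  then show ?thesis using assms by (intro exI[of _ "y - x"]) (auto simp: vertex_after_def)
next
  case False
  then have "x + (y + n - x) - 1 = (y - 1) + n" using assms by auto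
  then have "vertex_after n x (y + n - x) = (y - 1 + n) mod n + 1"
    by (simp only: vertex_after_def)
  also have "\<dots> = y"
  proof -
    have "(y - 1 + n) mod n = y - 1" using assms by (subst mod_add_self2) auto
    moreover have "y - 1 + 1 = y" using assms by simp
    ultimately show ?thesis by (simp only:)
  qed
  finally have "vertex_after n x (y + n - x) = y" .
  then show ?thesis using assms False by (intro exI[of _ "y + n - x"]) auto
qed

section \<open>Paths surviving modulo the relations, and the lengths of the projectives\<close>

definition nonzero_path :: "quiver \<Rightarrow> nat \<Rightarrow> qpath set \<Rightarrow> qpath \<Rightarrow> bool" where
  "nonzero_path Q n G p \<longleftrightarrow>
    p \<in> qpaths Q n \<and> (\<forall>r s. r + s \<le> snd p \<longrightarrow> (vertex_after n (fst p) r, s) \<notin> G)"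

text \<open>The number of composition factors of \<open>P(i)\<close>\<close>
definition proj_length :: "quiver \<Rightarrow> nat \<Rightarrow> qpath set \<Rightarrow> nat \<Rightarrow> nat" where
  "proj_length Q n G i = (LEAST m. \<not> nonzero_path Q n G (i, m))"

lemma qpaths_subpath:
  assumes "(i, m) \<in> qpaths Q n" "r + s \<le> m"
  shows "(vertex_after n i r, s) \<in> qpaths Q n"
  using assms vertex_after_range[of n i r] by (cases Q) (auto simp: vertex_after_linear)

lemma qpaths_fst: "(i, m) \<in> qpaths Q n \<Longrightarrow> i \<in> {1..n}"
  by (cases Q) auto

lemma nonzero_path_subpath:
  assumes "nonzero_path Q n G (i, m)" "r + s \<le> m"
  shows "nonzero_path Q n G (vertex_after n i r, s)"
proof -
  have i: "i \<ge> 1" using assms(1) qpaths_fst[of i m Q n] by (auto simp: nonzero_path_def)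
  have "r' + s' \<le> s \<Longrightarrow> (vertex_after n (vertex_after n i r) r', s') \<notin> G" for r' s'
    using assms vertex_after_add[OF i, of n r r'] by (auto simp: nonzero_path_def)
  then show ?thesis
    using assms qpaths_subpath[of i m Q n r s] by (auto simp: nonzero_path_def)
qed

lemma nonzero_path_prefix:
  assumes "nonzero_path Q n G (i, m)" "s \<le> m"
  shows "nonzero_path Q n G (i, s)"
  using nonzero_path_subpath[of Q n G i m 0 s] assms qpaths_fst[of i m Q n]
  by (auto simp: nonzero_path_def vertex_after_0)

text \<open>The combinatorial content of admissibility and minimality: generators have at least two
  arrows, none is a proper subpath of another, and in the cyclic case at least one exists, since
  otherwise the projectives would be infinite. Nonempty subsets of \<open>G\<close> satisfy these
  conditions again, which is what permits removing generators.\<close>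

locale path_relations =
  fixes Q :: quiver and n :: nat and G :: "qpath set"
  assumes n_ge_2: "n \<ge> 2"
    and relations_subset: "G \<subseteq> qpaths Q n"
    and relations_length: "g \<in> G \<Longrightarrow> snd g \<ge> 2"
    and relations_antichain:
      "\<lbrakk>(i, m) \<in> G; r + s \<le> m; (vertex_after n i r, s) \<in> G\<rbrakk> \<Longrightarrow> s = m"
    and relations_nonempty: "Q = Cyclic \<Longrightarrow> G \<noteq> {}"
begin

abbreviation va where "va \<equiv> vertex_after n"
abbreviation len where "len \<equiv> proj_length Q n G"
abbreviation nzp where "nzp \<equiv> nonzero_path Q n G"

lemma n_ge_1: "n \<ge> 1" using n_ge_2 by simp

text \<open>Gives the minimum in \<open>proj_length\<close> a meaning. In the linear quiver no path
  has \<open>n\<close> arrows; in the cyclic one a long enough path from any vertex runs through a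
  given generator.\<close>

lemma ex_zero_path: "\<exists>m. \<not> nzp (i, m)"
proof (cases "Q")
  case Linear
  then have "\<not> nzp (i, n)" by (auto simp: nonzero_path_def)
  then show ?thesis by blast
next
  case Cyclic
  then obtain h m where g: "(h, m) \<in> G" using relations_nonempty by auto
  then have h: "h \<in> {1..n}" using relations_subset qpaths_fst by blast
  show ?thesis
  proof (cases "i \<in> {1..n}")
    case True
    then obtain t where "va i t = h" using vertex_after_surj h by blast
    then have "\<not> nzp (i, t + m)" using g by (auto simp: nonzero_path_def)
    then show ?thesis by blast
  next
    case False
    then show ?thesis using qpaths_fst[of i 0 Q n] by (auto simp: nonzero_path_def)
  qed
qed

lemma nzp_iff: "nzp (i, m) \<longleftrightarrow> m < len i"
proof
  assume "nzp (i, m)"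
  show "m < len i"
  proof (rule ccontr)
    assume "\<not> m < len i"
    then have "nzp (i, len i)" using nonzero_path_prefix \<open>nzp (i, m)\<close> by auto
    then show False using LeastI_ex[OF ex_zero_path] by (auto simp: proj_length_def)
  qed
next
  assume "m < len i"
  then show "nzp (i, m)" unfolding proj_length_def by (auto dest: not_less_Least)
qed

lemma len_pos: "i \<in> {1..n} \<Longrightarrow> len i \<ge> 1"
proof -
  assume "i \<in> {1..n}"
  then have "nzp (i, 0)"
    using relations_length by (cases Q) (force simp: nonzero_path_def)+
  then show ?thesis by (simp add: nzp_iff)
qed

lemma len_outside: "i \<notin> {1..n} \<Longrightarrow> len i = 0"
  using nzp_iff[of i 0] qpaths_fst[of i 0 Q n] by (auto simp: nonzero_path_def)

text \<open>Dropping the first \<open>k\<close> arrows of the longest nonzero path from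
  \<open>i\<close> leaves a nonzero path. For \<open>k = 1\<close> this is the inequality satisfied
  by Kupisch series.\<close>

lemma len_step:
  assumes "k < len i" shows "len i \<le> k + len (va i k)"
proof -
  have "nzp (i, len i - 1)" using assms by (simp add: nzp_iff)
  then have "nzp (va i k, len i - 1 - k)"
    by (rule nonzero_path_subpath) (use assms in simp)
  then show ?thesis by (simp add: nzp_iff)
qed

text \<open>A generator is itself zero, but without its last arrow it contains no generator, by the
  antichain condition. Hence the projective at the hook stops exactly one depth before the
  denouement.\<close>

lemma relation_len:
  assumes "(h, m) \<in> G" shows "len h = m"
proof -
  have hn: "h \<in> {1..n}" using assms relations_subset qpaths_fst by blast
  have "\<not> nzp (h, m)" using assms vertex_after_0[OF hn]
    unfolding nonzero_path_def by (metis add_0 fst_conv snd_conv order_refl)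
  then have le: "len h \<le> m" by (simp add: nzp_iff)
  have m: "m \<ge> 2" using relations_length[OF assms] by simp
  have "nzp (h, m - 1)"
  proof -
    have "(h, m - 1) \<in> qpaths Q n"
      using assms relations_subset qpaths_subpath[of h m Q n 0 "m - 1"] vertex_after_0[OF hn] by auto
    moreover have "(va h r, s) \<notin> G" if "r + s \<le> m - 1" for r s
    proof
      assume "(va h r, s) \<in> G"
      then have "s = m" using relations_antichain[OF assms, of r s] that by simp
      then show False using that m by simp
    qed
    ultimately show ?thesis by (auto simp: nonzero_path_def)
  qed
  then show ?thesis using le by (simp add: nzp_iff)
qed

text \<open>A proper final segment of a generator contains no generator, so the projective at an
  interior vertex still reaches the denouement, one depth beyond the end of the projective at the
  hook.\<close>

lemma relation_interior_len:
  assumes "(h, m) \<in> G" "0 < p" "p < m" shows "m < p + len (va h p)"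
proof -
  have h: "h \<ge> 1" using assms relations_subset qpaths_fst[of h m Q n] by auto
  have "nzp (va h p, m - p)"
  proof -
    have "(va h p, m - p) \<in> qpaths Q n"
      using assms relations_subset qpaths_subpath[of h m Q n p "m - p"] by auto
    moreover have "(va (va h p) r, s) \<notin> G" if "r + s \<le> m - p" for r s
    proof
      assume "(va (va h p) r, s) \<in> G"
      then have "s = m"
        using relations_antichain[OF assms(1), of "p + r" s] that assms vertex_after_add[OF h, of n p r]
        by (metis add.assoc add.commute add_le_mono1 le_add_diff_inverse2 less_imp_le)
      then show False using that assms by simp
    qed
    ultimately show ?thesis by (auto simp: nonzero_path_def)
  qed
  then show ?thesis by (simp add: nzp_iff)
qed

text \<open>Converse to \<open>relation_interior_len\<close>: some generator must be responsible for
  the end of the projective at \<open>x\<close>. It ends at depth \<open>len x\<close> because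
  shorter paths from \<open>x\<close> are nonzero, and starts before depth \<open>k\<close> because
  the path from depth \<open>k\<close> to depth \<open>len x\<close> is nonzero.\<close>

lemma overshoot_relation:
  assumes x: "x \<in> {1..n}" and k: "k < len x" and over: "len x < k + len (va x k)"
  shows "\<exists>r s. (va x r, s) \<in> G \<and> r < k \<and> r + s = len x"
proof -
  have nz: "nzp (va x k, len x - k)" using over k by (simp add: nzp_iff)
  have pre: "nzp (x, len x - 1)" and nk: "nzp (x, k)" using k by (auto simp: nzp_iff)
  have "(x, len x) \<in> qpaths Q n"
    using nz nk k by (cases Q) (auto simp: nonzero_path_def vertex_after_linear)
  moreover have "\<not> nzp (x, len x)" by (simp add: nzp_iff)
  ultimately obtain r s where rs: "r + s \<le> len x" "(va x r, s) \<in> G"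
    by (auto simp: nonzero_path_def)
  have "\<not> r + s \<le> len x - 1" using pre rs by (auto simp: nonzero_path_def)
  then have eq: "r + s = len x" using rs by simp
  have "r < k"
  proof (rule ccontr)
    assume "\<not> r < k"
    then have "va (va x k) (r - k) = va x r" using vertex_after_add[of x n k "r - k"] x by auto
    moreover have "r - k + s \<le> len x - k" using eq \<open>\<not> r < k\<close> by simp
    ultimately show False using nz rs unfolding nonzero_path_def by (metis fst_conv snd_conv)
  qed
  then show ?thesis using rs eq by blast
qed

end

section \<open>The greedy Weyl filtration\<close>

text \<open>The length of the Weyl module with top \<open>x\<close>, if \<open>P(x)\<close> has length \<open>len x\<close>\<close>
definition weyl_length :: "nat \<Rightarrow> (nat \<Rightarrow> nat) \<Rightarrow> nat rel \<Rightarrow> nat \<Rightarrow> nat" where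
  "weyl_length n len r x = (GREATEST k. k \<le> len x \<and> (\<forall>t<k. (vertex_after n x t, x) \<in> r))"

lemma
  fixes n len r x
  defines "w \<equiv> weyl_length n len r x"
  shows weyl_length_le: "w \<le> len x"
    and weyl_length_below: "t < w \<Longrightarrow> (vertex_after n x t, x) \<in> r"
    and weyl_length_greatest: "k \<le> len x \<Longrightarrow> (\<And>t. t < k \<Longrightarrow> (vertex_after n x t, x) \<in> r) \<Longrightarrow> k \<le> w"
proof -
  let ?P = "\<lambda>k. k \<le> len x \<and> (\<forall>t<k. (vertex_after n x t, x) \<in> r)"
  have "?P w" unfolding w_def weyl_length_def
    by (rule GreatestI_nat[of ?P 0 "len x"]) auto
  then show "w \<le> len x" "t < w \<Longrightarrow> (vertex_after n x t, x) \<in> r" by auto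
  show "k \<le> len x \<Longrightarrow> (\<And>t. t < k \<Longrightarrow> (vertex_after n x t, x) \<in> r) \<Longrightarrow> k \<le> w"
    unfolding w_def weyl_length_def by (rule Greatest_le_nat[of ?P _ "len x"]) auto
qed

text \<open>The depths in \<open>P(x)\<close> at which a layer starts when Weyl modules are split off greedily from the top\<close>
inductive weyl_depth :: "nat \<Rightarrow> (nat \<Rightarrow> nat) \<Rightarrow> nat rel \<Rightarrow> nat \<Rightarrow> nat \<Rightarrow> bool" for n len r x where
  zero: "weyl_depth n len r x 0"
| step: "weyl_depth n len r x k \<Longrightarrow>
    weyl_depth n len r x (k + weyl_length n len r (vertex_after n x k))"

text \<open>The maximal element of \<open>Hod(g)\<close> does not lie in \<open>Int(g)\<close>.\<close>
definition peak_at_end :: "nat \<Rightarrow> nat rel \<Rightarrow> qpath \<Rightarrow> bool" where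
  "peak_at_end n r g \<longleftrightarrow> (\<forall>p. 0 < p \<and> p < snd g \<longrightarrow>
     (\<exists>t\<le>snd g. (vertex_after n (fst g) t, vertex_after n (fst g) p) \<notin> r))"

text \<open>The layers tile the depths below \<open>m\<close> without gaps, and the layer covering
  \<open>p\<close> is itself complete by depth \<open>m\<close>.\<close>

lemma weyl_depth_around:
  assumes "weyl_depth n len r x m" "p < m"
  shows "\<exists>k\<le>p. p < k + weyl_length n len r (vertex_after n x k) \<and>
           k + weyl_length n len r (vertex_after n x k) \<le> m"
  using assms
proof induction
  case zero
  then show ?case by simp
next
  case (step k)
  show ?case
  proof (cases "p < k")
    case True
    with step show ?thesis by (meson le_add1 order_trans)
  next
    case False
    with step show ?thesis by (intro exI[of _ k]) auto
  qed
qed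

section \<open>Exactness of the greedy process in terms of generators\<close>

context path_relations
begin

abbreviation wl where "wl \<equiv> weyl_length n len"
abbreviation wd where "wd \<equiv> weyl_depth n len"

lemma weyl_length_pos:
  assumes "linear_order_on {1..n} r" "x \<in> {1..n}" shows "wl r x \<ge> 1"
proof (rule weyl_length_greatest)
  show "1 \<le> len x" using len_pos assms by simp
  have "(x, x) \<in> r" using assms by (auto simp: order_on_defs refl_on_def)
  then show "(va x t, x) \<in> r" if "t < 1" for t using that assms vertex_after_0 by auto
qed

text \<open>The generator supplied by \<open>overshoot_relation\<close> ends at depth
  \<open>len x\<close> and has depth \<open>k\<close> in its interior, so a maximum at depth
  \<open>k\<close> violates \<open>peak_at_end\<close>. Both possible failures, a repeated top and
  an overshooting layer, are refuted this way.\<close>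

lemma relation_contra:
  assumes x: "x \<in> {1..n}" and k: "k < len x" and over: "len x < k + len (va x k)"
    and max: "\<And>t. t \<le> len x \<Longrightarrow> (va x t, va x k) \<in> r"
    and ends: "\<And>g. g \<in> G \<Longrightarrow> peak_at_end n r g"
  shows False
proof -
  obtain a s where g: "(va x a, s) \<in> G" "a < k" "a + s = len x"
    using overshoot_relation[OF x k over] by blast
  have x1: "x \<ge> 1" using x by simp
  have "va (va x a) (k - a) = va x k" using vertex_after_add[OF x1] g by simp
  moreover have "(va (va x a) t, va x k) \<in> r" if "t \<le> s" for t
    using max[of "a + t"] that g vertex_after_add[OF x1] by simp
  ultimately show False using ends[OF g(1)] g k
    unfolding peak_at_end_def by (auto dest!: spec[of _ "k - a"])
qed

text \<open>Forward, take a generator with an interior maximum at depth \<open>p\<close> and the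
  layer of the projective at its hook that covers \<open>p\<close>. It cannot start at
  \<open>p\<close>, for it would run past the end. It cannot start earlier, for its top would be the
  same maximal vertex, forcing a Weyl module with more than \<open>n\<close> factors. Backward, both
  conclusions come from \<open>relation_contra\<close>.\<close>

lemma weyl_depth_iff_relations:
  assumes r: "linear_order_on {1..n} r"
  shows "(\<forall>x\<in>{1..n}. wl r x \<le> n \<and> wd r x (len x)) \<longleftrightarrow> (\<forall>g\<in>G. peak_at_end n r g)"
    (is "?L \<longleftrightarrow> ?R")
proof
  have trans: "trans r" and antisym: "antisym r" and total: "total_on {1..n} r"
    and refl: "\<And>y. y \<in> {1..n} \<Longrightarrow> (y, y) \<in> r"
    using r by (auto simp: order_on_defs refl_on_def)
  note rng = vertex_after_range[OF n_ge_1]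
  {
    assume L: ?L
    show ?R
    proof
      fix g assume gG: "g \<in> G"
      obtain h m where g: "g = (h, m)" by (cases g)
      have hn: "h \<in> {1..n}" using gG g relations_subset qpaths_fst by blast
      then have h1: "h \<ge> 1" by simp
      have lm: "len h = m" using relation_len gG g by simp
      show "peak_at_end n r g"
      proof (rule ccontr)
        assume "\<not> peak_at_end n r g"
        then obtain p where p: "0 < p" "p < m" and max: "\<And>t. t \<le> m \<Longrightarrow> (va h t, va h p) \<in> r"
          by (auto simp: peak_at_end_def g)
        have "wd r h m" using L hn lm by auto
        from weyl_depth_around[OF this p(2)] obtain k where
          k: "k \<le> p" "p < k + wl r (va h k)" "k + wl r (va h k) \<le> m" by blast
        show False
        proof (cases "k = p")
          case True
          \<comment> \<open>Depths \<open>p\<close> to \<open>m\<close> inclusive: the denouement at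
            depth \<open>m\<close> takes part in the maximality condition although it lies just
            outside the projective at \<open>h\<close>.\<close>
          have "m - p + 1 \<le> wl r (va h p)"
          proof (rule weyl_length_greatest)
            show "m - p + 1 \<le> len (va h p)"
              using relation_interior_len[of h m p] gG g p by simp
            show "(va (va h p) t, va h p) \<in> r" if "t < m - p + 1" for t
              using max[of "p + t"] that p vertex_after_add[OF h1] by simp
          qed
          then show False using k True p by simp
        next
          case False
          then have "k < p" using k by simp
          have "(va (va h k) (p - k), va h k) \<in> r"
            by (rule weyl_length_below[where len = len]) (use k \<open>k < p\<close> in simp)
          then have "(va h p, va h k) \<in> r" using vertex_after_add[OF h1] \<open>k < p\<close> by simp
          moreover have "(va h k, va h p) \<in> r" using max \<open>k < p\<close> p by simp
          ultimately have "va h k = va h p" using antisym by (auto dest: antisymD)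
          then have "n \<le> p - k" using vertex_after_eqD[OF h1 _ \<open>k < p\<close>] by simp
          moreover have "wl r (va h k) \<le> n" using L rng by blast
          ultimately show False using k by simp
        qed
      qed
    qed
  }
  {
    assume R: ?R
    show ?L
    proof
      fix x assume x: "x \<in> {1..n}"
      then have x1: "x \<ge> 1" by simp
      have "wl r x \<le> n"
      proof (rule ccontr)
        assume "\<not> wl r x \<le> n"
        then have w: "n < wl r x" by simp
        then have nl: "n < len x" using weyl_length_le[of n len r x] by simp
        \<comment> \<open>A Weyl module with more than \<open>n\<close> factors meets its own top
          again at depth \<open>n\<close> after passing every vertex, so the vertex at depth
          \<open>n\<close> dominates all others.\<close>
        have vn: "va x n = x" using vertex_after_period[OF x1, of n 0] vertex_after_0[OF x] by simp
        have "(va x t, va x n) \<in> r" for t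
        proof -
          obtain s where "s < n" "va x s = va x t" using vertex_after_surj[OF x rng] by blast
          then show ?thesis using weyl_length_below[of s n len r x] w vn by auto
        qed
        from relation_contra[OF x nl _ this] R show False using vn n_ge_1 by auto
      qed
      \<comment> \<open>Invariant of the greedy process: the top of a layer that starts inside the
        projective dominates everything met so far.\<close>
      moreover have maximal: "k < len x \<longrightarrow> (\<forall>t\<le>k. (va x t, va x k) \<in> r)" if "wd r x k" for k
        using that
      proof induction
        case zero
        then show ?case using refl[OF rng] by auto
      next
        case (step k)
        let ?w = "wl r (va x k)"
        show ?case
        proof (intro impI allI)
          fix t assume kw: "k + ?w < len x" and t: "t \<le> k + ?w"
          \<comment> \<open>The layer ends because the next vertex is not below its top, and not
            because the projective at that top is exhausted: by \<open>len_step\<close> it has at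
            least one more factor.\<close>
          have "len x \<le> k + len (va x k)" using len_step kw by simp
          then have wl: "?w + 1 \<le> len (va x k)" using kw by simp
          have "\<exists>s<?w + 1. (va (va x k) s, va x k) \<notin> r"
            using weyl_length_greatest[where k = "?w + 1" and len = len and x = "va x k", of n r] wl
            by (metis add_le_same_cancel1 not_one_le_zero)
          then obtain s where s: "s < ?w + 1" "(va (va x k) s, va x k) \<notin> r" by blast
          moreover have "\<not> s < ?w" using weyl_length_below[of s n len r "va x k"] s by blast
          ultimately have "s = ?w" by linarith
          then have "(va x (k + ?w), va x k) \<notin> r" using s vertex_after_add[OF x1] by simp
          then have up: "(va x k, va x (k + ?w)) \<in> r"
            using total refl rng[of x k] rng[of x "k + ?w"] unfolding total_on_def by metis
          show "(va x t, va x (k + ?w)) \<in> r"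
          proof (cases "t = k + ?w")
            case True
            then show ?thesis using refl rng by simp
          next
            case False
            have "(va x t, va x k) \<in> r"
            proof (cases "t \<le> k")
              case True
              then show ?thesis using step.IH kw by simp
            next
              case False
              then have "(va (va x k) (t - k), va x k) \<in> r"
                using weyl_length_below[of "t - k" n len r "va x k"] t \<open>t \<noteq> k + ?w\<close> by simp
              then show ?thesis using vertex_after_add[OF x1] False by simp
            qed
            then show ?thesis using up trans by (auto dest: transD)
          qed
        qed
      qed
      moreover have "wd r x (len x)"
      proof -
        \<comment> \<open>The last layer boundary not beyond the end. If it falls short, the next
          layer overshoots, and its top dominates all depths up to and including
          \<open>len x\<close>.\<close>
        define k where "k = (GREATEST k. wd r x k \<and> k \<le> len x)"
        have k: "wd r x k" "k \<le> len x"
          using GreatestI_nat[of "\<lambda>k. wd r x k \<and> k \<le> len x" 0 "len x"] weyl_depth.zero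
          unfolding k_def by auto
        have top: "j \<le> k" if "wd r x j" "j \<le> len x" for j
          using Greatest_le_nat[of "\<lambda>k. wd r x k \<and> k \<le> len x" j "len x"] that unfolding k_def by auto
        have "k = len x"
        proof (rule ccontr)
          assume "k \<noteq> len x"
          then have kl: "k < len x" using k by simp
          have "wl r (va x k) \<ge> 1" using weyl_length_pos r rng by blast
          then have over: "len x < k + wl r (va x k)"
            using top[OF weyl_depth.step[OF k(1)]] by linarith
          have "(va x t, va x k) \<in> r" if "t \<le> len x" for t
          proof (cases "t \<le> k")
            case True
            then show ?thesis using maximal[OF k(1)] kl by simp
          next
            case False
            then have "(va (va x k) (t - k), va x k) \<in> r"
              using weyl_length_below[of "t - k" n len r "va x k"] that over by simp
            then show ?thesis using vertex_after_add[OF x1] False by simp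
          qed
          moreover have "len x < k + len (va x k)"
            using over weyl_length_le[of n len r "va x k"] by simp
          ultimately show False using relation_contra[OF x kl] R by blast
        qed
        then show ?thesis using k by simp
      qed
      ultimately show "wl r x \<le> n \<and> wd r x (len x)" by blast
    qed
  }
qed

end

section \<open>Uniserial modules\<close>

definition vecs :: "nat \<Rightarrow> (nat \<Rightarrow> 'k::zero) set" where
  "vecs L = {x. \<forall>t\<ge>L. x t = 0}"

text \<open>In coordinates, the \<open>k\<close>-th radical power of a uniserial module of length
  \<open>L\<close>.\<close>

definition deep_vecs :: "nat \<Rightarrow> nat \<Rightarrow> (nat \<Rightarrow> 'k::zero) set" where
  "deep_vecs k L = {x \<in> vecs L. \<forall>t<k. x t = 0}"

definition unit_vec :: "nat \<Rightarrow> nat \<Rightarrow> 'k::zero_neq_one" where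
  "unit_vec k t = (if t = k then 1 else 0)"

lemma deep_vecs_0: "deep_vecs 0 L = vecs L"
  by (simp add: deep_vecs_def)

lemma deep_vecs_full: "deep_vecs L L = {\<lambda>_. 0}"
  unfolding deep_vecs_def vecs_def by (auto simp: fun_eq_iff) (metis not_less)

lemma deep_vecs_subset_iff:
  assumes "k \<le> L" "l \<le> L"
  shows "deep_vecs k L \<subseteq> (deep_vecs l L :: (nat \<Rightarrow> 'k::zero_neq_one) set) \<longleftrightarrow> l \<le> k"
proof
  assume sub: "deep_vecs k L \<subseteq> (deep_vecs l L :: (nat \<Rightarrow> 'k) set)"
  show "l \<le> k"
  proof (rule ccontr)
    assume "\<not> l \<le> k"
    then have "unit_vec k \<in> (deep_vecs k L :: (nat \<Rightarrow> 'k) set)" 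
      using assms by (auto simp: deep_vecs_def vecs_def unit_vec_def)
    then have "unit_vec k \<in> (deep_vecs l L :: (nat \<Rightarrow> 'k) set)" using sub by blast
    then show False using \<open>\<not> l \<le> k\<close> by (auto simp: deep_vecs_def unit_vec_def split: if_splits)
  qed
qed (auto simp: deep_vecs_def)

lemma vecs_add: "x \<in> vecs L \<Longrightarrow> y \<in> vecs L \<Longrightarrow> (\<lambda>t. x t + y t :: 'k::monoid_add) \<in> vecs L"
  by (simp add: vecs_def)

lemma vecs_diff: "x \<in> vecs L \<Longrightarrow> y \<in> vecs L \<Longrightarrow> (\<lambda>t. x t - y t :: 'k::group_add) \<in> vecs L"
  by (simp add: vecs_def)

text \<open>What is kept of the algebra: its elements correspond to the functions on paths that
  vanish on the zero ones. The product formula is required only for \<open>m < len i\<close>, since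
  longer paths are zero in the quotient. Uniserial modules can then be treated without cosets of the
  ideal.\<close>

locale path_coefficients =
  fixes A :: "'a ring" and \<iota> :: "'k::field \<Rightarrow> 'a" and e :: "nat \<Rightarrow> 'a"
    and n :: nat and len :: "nat \<Rightarrow> nat" and cf :: "'a \<Rightarrow> qpath \<Rightarrow> 'k"
  assumes n_pos: "n \<ge> 1"
    and len_pos: "i \<in> {1..n} \<Longrightarrow> len i \<ge> 1"
    and len_outside: "i \<notin> {1..n} \<Longrightarrow> len i = 0"
    and len_step: "k < len i \<Longrightarrow> len i \<le> k + len (vertex_after n i k)"
    and cf_bij: "bij_betw cf (carrier A) {f. \<forall>i m. len i \<le> m \<longrightarrow> f (i, m) = 0}"
    and add_closed: "\<lbrakk>a \<in> carrier A; b \<in> carrier A\<rbrakk> \<Longrightarrow> a \<oplus>\<^bsub>A\<^esub> b \<in> carrier A"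
    and cf_add: "\<lbrakk>a \<in> carrier A; b \<in> carrier A\<rbrakk> \<Longrightarrow> cf (a \<oplus>\<^bsub>A\<^esub> b) p = cf a p + cf b p"
    and mult_closed: "\<lbrakk>a \<in> carrier A; b \<in> carrier A\<rbrakk> \<Longrightarrow> a \<otimes>\<^bsub>A\<^esub> b \<in> carrier A"
    and cf_mult: "\<lbrakk>a \<in> carrier A; b \<in> carrier A; m < len i\<rbrakk> \<Longrightarrow>
      cf (a \<otimes>\<^bsub>A\<^esub> b) (i, m) = (\<Sum>r\<le>m. cf a (vertex_after n i r, m - r) * cf b (i, r))"
    and zero_closed: "\<zero>\<^bsub>A\<^esub> \<in> carrier A"
    and cf_zero: "cf \<zero>\<^bsub>A\<^esub> p = 0"
    and scalar_closed: "\<iota> c \<in> carrier A"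
    and cf_scalar: "i \<in> {1..n} \<Longrightarrow> cf (\<iota> c) (i, m) = (if m = 0 then c else 0)"
    and idem_closed: "j \<in> {1..n} \<Longrightarrow> e j \<in> carrier A"
    and cf_idem: "j \<in> {1..n} \<Longrightarrow> cf (e j) p = (if p = (j, 0) then 1 else 0)"
begin

abbreviation va where "va \<equiv> vertex_after n"

text \<open>The path from the vertex at depth \<open>r\<close> to the one at depth \<open>t\<close>
  has \<open>t - r\<close> arrows, so its coefficient in \<open>a\<close> carries the coordinate
  from \<open>r\<close> to \<open>t\<close>. Whatever would land at depth \<open>L\<close> or beyond
  is zero.\<close>

definition act :: "'a \<Rightarrow> nat \<Rightarrow> nat \<Rightarrow> (nat \<Rightarrow> 'k) \<Rightarrow> nat \<Rightarrow> 'k" where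
  "act a j L x t = (if t < L then \<Sum>r\<le>t. cf a (va j r, t - r) * x r else 0)"

text \<open>
  \<open>M\<close> is uniserial with composition factors \<open>j, \<dots>, j + L - 1\<close>, and \<open>\<Phi>\<close> takes coordinates with respect
  to a basis indexed by the depths \<open>t < L\<close>.
\<close>
definition interval_module ::
    "((nat \<Rightarrow> 'k) \<Rightarrow> 'm) \<Rightarrow> ('a, 'm) module \<Rightarrow> nat \<Rightarrow> nat \<Rightarrow> bool" where
  "interval_module \<Phi> M j L \<longleftrightarrow> j \<in> {1..n} \<and> L \<le> len j \<and>
    bij_betw \<Phi> (vecs L) (carrier M) \<and> \<Phi> (\<lambda>_. 0) = \<zero>\<^bsub>M\<^esub> \<and>
    (\<forall>x\<in>vecs L. \<forall>y\<in>vecs L. \<Phi> (\<lambda>t. x t + y t) = \<Phi> x \<oplus>\<^bsub>M\<^esub> \<Phi> y) \<and>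
    (\<forall>a\<in>carrier A. \<forall>x\<in>vecs L. a \<odot>\<^bsub>M\<^esub> \<Phi> x = \<Phi> (act a j L x))"

lemma interval_moduleD:
  assumes "interval_module \<Phi> M j L"
  shows "j \<in> {1..n}" "L \<le> len j" "inj_on \<Phi> (vecs L)" "carrier M = \<Phi> ` vecs L"
    "\<zero>\<^bsub>M\<^esub> = \<Phi> (\<lambda>_. 0)"
    "\<And>x y. x \<in> vecs L \<Longrightarrow> y \<in> vecs L \<Longrightarrow> \<Phi> x \<oplus>\<^bsub>M\<^esub> \<Phi> y = \<Phi> (\<lambda>t. x t + y t)"
    "\<And>a x. a \<in> carrier A \<Longrightarrow> x \<in> vecs L \<Longrightarrow> a \<odot>\<^bsub>M\<^esub> \<Phi> x = \<Phi> (act a j L x)"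
  using assms by (auto simp: interval_module_def bij_betw_def)

lemma act_vecs: "act a j L x \<in> vecs L"
  by (simp add: act_def vecs_def)

lemma ex_coefficients:
  assumes "\<And>i m. len i \<le> m \<Longrightarrow> f (i, m) = 0"
  shows "\<exists>a\<in>carrier A. cf a = f"
proof -
  have "f \<in> cf ` carrier A" using assms by (simp add: bij_betw_imp_surj_on[OF cf_bij])
  then show ?thesis by auto
qed

lemma ex_path_element:
  assumes "m < len i" shows "\<exists>a\<in>carrier A. cf a = (\<lambda>p. if p = (i, m) then c else 0)"
  by (rule ex_coefficients) (use assms in auto)

text \<open>A single path shifts coordinates by its number \<open>s\<close> of arrows, but only from
  depths whose vertex is \<open>i\<close>; on the cyclic quiver there may be several.\<close>

lemma act_path_element:
  assumes "cf a = (\<lambda>p. if p = (i, s) then c else 0)"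
  shows "act a j L x t = (if t < L \<and> s \<le> t \<and> va j (t - s) = i then c * x (t - s) else 0)"
proof -
  have "(\<Sum>r\<le>t. cf a (va j r, t - r) * x r) =
      (\<Sum>r\<le>t. if r = t - s then (if s \<le> t \<and> va j (t - s) = i then c * x (t - s) else 0) else 0)"
  proof (intro sum.cong refl)
    fix r assume "r \<in> {..t}"
    then have "t - r = s \<longleftrightarrow> r = t - s \<and> s \<le> t" by auto
    then show "cf a (va j r, t - r) * x r =
        (if r = t - s then (if s \<le> t \<and> va j (t - s) = i then c * x (t - s) else 0) else 0)"
      unfolding assms by simp
  qed
  then show ?thesis by (simp add: act_def)
qed

lemma act_idem:
  "y \<in> {1..n} \<Longrightarrow> act (e y) j L x t = (if t < L \<and> va j t = y then x t else 0)"
  using act_path_element[of "e y" y 0 1 j L x t] cf_idem[of y] by (auto simp: fun_eq_iff)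

lemma act_scalar:
  assumes "x \<in> vecs L"
  shows "act (\<iota> c) j L x = (\<lambda>t. c * x t)"
proof
  fix t
  have "(\<Sum>r\<le>t. cf (\<iota> c) (va j r, t - r) * x r) = (\<Sum>r\<le>t. if r = t then c * x t else 0)"
  proof (intro sum.cong refl)
    fix r assume "r \<in> {..t}"
    then show "cf (\<iota> c) (va j r, t - r) * x r = (if r = t then c * x t else 0)"
      using cf_scalar[OF vertex_after_range[OF n_pos], of c j r "t - r"] by (cases "r = t") simp_all
  qed
  then show "act (\<iota> c) j L x t = c * x t" using assms by (auto simp: act_def vecs_def)
qed

text \<open>Elimination of leading terms: a multiple of a path moves the leading coordinate of
  \<open>x\<close> to any deeper position with any value. Subtracting the result from a vector with
  that leading term leaves a deeper one, hence the induction from depth \<open>L\<close> back to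
  \<open>k\<close>.\<close>

lemma deep_vecs_generated:
  assumes L: "L \<le> len j"
    and add: "\<And>x y. x \<in> Y \<Longrightarrow> y \<in> Y \<Longrightarrow> (\<lambda>t. x t + y t) \<in> Y"
    and act: "\<And>a x. a \<in> carrier A \<Longrightarrow> x \<in> Y \<Longrightarrow> act a j L x \<in> Y"
    and zero: "(\<lambda>_. 0) \<in> Y"
    and x: "x \<in> Y" "\<And>t. t < k \<Longrightarrow> x t = 0" "x k \<noteq> 0" and k: "k < L"
  shows "deep_vecs k L \<subseteq> Y"
proof -
  have "deep_vecs t L \<subseteq> Y" if "k \<le> t" "t \<le> L" for t
    using that(2,1)
  proof (induction rule: inc_induct)
    case base
    then show ?case using zero by (simp add: deep_vecs_full)
  next
    case (step t)
    show ?case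
    proof
      fix y :: "nat \<Rightarrow> 'k" assume y: "y \<in> deep_vecs t L"
      define c where "c = y t / x k"
      have "len j \<le> k + len (va j k)" by (rule len_step) (use k L in simp)
      then have "t - k < len (va j k)" using step L by simp
      then obtain a where a: "a \<in> carrier A" "cf a = (\<lambda>p. if p = (va j k, t - k) then c else 0)"
        using ex_path_element by blast
      define z where "z = act a j L x"
      have z: "z \<in> Y" using act a x by (simp add: z_def)
      have ze: "z t' = (if t' < L \<and> t - k \<le> t' \<and> va j (t' - (t - k)) = va j k
          then c * x (t' - (t - k)) else 0)" for t'
        unfolding z_def by (rule act_path_element[OF a(2)])
      \<comment> \<open>On the cyclic quiver the path also acts at other depths with the same
        vertex, but these contribute only beyond depth \<open>t\<close>.\<close>
      have "z t' = 0" if "t' < t" for t'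
      proof (cases "t - k \<le> t'")
        case True
        then have "t' - (t - k) < k" using that by linarith
        then show ?thesis using x(2) by (simp add: ze)
      qed (simp add: ze)
      moreover have "z t = y t" using step x by (simp add: ze c_def)
      ultimately have "(\<lambda>t. y t - z t) \<in> deep_vecs (Suc t) L"
        using y act_vecs[of a j L x] by (auto simp: deep_vecs_def vecs_def z_def less_Suc_eq)
      then have "(\<lambda>t. y t - z t) \<in> Y" using step by auto
      from add[OF this z] show "y \<in> Y" by simp
    qed
  qed
  then show ?thesis using k by simp
qed

lemma act_deep_vecs: "x \<in> deep_vecs k L \<Longrightarrow> act a j L x \<in> deep_vecs k L"
  using act_vecs[of a j L x] by (auto simp: deep_vecs_def act_def)

text \<open>Uniseriality. A nonzero submodule is the radical power at the least depth where some
  member has a nonzero coordinate, by \<open>deep_vecs_generated\<close>.\<close>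

lemma interval_submodule_iff:
  assumes M: "interval_module \<Phi> M j L"
  shows "submodule N A M \<longleftrightarrow> (\<exists>k\<le>L. N = \<Phi> ` deep_vecs k L)"
proof
  note D = interval_moduleD[OF M]
  {
    assume "submodule N A M"
    then interpret submodule N A M .
    define Y where "Y = {x \<in> vecs L. \<Phi> x \<in> N}"
    have N: "N = \<Phi> ` Y" using subset D(4) by (auto simp: Y_def)
    have zero: "(\<lambda>_. 0) \<in> Y" using one_closed D(5) by (simp add: Y_def vecs_def)
    have add: "(\<lambda>t. x t + y t) \<in> Y" if "x \<in> Y" "y \<in> Y" for x y
      using that m_closed[of "\<Phi> x" "\<Phi> y"] D(6)[of x y] by (simp add: Y_def vecs_add)
    have act: "act a j L x \<in> Y" if "a \<in> carrier A" "x \<in> Y" for a x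
      using that smult_closed[of a "\<Phi> x"] D(7)[of a x] by (simp add: Y_def act_vecs)
    have "\<exists>k\<le>L. Y = deep_vecs k L"
    proof (cases "\<exists>k. \<exists>x\<in>Y. x k \<noteq> 0")
      case False
      then have "Y = {\<lambda>_. 0}" using zero by auto
      then show ?thesis using deep_vecs_full by blast
    next
      case True
      define k where "k = (LEAST k. \<exists>x\<in>Y. x k \<noteq> 0)"
      obtain x where x: "x \<in> Y" "x k \<noteq> 0" using LeastI_ex[OF True] by (auto simp: k_def)
      have low: "y t = 0" if "y \<in> Y" "t < k" for y t
        using that not_less_Least[of t "\<lambda>k. \<exists>x\<in>Y. x k \<noteq> 0"] by (auto simp: k_def)
      have kL: "k < L" using x by (auto simp: Y_def vecs_def) (meson not_less)
      have "deep_vecs k L \<subseteq> Y"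
        by (rule deep_vecs_generated[OF D(2) add act zero x(1) low[OF x(1)] x(2) kL])
      moreover have "Y \<subseteq> deep_vecs k L" using low by (auto simp: deep_vecs_def Y_def)
      ultimately show ?thesis using kL by (intro exI[of _ k]) auto
    qed
    then show "\<exists>k\<le>L. N = \<Phi> ` deep_vecs k L" using N by blast
  }
  {
    assume "\<exists>k\<le>L. N = \<Phi> ` deep_vecs k L"
    then obtain k where k: "k \<le> L" "N = \<Phi> ` deep_vecs k L" by blast
    have sub: "deep_vecs k L \<subseteq> vecs L" by (auto simp: deep_vecs_def)
    \<comment> \<open>\<open>interval_module\<close> gives no group structure in advance, so the
      inverse in the additive monoid is computed from its definition.\<close>
    have inv: "inv\<^bsub>add_monoid M\<^esub> (\<Phi> x) = \<Phi> (\<lambda>t. - x t)" if "x \<in> vecs L" for x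
      unfolding m_inv_def
    proof (rule the_equality)
      have m: "(\<lambda>t. - x t) \<in> vecs L" using that by (simp add: vecs_def)
      then show "\<Phi> (\<lambda>t. - x t) \<in> carrier (add_monoid M) \<and>
          \<Phi> x \<otimes>\<^bsub>add_monoid M\<^esub> \<Phi> (\<lambda>t. - x t) = \<one>\<^bsub>add_monoid M\<^esub> \<and>
          \<Phi> (\<lambda>t. - x t) \<otimes>\<^bsub>add_monoid M\<^esub> \<Phi> x = \<one>\<^bsub>add_monoid M\<^esub>"
        using D(4,5) D(6)[OF that m] D(6)[OF m that] by simp
      fix y assume y: "y \<in> carrier (add_monoid M) \<and>
          \<Phi> x \<otimes>\<^bsub>add_monoid M\<^esub> y = \<one>\<^bsub>add_monoid M\<^esub> \<and> y \<otimes>\<^bsub>add_monoid M\<^esub> \<Phi> x = \<one>\<^bsub>add_monoid M\<^esub>"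
      then obtain y' where y': "y' \<in> vecs L" "y = \<Phi> y'" using D(4) by auto
      then have "\<Phi> (\<lambda>t. x t + y' t) = \<Phi> (\<lambda>_. 0)" using y D(5) D(6)[OF that y'(1)] by simp
      then have "(\<lambda>t. x t + y' t) = (\<lambda>_. 0)"
        using inj_onD[OF D(3)] vecs_add[OF that y'(1)] by (simp add: vecs_def)
      then have "y' = (\<lambda>t. - x t)" by (auto simp: fun_eq_iff add_eq_0_iff)
      then show "y = \<Phi> (\<lambda>t. - x t)" using y' by simp
    qed
    show "submodule N A M"
    proof (intro submodule.intro subgroup.intro submodule_axioms.intro)
      show "N \<subseteq> carrier (add_monoid M)" using D(4) sub k by auto
      show "\<one>\<^bsub>add_monoid M\<^esub> \<in> N" using D(5) k by (auto simp: deep_vecs_def vecs_def)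
      show "x \<otimes>\<^bsub>add_monoid M\<^esub> y \<in> N" if xy: "x \<in> N" "y \<in> N" for x y
      proof -
        obtain u v where uv: "u \<in> deep_vecs k L" "v \<in> deep_vecs k L" "x = \<Phi> u" "y = \<Phi> v"
          using xy k by blast
        then have "(\<lambda>t. u t + v t) \<in> deep_vecs k L" by (simp add: deep_vecs_def vecs_def)
        moreover have "x \<otimes>\<^bsub>add_monoid M\<^esub> y = \<Phi> (\<lambda>t. u t + v t)"
          using uv sub D(6)[of u v] by auto
        ultimately show ?thesis using k by blast
      qed
      show "inv\<^bsub>add_monoid M\<^esub> x \<in> N" if xN: "x \<in> N" for x
      proof -
        obtain u where u: "u \<in> deep_vecs k L" "x = \<Phi> u" using xN k by blast
        then have "(\<lambda>t. - u t) \<in> deep_vecs k L" by (simp add: deep_vecs_def vecs_def)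
        then show ?thesis using inv[of u] u sub k by auto
      qed
      show "a \<odot>\<^bsub>M\<^esub> x \<in> N" if aA: "a \<in> carrier A" and xN: "x \<in> N" for a x
      proof -
        obtain u where u: "u \<in> deep_vecs k L" "x = \<Phi> u" using xN k by blast
        then show ?thesis using act_deep_vecs[OF u(1), of a j] D(7)[OF aA, of u] sub k by auto
      qed
    qed
  }
qed

lemma interval_image_subset_iff:
  assumes "interval_module \<Phi> M j L" "k \<le> L" "l \<le> L"
  shows "\<Phi> ` deep_vecs k L \<subseteq> \<Phi> ` deep_vecs l L \<longleftrightarrow> l \<le> k"
proof -
  have sub: "deep_vecs i L \<subseteq> (vecs L :: (nat \<Rightarrow> 'k) set)" for i by (auto simp: deep_vecs_def)
  have "\<Phi> x \<in> \<Phi> ` deep_vecs l L \<longleftrightarrow> x \<in> deep_vecs l L" if "x \<in> deep_vecs k L" for x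
    using inj_on_image_mem_iff[OF interval_moduleD(3)[OF assms(1)] _ sub] that sub[of k] by blast
  then have "\<Phi> ` deep_vecs k L \<subseteq> \<Phi> ` deep_vecs l L \<longleftrightarrow> deep_vecs k L \<subseteq> (deep_vecs l L :: (nat \<Rightarrow> 'k) set)"
    unfolding image_subset_iff by blast
  then show ?thesis using deep_vecs_subset_iff[OF assms(2,3)] by blast
qed

text \<open>The action depends on the top only through the vertices met, so vectors supported from
  depth \<open>k\<close> on behave like vectors of the module with top \<open>va j k\<close>. This
  yields subquotients and, for \<open>k = n\<close>, an endomorphism.\<close>

lemma act_shift:
  assumes j: "j \<ge> 1" and x: "\<And>s. k \<le> s \<Longrightarrow> s \<le> t \<Longrightarrow> y s = x (s - k)" and y0: "\<And>s. s < k \<Longrightarrow> y s = 0"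
    and t: "k \<le> t" "t < L" "t - k < L'"
  shows "act a j L y t = act a (va j k) L' x (t - k)"
proof -
  have "(\<Sum>r\<le>t. cf a (va j r, t - r) * y r) = (\<Sum>r\<in>{k..t}. cf a (va j r, t - r) * y r)"
    by (rule sum.mono_neutral_right) (auto simp: y0)
  also have "\<dots> = (\<Sum>r\<le>t - k. cf a (va j (r + k), t - (r + k)) * y (r + k))"
    using t by (intro sum.reindex_bij_witness[of _ "\<lambda>r. r + k" "\<lambda>r. r - k"]) auto
  also have "\<dots> = (\<Sum>r\<le>t - k. cf a (va (va j k) r, t - k - r) * x r)"
    using t j by (intro sum.cong) (auto simp: x vertex_after_add add.commute)
  finally show ?thesis using t by (simp add: act_def)
qed

text \<open>The quotient of the \<open>k\<close>-th by the \<open>l\<close>-th radical power sees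
  exactly the depths \<open>k\<close> to \<open>l - 1\<close>. As all submodules are radical powers,
  every subquotient is again an interval module.\<close>

lemma interval_subquot:
  fixes M :: "('a, 'm) module"
  assumes M: "interval_module \<Phi> M j L" and kl: "k \<le> l" "l \<le> L"
  shows "\<exists>\<Psi>. interval_module \<Psi> (subquot M (\<Phi> ` deep_vecs k L) (\<Phi> ` deep_vecs l L)) (va j k) (l - k)"
proof -
  note D = interval_moduleD[OF M]
  let ?N1 = "\<Phi> ` deep_vecs k L" and ?N2 = "\<Phi> ` deep_vecs l L"
  let ?S = "subquot M ?N1 ?N2"
  \<comment> \<open>\<open>cl x\<close> is the coset of \<open>\<Phi> x\<close>, which remembers
    only the coordinates at depths less than \<open>l\<close>; \<open>emb\<close> lifts coordinates
    of the subquotient to the depths \<open>k\<close> to \<open>l - 1\<close>.\<close>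
  define cl where "cl x = \<Phi> ` {y \<in> vecs L. \<forall>t<l. y t = x t}" for x
  define emb :: "(nat \<Rightarrow> 'k) \<Rightarrow> nat \<Rightarrow> 'k" where
    "emb x t = (if k \<le> t \<and> t < l then x (t - k) else 0)" for x t
  have j1: "j \<ge> 1" using D(1) by simp
  have sub: "deep_vecs i L \<subseteq> (vecs L :: (nat \<Rightarrow> 'k) set)" for i by (auto simp: deep_vecs_def)
  have emb: "emb x \<in> deep_vecs k L" for x
    using kl by (auto simp: emb_def deep_vecs_def vecs_def)
  then have embv: "emb x \<in> vecs L" for x using sub by blast
  have coset: "?N2 +>\<^bsub>M\<lparr>carrier := ?N1\<rparr>\<^esub> \<Phi> x = cl x" if "x \<in> vecs L" for x
  proof -
    have "?N2 +>\<^bsub>M\<lparr>carrier := ?N1\<rparr>\<^esub> \<Phi> x = (\<lambda>h. \<Phi> h \<oplus>\<^bsub>M\<^esub> \<Phi> x) ` deep_vecs l L"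
      by (auto simp: a_r_coset_def r_coset_def)
    also have "\<dots> = (\<lambda>h. \<Phi> (\<lambda>t. h t + x t)) ` deep_vecs l L"
      using D(6) that sub[of l] by (intro image_cong) auto
    also have "\<dots> = \<Phi> ` ((\<lambda>h t. h t + x t) ` deep_vecs l L)" by (simp add: image_image)
    also have "(\<lambda>h t. h t + x t) ` deep_vecs l L = {y \<in> vecs L. \<forall>t<l. y t = x t}"
    proof (intro equalityI subsetI)
      fix y assume "y \<in> {y \<in> vecs L. \<forall>t<l. y t = x t}"
      then have "(\<lambda>t. y t - x t) \<in> deep_vecs l L" using vecs_diff[of y L x] that
        by (auto simp: deep_vecs_def)
      then show "y \<in> (\<lambda>h t. h t + x t) ` deep_vecs l L"
        by (rule rev_image_eqI) simp
    qed (use that in \<open>auto simp: deep_vecs_def vecs_def\<close>)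
    finally show ?thesis by (simp add: cl_def)
  qed
  have cl_cong: "cl x = cl y" if "\<And>t. t < l \<Longrightarrow> x t = y t" for x y
    using that by (auto simp: cl_def)
  have cl_inj: "x t = y t" if "cl x = cl y" "x \<in> vecs L" "y \<in> vecs L" "t < l" for x y t
  proof -
    have "\<Phi> x \<in> cl y" using that(1,2) by (auto simp: cl_def simp flip: that(1))
    then show ?thesis using that D(3) by (auto simp: cl_def dest: inj_onD)
  qed
  define \<Psi> where "\<Psi> x = cl (emb x)" for x
  have car: "carrier ?S = \<Psi> ` vecs (l - k)"
  proof -
    have "carrier ?S = (\<lambda>x. ?N2 +>\<^bsub>M\<lparr>carrier := ?N1\<rparr>\<^esub> \<Phi> x) ` deep_vecs k L"
      unfolding subquot_def quot_module_def
      by (auto simp: A_RCOSETS_def RCOSETS_def a_r_coset_def)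
    also have "\<dots> = cl ` deep_vecs k L" using coset sub[of k] by (intro image_cong) auto
    also have "\<dots> = \<Psi> ` vecs (l - k)"
    proof (intro equalityI subsetI)
      fix c assume "c \<in> cl ` deep_vecs k L"
      then obtain x where x: "x \<in> deep_vecs k L" "c = cl x" by blast
      let ?y = "\<lambda>t. if t < l - k then x (t + k) else 0"
      have "c = \<Psi> ?y" unfolding \<Psi>_def x(2)
        by (rule cl_cong) (use x in \<open>auto simp: emb_def deep_vecs_def\<close>)
      moreover have "?y \<in> vecs (l - k)" by (simp add: vecs_def)
      ultimately show "c \<in> \<Psi> ` vecs (l - k)" by blast
    qed (use emb in \<open>auto simp: \<Psi>_def\<close>)
    finally show ?thesis .
  qed
  have inj: "inj_on \<Psi> (vecs (l - k))"
  proof (rule inj_onI)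
    fix x y :: "nat \<Rightarrow> 'k" assume xy: "x \<in> vecs (l - k)" "y \<in> vecs (l - k)" "\<Psi> x = \<Psi> y"
    have "x t = y t" for t
    proof (cases "t < l - k")
      case True
      then have "emb x (t + k) = emb y (t + k)"
        using xy(3) embv unfolding \<Psi>_def by (intro cl_inj) auto
      then show ?thesis using True by (simp add: emb_def less_diff_conv)
    next
      case False
      then show ?thesis using xy by (simp add: vecs_def)
    qed
    then show "x = y" by blast
  qed
  have zero: "\<Psi> (\<lambda>_. 0) = \<zero>\<^bsub>?S\<^esub>"
    by (simp add: subquot_def quot_module_def \<Psi>_def cl_def emb_def deep_vecs_def)
  have add: "\<Psi> (\<lambda>t. x t + y t) = \<Psi> x \<oplus>\<^bsub>?S\<^esub> \<Psi> y" for x y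
  proof -
    have "\<Psi> x \<oplus>\<^bsub>?S\<^esub> \<Psi> y = {h \<oplus>\<^bsub>M\<^esub> h' | h h'. h \<in> cl (emb x) \<and> h' \<in> cl (emb y)}"
      by (auto simp: subquot_def quot_module_def \<Psi>_def set_add_def set_mult_def)
    also have "\<dots> = cl (\<lambda>t. emb x t + emb y t)"
    proof (intro equalityI subsetI)
      fix z assume "z \<in> {h \<oplus>\<^bsub>M\<^esub> h' | h h'. h \<in> cl (emb x) \<and> h' \<in> cl (emb y)}"
      then obtain u v where u: "u \<in> vecs L" "\<forall>t<l. u t = emb x t" and
        v: "v \<in> vecs L" "\<forall>t<l. v t = emb y t" and z: "z = \<Phi> u \<oplus>\<^bsub>M\<^esub> \<Phi> v"
        by (auto simp: cl_def)
      then have "z = \<Phi> (\<lambda>t. u t + v t)" using D(6) by simp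
      then show "z \<in> cl (\<lambda>t. emb x t + emb y t)"
        unfolding cl_def using u v vecs_add[of u L v] by auto
    next
      fix z assume "z \<in> cl (\<lambda>t. emb x t + emb y t)"
      then obtain w where w: "w \<in> vecs L" "\<forall>t<l. w t = emb x t + emb y t" "z = \<Phi> w"
        by (auto simp: cl_def)
      let ?v = "\<lambda>t. w t - emb x t"
      have v: "?v \<in> vecs L" using vecs_diff[OF w(1) embv[of x]] .
      have "z = \<Phi> (emb x) \<oplus>\<^bsub>M\<^esub> \<Phi> ?v" using D(6)[OF embv[of x] v] w by simp
      moreover have "\<Phi> (emb x) \<in> cl (emb x)" using embv by (auto simp: cl_def)
      moreover have "\<Phi> ?v \<in> cl (emb y)" using v w by (auto simp: cl_def)
      ultimately show "z \<in> {h \<oplus>\<^bsub>M\<^esub> h' | h h'. h \<in> cl (emb x) \<and> h' \<in> cl (emb y)}" by blast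
    qed
    also have "\<dots> = \<Psi> (\<lambda>t. x t + y t)" unfolding \<Psi>_def by (rule cl_cong) (simp add: emb_def)
    finally show ?thesis by simp
  qed
  have smult: "a \<odot>\<^bsub>?S\<^esub> \<Psi> x = \<Psi> (act a (va j k) (l - k) x)" if a: "a \<in> carrier A" for a x
  proof -
    \<comment> \<open>Scalar multiplication on a quotient module is a union over representatives;
      all of them give the same coset, and there is at least one.\<close>
    have "a \<odot>\<^bsub>?S\<^esub> \<Psi> x = (\<Union>m\<in>cl (emb x). ?N2 +>\<^bsub>M\<lparr>carrier := ?N1\<rparr>\<^esub> (a \<odot>\<^bsub>M\<^esub> m))"
      by (simp add: subquot_def quot_module_def \<Psi>_def)
    also have "\<dots> = (\<Union>m\<in>cl (emb x). \<Psi> (act a (va j k) (l - k) x))"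
    proof (intro SUP_cong refl)
      fix m assume "m \<in> cl (emb x)"
      then obtain y where y: "y \<in> vecs L" "\<forall>t<l. y t = emb x t" "m = \<Phi> y" by (auto simp: cl_def)
      have "?N2 +>\<^bsub>M\<lparr>carrier := ?N1\<rparr>\<^esub> (a \<odot>\<^bsub>M\<^esub> m) = cl (act a j L y)"
        using D(7)[OF a y(1)] coset[OF act_vecs] y(3) by simp
      also have "\<dots> = \<Psi> (act a (va j k) (l - k) x)" unfolding \<Psi>_def
      proof (rule cl_cong)
        fix t assume t: "t < l"
        show "act a j L y t = emb (act a (va j k) (l - k) x) t"
        proof (cases "k \<le> t")
          case True
          have "act a j L y t = act a (va j k) (l - k) x (t - k)"
            by (rule act_shift) (use j1 y t kl True in \<open>auto simp: emb_def\<close>)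
          then show ?thesis using True t by (simp add: emb_def)
        next
          case False
          then show ?thesis using y t by (auto simp: emb_def act_def)
        qed
      qed
      finally show "?N2 +>\<^bsub>M\<lparr>carrier := ?N1\<rparr>\<^esub> (a \<odot>\<^bsub>M\<^esub> m) = \<Psi> (act a (va j k) (l - k) x)" .
    qed
    also have "\<dots> = \<Psi> (act a (va j k) (l - k) x)"
    proof -
      have "\<Phi> (emb x) \<in> cl (emb x)" using embv by (auto simp: cl_def)
      then show ?thesis by auto
    qed
    finally show ?thesis .
  qed
  have "l - k \<le> len (va j k)"
  proof (cases "k < l")
    case True
    then have "len j \<le> k + len (va j k)" using len_step[of k j] kl D(2) by simp
    then show ?thesis using kl D(2) by simp
  qed simp
  then have "interval_module \<Psi> ?S (va j k) (l - k)"
    unfolding interval_module_def bij_betw_def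
    using vertex_after_range[OF n_pos] car inj zero add smult by auto
  then show ?thesis by blast
qed

text \<open>Homomorphisms are only assumed additive and compatible with the action; that they
  preserve zero comes from zero being the only additive idempotent.\<close>

lemma interval_zero_add:
  assumes M: "interval_module \<Phi> M j L" and m: "m \<in> carrier M" "m \<oplus>\<^bsub>M\<^esub> m = m"
  shows "m = \<zero>\<^bsub>M\<^esub>"
proof -
  note D = interval_moduleD[OF M]
  obtain x where x: "x \<in> vecs L" "m = \<Phi> x" using D(4) m by auto
  then have "\<Phi> (\<lambda>t. x t + x t) = \<Phi> x" using m D(6) by simp
  then have "(\<lambda>t. x t + x t) = x" using inj_onD[OF D(3)] x vecs_add by blast
  then have "x t + x t = x t" for t by metis
  then have "x t = 0" for t by (metis add_cancel_right_right)
  then have "x = (\<lambda>_. 0)" by blast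
  then show ?thesis using x D(5) by simp
qed

section \<open>Top and length as isomorphism invariants\<close>

lemma module_homsD:
  assumes "f \<in> module_homs A M N"
  shows "m \<in> carrier M \<Longrightarrow> f m \<in> carrier N"
    "m \<in> carrier M \<Longrightarrow> m' \<in> carrier M \<Longrightarrow> f (m \<oplus>\<^bsub>M\<^esub> m') = f m \<oplus>\<^bsub>N\<^esub> f m'"
    "a \<in> carrier A \<Longrightarrow> m \<in> carrier M \<Longrightarrow> f (a \<odot>\<^bsub>M\<^esub> m) = a \<odot>\<^bsub>N\<^esub> f m"
  using assms by (auto simp: module_homs_def hom_def)

lemma module_homsI:
  assumes "\<And>m. m \<in> carrier M \<Longrightarrow> f m \<in> carrier N"
    "\<And>m m'. m \<in> carrier M \<Longrightarrow> m' \<in> carrier M \<Longrightarrow> f (m \<oplus>\<^bsub>M\<^esub> m') = f m \<oplus>\<^bsub>N\<^esub> f m'"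
    "\<And>a m. a \<in> carrier A \<Longrightarrow> m \<in> carrier M \<Longrightarrow> f (a \<odot>\<^bsub>M\<^esub> m) = a \<odot>\<^bsub>N\<^esub> f m"
  shows "f \<in> module_homs A M N"
  using assms by (auto simp: module_homs_def hom_def)

lemma unit_vec_vecs: "k < L \<Longrightarrow> unit_vec k \<in> (vecs L :: (nat \<Rightarrow> 'k) set)"
  by (auto simp: vecs_def unit_vec_def)

lemma zero_vecs: "(\<lambda>_. 0) \<in> (vecs L :: (nat \<Rightarrow> 'k) set)"
  by (simp add: vecs_def)

lemma deep_vecs_vecs: "deep_vecs k L \<subseteq> (vecs L :: (nat \<Rightarrow> 'k) set)"
  by (auto simp: deep_vecs_def)

text \<open>An isomorphism puts a second coordinate system on \<open>N\<close>, so comparing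
  isomorphic modules reduces to comparing two coordinate systems on one module.\<close>

lemma interval_transport:
  assumes M: "interval_module \<Phi> M j L" and N: "interval_module \<Phi>' N j' L'"
    and f: "f \<in> module_homs A M N" and bij: "bij_betw f (carrier M) (carrier N)"
  shows "interval_module (f \<circ> \<Phi>) N j L"
proof -
  note D = interval_moduleD[OF M]
  have car: "\<Phi> x \<in> carrier M" if "x \<in> vecs L" for x using that D(4) by simp
  have z: "\<zero>\<^bsub>M\<^esub> \<in> carrier M" using D(5) car[OF zero_vecs] by simp
  have "\<zero>\<^bsub>M\<^esub> \<oplus>\<^bsub>M\<^esub> \<zero>\<^bsub>M\<^esub> = \<zero>\<^bsub>M\<^esub>" using D(5) D(6)[OF zero_vecs zero_vecs] by simp
  then have "f \<zero>\<^bsub>M\<^esub> \<oplus>\<^bsub>N\<^esub> f \<zero>\<^bsub>M\<^esub> = f \<zero>\<^bsub>M\<^esub>" using module_homsD(2)[OF f z z] by simp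
  then have "f \<zero>\<^bsub>M\<^esub> = \<zero>\<^bsub>N\<^esub>" using interval_zero_add[OF N] module_homsD(1)[OF f z] by blast
  moreover have "bij_betw (f \<circ> \<Phi>) (vecs L) (carrier N)"
    using bij_betw_trans[OF _ bij, of \<Phi> "vecs L"] M by (simp add: interval_module_def)
  ultimately show ?thesis
    unfolding interval_module_def
    using D(1,2,5) D(6,7)[symmetric] module_homsD(2,3)[OF f] car by simp
qed

lemma interval_submodules_card:
  assumes M: "interval_module \<Phi> M j L"
  shows "card {N. submodule N A M} = Suc L"
proof -
  have "{N. submodule N A M} = (\<lambda>k. \<Phi> ` deep_vecs k L) ` {..L}"
    using interval_submodule_iff[OF M] by auto
  moreover have "inj_on (\<lambda>k. \<Phi> ` deep_vecs k L) {..L}"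
  proof (rule inj_onI)
    fix k l assume "k \<in> {..L}" "l \<in> {..L}" "\<Phi> ` deep_vecs k L = \<Phi> ` deep_vecs l L"
    then show "k = l"
      using interval_image_subset_iff[OF M, of k l] interval_image_subset_iff[OF M, of l k] by auto
  qed
  ultimately show ?thesis by (simp add: card_image)
qed

text \<open>The length is read off from the number of submodules. For the top, a generator fixed by
  \<open>e j\<close> in one system has a nonzero coordinate at depth 0 in the other, and
  \<open>e j\<close> keeps that coordinate only if \<open>j' = j\<close>. Positivity of the length
  matters, as the zero module has no top.\<close>

lemma interval_unique:
  assumes M: "interval_module \<Phi> M j L" and M': "interval_module \<Phi>' M j' L'" and pos: "0 < L'"
  shows "j = j' \<and> L = L'"
proof -
  note D = interval_moduleD[OF M] and D' = interval_moduleD[OF M']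
  have L: "L = L'" using interval_submodules_card[OF M] interval_submodules_card[OF M'] by simp
  let ?u = "unit_vec 0 :: nat \<Rightarrow> 'k"
  have u: "?u \<in> vecs L" using pos L unit_vec_vecs by simp
  then obtain x where x: "x \<in> vecs L'" "\<Phi> ?u = \<Phi>' x" using D(4) D'(4) by auto
  \<comment> \<open>Otherwise the generator lies in the radical of the second system. In the first
    system that submodule contains the vector \<open>unit_vec 0\<close> and so is the whole
    module.\<close>
  have "x 0 \<noteq> 0"
  proof
    assume "x 0 = 0"
    then have xd: "x \<in> deep_vecs 1 L'" using x by (simp add: deep_vecs_def)
    have "submodule (\<Phi>' ` deep_vecs 1 L') A M" unfolding interval_submodule_iff[OF M'] using pos by (intro exI[of _ 1]) auto
    then obtain k where k: "k \<le> L" "\<Phi>' ` deep_vecs 1 L' = \<Phi> ` deep_vecs k L"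
      using interval_submodule_iff[OF M] by blast
    have "\<Phi> ?u \<in> \<Phi> ` deep_vecs k L" using xd x(2) k(2) by auto
    then have "?u \<in> deep_vecs k L"
      using inj_on_image_mem_iff[OF D(3) u deep_vecs_vecs] by blast
    then have "k = 0" by (auto simp: deep_vecs_def unit_vec_def split: if_splits)
    then have "\<Phi>' ` deep_vecs 1 L' = \<Phi>' ` deep_vecs 0 L'"
      using k(2) D(4) D'(4) by (simp add: deep_vecs_0)
    then show False using interval_image_subset_iff[OF M', of 0 1] pos by auto
  qed
  have ej: "e j \<in> carrier A" using D(1) idem_closed by blast
  have "act (e j) j L ?u = ?u"
    using act_idem[OF D(1)] vertex_after_0[OF D(1)] pos L by (auto simp: fun_eq_iff unit_vec_def)
  then have "e j \<odot>\<^bsub>M\<^esub> \<Phi> ?u = \<Phi> ?u" using D(7)[OF ej u] by simp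
  then have "\<Phi>' (act (e j) j' L' x) = \<Phi>' x" using D'(7)[OF ej x(1)] x(2) by simp
  then have "act (e j) j' L' x = x" using inj_onD[OF D'(3)] act_vecs x(1) by blast
  then have "act (e j) j' L' x 0 = x 0" by simp
  then have "j' = j"
    using \<open>x 0 \<noteq> 0\<close> act_idem[OF D(1)] vertex_after_0[OF D'(1)] by (auto split: if_splits)
  then show ?thesis using L by simp
qed

lemma interval_iso_iff:
  assumes M: "interval_module \<Phi> M j L" and N: "interval_module \<Phi>' N j' L'" and pos: "0 < L'"
  shows "module_iso A M N \<longleftrightarrow> j = j' \<and> L = L'"
proof
  assume "module_iso A M N"
  then obtain f where "f \<in> module_homs A M N" "bij_betw f (carrier M) (carrier N)"
    by (auto simp: module_iso_def)
  then have "interval_module (f \<circ> \<Phi>) N j L" using interval_transport[OF M N] by blast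
  then show "j = j' \<and> L = L'" using interval_unique[OF _ N pos] by blast
next
  assume eq: "j = j' \<and> L = L'"
  note D = interval_moduleD[OF M] and D' = interval_moduleD[OF N]
  define g where "g = inv_into (vecs L) \<Phi>"
  have g: "g (\<Phi> x) = x" if "x \<in> vecs L" for x using that D(3) by (simp add: g_def)
  have "bij_betw (\<Phi>' \<circ> g) (carrier M) (carrier N)"
  proof (rule bij_betw_trans)
    show "bij_betw g (carrier M) (vecs L)"
      unfolding g_def using M by (intro bij_betw_inv_into) (simp add: interval_module_def)
    show "bij_betw \<Phi>' (vecs L) (carrier N)" using N eq by (simp add: interval_module_def)
  qed
  moreover have "\<Phi>' \<circ> g \<in> module_homs A M N"
  proof (rule module_homsI)
    fix m assume "m \<in> carrier M"
    then obtain x where x: "x \<in> vecs L" "m = \<Phi> x" using D(4) by auto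
    then show "(\<Phi>' \<circ> g) m \<in> carrier N" using g D'(4) eq by simp
    {
      fix a assume "a \<in> carrier A"
      then show "(\<Phi>' \<circ> g) (a \<odot>\<^bsub>M\<^esub> m) = a \<odot>\<^bsub>N\<^esub> (\<Phi>' \<circ> g) m"
        using x g D(7) D'(7) eq by (simp add: act_vecs)
    }
    fix m' assume "m' \<in> carrier M"
    then obtain y where y: "y \<in> vecs L" "m' = \<Phi> y" using D(4) by auto
    then show "(\<Phi>' \<circ> g) (m \<oplus>\<^bsub>M\<^esub> m') = (\<Phi>' \<circ> g) m \<oplus>\<^bsub>N\<^esub> (\<Phi>' \<circ> g) m'"
      using x g D(6) D'(6) eq by (simp add: vecs_add)
  qed
  ultimately show "module_iso A M N" unfolding module_iso_def by blast
qed

section \<open>Composition factors of interval modules\<close>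

lemma interval_simple_at:
  assumes M: "interval_module \<Phi> M j 1"
  shows "simple_at A e j M"
proof -
  note D = interval_moduleD[OF M]
  let ?u = "unit_vec 0 :: nat \<Rightarrow> 'k"
  have u: "?u \<in> vecs 1" using unit_vec_vecs[of 0 1] by simp
  have "act (e j) j 1 ?u = ?u"
    using act_idem[OF D(1)] vertex_after_0[OF D(1)] by (auto simp: fun_eq_iff unit_vec_def)
  then have "e j \<odot>\<^bsub>M\<^esub> \<Phi> ?u = \<Phi> ?u" using D(7)[OF idem_closed[OF D(1)] u] by simp
  moreover have "?u \<noteq> (\<lambda>_. 0)" by (auto simp: unit_vec_def fun_eq_iff)
  then have nz: "\<Phi> ?u \<noteq> \<zero>\<^bsub>M\<^esub>" using inj_onD[OF D(3) _ u zero_vecs] D(5) by auto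
  moreover have uc: "\<Phi> ?u \<in> carrier M" using u D(4) by simp
  moreover have "N = {\<zero>\<^bsub>M\<^esub>} \<or> N = carrier M" if sub: "submodule N A M" for N
  proof -
    obtain k where k: "k \<le> 1" "N = \<Phi> ` deep_vecs k 1" using sub interval_submodule_iff[OF M] by blast
    then consider "k = 0" | "k = 1" by linarith
    then show ?thesis
      by cases (use k D(4,5) deep_vecs_full[of 1, where 'a = 'k] in \<open>auto simp: deep_vecs_0\<close>)
  qed
  moreover have "carrier M \<noteq> {\<zero>\<^bsub>M\<^esub>}" using nz uc by blast
  ultimately show ?thesis unfolding simple_at_def simple_module_def by metis
qed

lemma interval_idem_support:
  assumes M: "interval_module \<Phi> M j L" and y: "y \<in> {1..n}" and m: "m \<in> carrier M"
    and nz: "e y \<odot>\<^bsub>M\<^esub> m \<noteq> \<zero>\<^bsub>M\<^esub>"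
  shows "\<exists>t<L. va j t = y"
proof (rule ccontr)
  assume no: "\<not> ?thesis"
  note D = interval_moduleD[OF M]
  obtain x where x: "x \<in> vecs L" "m = \<Phi> x" using m D(4) by auto
  have "act (e y) j L x = (\<lambda>_. 0)" using no act_idem[OF y] by (auto simp: fun_eq_iff)
  then have "e y \<odot>\<^bsub>M\<^esub> m = \<zero>\<^bsub>M\<^esub>" using D(5) D(7)[OF idem_closed[OF y] x(1)] x(2) by simp
  then show False using nz by simp
qed

text \<open>Any composition series consists of radical powers, so a factor on which
  \<open>e y\<close> acts nontrivially shows \<open>y\<close> at one of its depths. Conversely the
  radical series exhibits the vertex of every depth.\<close>

lemma interval_composition_factor_iff:
  assumes M: "interval_module \<Phi> M j L" and y: "y \<in> {1..n}"
  shows "composition_factor A e M y \<longleftrightarrow> (\<exists>t<L. va j t = y)"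
proof
  note D = interval_moduleD[OF M]
  have j1: "j \<ge> 1" using D(1) by simp
  {
    assume "composition_factor A e M y"
    then obtain Ns i where Ns: "composition_series A M Ns" "Suc i < length Ns"
      and s: "simple_at A e y (subquot M (Ns ! Suc i) (Ns ! i))"
      by (auto simp: composition_factor_def)
    have "submodule (Ns ! i) A M" "submodule (Ns ! Suc i) A M" and sub: "Ns ! i \<subseteq> Ns ! Suc i"
      using Ns by (auto simp: composition_series_def module_filtration_def)
    then obtain k l where k: "k \<le> L" "Ns ! Suc i = \<Phi> ` deep_vecs k L"
      and l: "l \<le> L" "Ns ! i = \<Phi> ` deep_vecs l L"
      using interval_submodule_iff[OF M] by metis
    have kl: "k \<le> l" using sub interval_image_subset_iff[OF M l(1) k(1)] k l by simp
    obtain \<Psi> where S: "interval_module \<Psi> (subquot M (Ns ! Suc i) (Ns ! i)) (va j k) (l - k)"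
      using interval_subquot[OF M kl l(1)] k l by auto
    obtain t where "t < l - k" "va (va j k) t = y"
      using s interval_idem_support[OF S y] by (auto simp: simple_at_def)
    then show "\<exists>t<L. va j t = y"
      using l vertex_after_add[OF j1] by (intro exI[of _ "k + t"]) auto
  }
  {
    assume "\<exists>t<L. va j t = y"
    then obtain t where t: "t < L" "va j t = y" by blast
    \<comment> \<open>The radical series from zero upwards: entry \<open>i\<close> has length
      \<open>i\<close>, hence radical index \<open>L - i\<close>, and depth \<open>t\<close> appears
      as the factor at index \<open>L - Suc t\<close>.\<close>
    define Ns where "Ns = map (\<lambda>i. \<Phi> ` deep_vecs (L - i) L) [0..<Suc L]"
    have len: "length Ns = Suc L" by (simp add: Ns_def)
    have nth: "Ns ! i = \<Phi> ` deep_vecs (L - i) L" if "i \<le> L" for i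
      using that nth_map_upt[of i "Suc L" 0] by (simp add: Ns_def del: upt_Suc)
    have factor: "simple_at A e (va j (L - Suc i)) (subquot M (Ns ! Suc i) (Ns ! i))"
      if i: "Suc i < length Ns" for i
    proof -
      have "Suc i \<le> L" using i len by simp
      then have "L - i - (L - Suc i) = 1" "L - Suc i \<le> L - i" by auto
      then obtain \<Psi> where "interval_module \<Psi> (subquot M (Ns ! Suc i) (Ns ! i)) (va j (L - Suc i)) 1"
        using interval_subquot[OF M, of "L - Suc i" "L - i"] nth[of i] nth[of "Suc i"] \<open>Suc i \<le> L\<close> by auto
      then show ?thesis by (rule interval_simple_at)
    qed
    have "module_filtration A M Ns"
      unfolding module_filtration_def
    proof (intro conjI allI ballI impI)
      show ne: "Ns \<noteq> []" using len by auto
      show "hd Ns = {\<zero>\<^bsub>M\<^esub>}" using nth[of 0] ne D(5) by (simp add: hd_conv_nth deep_vecs_full)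
      show "last Ns = carrier M" using nth[of L] ne len D(4) by (simp add: last_conv_nth deep_vecs_0)
      show "submodule N A M" if NN: "N \<in> set Ns" for N
      proof -
        obtain i where "i < length Ns" "N = Ns ! i" using NN by (metis in_set_conv_nth)
        then show ?thesis unfolding interval_submodule_iff[OF M] using nth[of i] len
          by (intro exI[of _ "L - i"]) simp
      qed
      show "Ns ! i \<subseteq> Ns ! Suc i" if "Suc i < length Ns" for i
        using that len nth interval_image_subset_iff[OF M, of "L - i" "L - Suc i"] by simp
    qed
    then have "composition_series A M Ns"
      unfolding composition_series_def using factor by (auto simp: simple_at_def)
    moreover have "Suc (L - Suc t) < length Ns" using t len by simp
    moreover have "simple_at A e y (subquot M (Ns ! Suc (L - Suc t)) (Ns ! (L - Suc t)))"
      using factor[of "L - Suc t"] t len by (simp add: Suc_diff_Suc)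
    ultimately show "composition_factor A e M y" unfolding composition_factor_def by blast
  }
qed

text \<open>Right multiplication by \<open>e x\<close> keeps precisely the coefficients on paths
  starting at \<open>x\<close>; the path \<open>(x, t)\<close> becomes the basis vector at depth
  \<open>t\<close>.\<close>

lemma proj_module_interval:
  assumes x: "x \<in> {1..n}"
  shows "\<exists>\<Phi>. interval_module \<Phi> (proj_module A e x) x (len x)"
proof -
  define g where "g = inv_into (carrier A) cf"
  define ext :: "(nat \<Rightarrow> 'k) \<Rightarrow> qpath \<Rightarrow> 'k" where
    "ext c = (\<lambda>(i, m). if i = x \<and> m < len x then c m else 0)" for c
  have extS: "ext c \<in> {f. \<forall>i m. len i \<le> m \<longrightarrow> f (i, m) = 0}" for c by (auto simp: ext_def)
  define \<Phi> where "\<Phi> c = g (ext c)" for c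
  have cfP: "cf (\<Phi> c) = ext c" for c
    unfolding \<Phi>_def g_def by (rule bij_betw_inv_into_right[OF cf_bij extS])
  have PA: "\<Phi> c \<in> carrier A" for c
    unfolding \<Phi>_def g_def using bij_betw_imp_surj_on[OF cf_bij] extS by (metis inv_into_into)
  have cf_eqI: "a = b" if "a \<in> carrier A" "b \<in> carrier A" "\<And>i m. m < len i \<Longrightarrow> cf a (i, m) = cf b (i, m)" for a b
  proof -
    have "cf a (i, m) = cf b (i, m)" for i m
    proof (cases "m < len i")
      case False
      have "cf c \<in> {f. \<forall>i m. len i \<le> m \<longrightarrow> f (i, m) = 0}" if "c \<in> carrier A" for c
        using that bij_betw_imp_surj_on[OF cf_bij] by blast
      then show ?thesis using that(1,2) False by simp
    qed (use that in simp)
    then show ?thesis using that bij_betw_imp_inj_on[OF cf_bij] by (auto simp: inj_on_def fun_eq_iff)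
  qed
  have cf_ae: "cf (a \<otimes>\<^bsub>A\<^esub> e x) (i, m) = (if i = x then cf a (i, m) else 0)"
    if a: "a \<in> carrier A" and m: "m < len i" for a i m
  proof -
    have "i \<in> {1..n}" using m len_outside by (metis less_nat_zero_code)
    have "(\<Sum>r\<le>m. cf a (va i r, m - r) * cf (e x) (i, r)) = 
        (\<Sum>r\<le>m. if r = 0 then (if i = x then cf a (i, m) else 0) else 0)"
      by (rule sum.cong) (simp_all add: cf_idem[OF x] vertex_after_0[OF \<open>i \<in> {1..n}\<close>])
    then show ?thesis using cf_mult[OF a idem_closed[OF x] m] by simp
  qed
  have Pe: "\<Phi> c \<otimes>\<^bsub>A\<^esub> e x = \<Phi> c" for c
    using PA cf_ae cfP by (intro cf_eqI) (auto simp: mult_closed idem_closed[OF x] ext_def)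
  let ?P = "proj_module A e x"
  have "interval_module \<Phi> ?P x (len x)"
    unfolding interval_module_def
  proof (intro conjI ballI)
    show "x \<in> {1..n}" by (rule x)
    show "len x \<le> len x" by simp
    show "bij_betw \<Phi> (vecs (len x)) (carrier ?P)"
      unfolding bij_betw_def
    proof (intro conjI equalityI subsetI inj_onI)
      fix c d assume cd: "c \<in> vecs (len x)" "d \<in> vecs (len x)" "\<Phi> c = \<Phi> d"
      then have "ext c = ext d" using cfP by metis
      then have eq: "ext c (x, t) = ext d (x, t)" for t by simp
      have "c t = d t" for t
        using cd eq[of t] by (cases "t < len x") (auto simp: ext_def vecs_def)
      then show "c = d" by blast
    next
      fix m assume "m \<in> \<Phi> ` vecs (len x)"
      then obtain c where "m = \<Phi> c" by blast
      then have "m = \<Phi> c \<otimes>\<^bsub>A\<^esub> e x" using Pe by simp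
      then show "m \<in> carrier ?P" using PA by (auto simp: proj_module_def)
    next
      fix m assume "m \<in> carrier ?P"
      then obtain a where a: "a \<in> carrier A" "m = a \<otimes>\<^bsub>A\<^esub> e x" by (auto simp: proj_module_def)
      define c where "c t = (if t < len x then cf a (x, t) else 0)" for t
      have "m = \<Phi> c"
      proof (rule cf_eqI)
        show "m \<in> carrier A" using a mult_closed idem_closed[OF x] by simp
        show "cf m (i, t) = cf (\<Phi> c) (i, t)" if "t < len i" for i t
          using cf_ae[OF a(1) that] a that by (cases "i = x") (auto simp: cfP ext_def c_def)
      qed (rule PA)
      moreover have "c \<in> vecs (len x)" by (simp add: vecs_def c_def)
      ultimately show "m \<in> \<Phi> ` vecs (len x)" by blast
    qed
    show "\<Phi> (\<lambda>_. 0) = \<zero>\<^bsub>?P\<^esub>"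
      unfolding proj_module_def by (simp, rule cf_eqI) (auto simp: PA zero_closed cfP cf_zero ext_def)
    show "\<Phi> (\<lambda>t. c t + d t) = \<Phi> c \<oplus>\<^bsub>?P\<^esub> \<Phi> d" for c d
      unfolding proj_module_def by (simp, rule cf_eqI) (auto simp: PA add_closed cfP cf_add ext_def)
    show "a \<odot>\<^bsub>?P\<^esub> \<Phi> c = \<Phi> (act a x (len x) c)" if a: "a \<in> carrier A" for a c
    proof -
      have "a \<otimes>\<^bsub>A\<^esub> \<Phi> c = \<Phi> (act a x (len x) c)"
      proof (rule cf_eqI)
        fix i m assume m: "m < len i"
        then show "cf (a \<otimes>\<^bsub>A\<^esub> \<Phi> c) (i, m) = cf (\<Phi> (act a x (len x) c)) (i, m)"
          unfolding cf_mult[OF a PA m]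
          by (cases "i = x") (auto simp: cfP ext_def act_def intro!: sum.cong)
      qed (use a PA mult_closed in auto)
      then show ?thesis by (simp add: proj_module_def)
    qed
  qed
  then show ?thesis by blast
qed

section \<open>Weyl modules as interval modules\<close>

lemma quot_module_subquot: "quot_module M N = subquot M (carrier M) N"
  by (simp add: subquot_def)

text \<open>The candidate submodules are radical powers and form a chain. The least of them belongs
  to the longest initial stretch of vertices not exceeding \<open>x\<close>, which is what
  \<open>weyl_length\<close> measures.\<close>

lemma weyl_module_interval:
  assumes x: "x \<in> {1..n}"
  shows "\<exists>\<Psi>. interval_module \<Psi> (weyl_module A e {1..n} r x) x (weyl_length n len r x)"
proof -
  let ?P = "proj_module A e x" and ?w = "weyl_length n len r x"
  obtain \<Phi> where P: "interval_module \<Phi> ?P x (len x)" using proj_module_interval[OF x] by blast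
  note D = interval_moduleD[OF P]
  have quot: "\<exists>\<Psi>. interval_module \<Psi> (quot_module ?P (\<Phi> ` deep_vecs k (len x))) x k" if "k \<le> len x" for k
    using interval_subquot[OF P le0 that]
    unfolding quot_module_subquot D(4) deep_vecs_0 vertex_after_0[OF x] diff_zero .
  have cand: "weyl_candidates A e {1..n} r x =
      {\<Phi> ` deep_vecs k (len x) | k. k \<le> len x \<and> (\<forall>t<k. (va x t, x) \<in> r)}"
  proof -
    have "(\<forall>y\<in>{1..n}. composition_factor A e (quot_module ?P (\<Phi> ` deep_vecs k (len x))) y \<longrightarrow> (y, x) \<in> r)
        \<longleftrightarrow> (\<forall>t<k. (va x t, x) \<in> r)" if k: "k \<le> len x" for k
    proof -
      obtain \<Psi> where Q: "interval_module \<Psi> (quot_module ?P (\<Phi> ` deep_vecs k (len x))) x k"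
        using quot[OF k] by blast
      show ?thesis
        using interval_composition_factor_iff[OF Q] vertex_after_range[OF n_pos, of x] by auto
    qed
    then show ?thesis
      unfolding weyl_candidates_def interval_submodule_iff[OF P] by auto
  qed
  have w: "?w \<le> len x" by (rule weyl_length_le)
  have "(THE U. U \<in> weyl_candidates A e {1..n} r x \<and> (\<forall>W\<in>weyl_candidates A e {1..n} r x. U \<subseteq> W)) =
      \<Phi> ` deep_vecs ?w (len x)"
  proof (rule the_equality)
    show least: "\<Phi> ` deep_vecs ?w (len x) \<in> weyl_candidates A e {1..n} r x \<and>
        (\<forall>W\<in>weyl_candidates A e {1..n} r x. \<Phi> ` deep_vecs ?w (len x) \<subseteq> W)"
    proof (intro conjI ballI)
      show "\<Phi> ` deep_vecs ?w (len x) \<in> weyl_candidates A e {1..n} r x"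
        unfolding cand using w weyl_length_below[of _ n len r x] by blast
      fix W assume "W \<in> weyl_candidates A e {1..n} r x"
      then obtain k where k: "W = \<Phi> ` deep_vecs k (len x)" "k \<le> len x" "\<forall>t<k. (va x t, x) \<in> r"
        unfolding cand by blast
      then have "k \<le> ?w" using weyl_length_greatest[of k len x n r] by blast
      then show "\<Phi> ` deep_vecs ?w (len x) \<subseteq> W"
        unfolding k(1) using interval_image_subset_iff[OF P w k(2)] by blast
    qed
    fix U assume "U \<in> weyl_candidates A e {1..n} r x \<and> (\<forall>W\<in>weyl_candidates A e {1..n} r x. U \<subseteq> W)"
    then show "U = \<Phi> ` deep_vecs ?w (len x)" using least by blast
  qed
  then show ?thesis unfolding weyl_module_def using quot[OF w] by simp
qed

section \<open>Endomorphism rings of interval modules\<close>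

lemma act_smult: "act a j L (\<lambda>t. c * x t) = (\<lambda>t. c * act a j L x t)"
proof
  fix t
  show "act a j L (\<lambda>t. c * x t) t = c * act a j L x t"
    by (simp add: act_def sum_distrib_left mult.left_commute)
qed

text \<open>An endomorphism is determined by the image \<open>d\<close> of the generator. As
  \<open>e j\<close> fixes the generator it fixes \<open>d\<close>, so \<open>d\<close> lives at
  depths carrying the vertex \<open>j\<close>; with at most \<open>n\<close> depths only depth 0
  remains.\<close>

lemma interval_endo_scalar:
  assumes M: "interval_module \<Phi> M j L" and L: "0 < L" "L \<le> n" and f: "f \<in> module_homs A M M"
  shows "\<exists>c. \<forall>m\<in>carrier M. f m = \<iota> c \<odot>\<^bsub>M\<^esub> m"
proof -
  note D = interval_moduleD[OF M]
  let ?u = "unit_vec 0 :: nat \<Rightarrow> 'k"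
  have u: "?u \<in> vecs L" by (rule unit_vec_vecs[OF L(1)])
  have car: "\<Phi> x \<in> carrier M" if "x \<in> vecs L" for x using that D(4) by simp
  obtain d where d: "d \<in> vecs L" "f (\<Phi> ?u) = \<Phi> d"
    using module_homsD(1)[OF f car[OF u]] D(4) by auto
  have ej: "e j \<in> carrier A" by (rule idem_closed[OF D(1)])
  have "act (e j) j L ?u = ?u"
    using act_idem[OF D(1)] vertex_after_0[OF D(1)] L by (auto simp: fun_eq_iff unit_vec_def)
  then have "\<Phi> d = f (e j \<odot>\<^bsub>M\<^esub> \<Phi> ?u)" using D(7)[OF ej u] d by simp
  also have "\<dots> = \<Phi> (act (e j) j L d)"
    using module_homsD(3)[OF f ej car[OF u]] d D(7)[OF ej d(1)] by simp
  finally have "d = act (e j) j L d" using inj_onD[OF D(3)] d(1) act_vecs by blast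
  then have de: "d t = act (e j) j L d t" for t by simp
  have "d t = d 0 * ?u t" for t
  proof (cases "t = 0")
    case False
    have "va j t \<noteq> j" if "t < L"
      using vertex_after_eqD[of j n 0 t] vertex_after_0[OF D(1)] D(1) that False L by force
    then show ?thesis using de[of t] act_idem[OF D(1), of j L d t] False
      by (auto simp: unit_vec_def split: if_splits)
  qed (simp add: unit_vec_def)
  then have d0: "d = (\<lambda>t. d 0 * ?u t)" by blast
  show ?thesis
  proof (intro exI[of _ "d 0"] ballI)
    fix m assume "m \<in> carrier M"
    then obtain x where x: "x \<in> vecs L" "m = \<Phi> x" using D(4) by auto
    \<comment> \<open>Along the paths from \<open>j\<close>, \<open>a\<close> has the coordinates of
      \<open>x\<close> as coefficients, so it takes the generator to \<open>m\<close>.\<close>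
    obtain a where a: "a \<in> carrier A" "cf a = (\<lambda>(i, m). if i = j \<and> m < L then x m else 0)"
    proof -
      have "\<exists>a\<in>carrier A. cf a = (\<lambda>(i, m). if i = j \<and> m < L then x m else 0)"
        by (rule ex_coefficients) (use D(2) in auto)
      then show ?thesis using that by blast
    qed
    have ax: "act a j L ?u = x"
    proof
      fix t
      have "(\<Sum>r\<le>t. cf a (va j r, t - r) * ?u r) = (\<Sum>r\<le>t. if r = 0 then cf a (j, t) else 0)"
        by (rule sum.cong) (simp_all add: unit_vec_def vertex_after_0[OF D(1)])
      then show "act a j L ?u t = x t" using x(1) by (auto simp: act_def a(2) vecs_def)
    qed
    have "f m = f (a \<odot>\<^bsub>M\<^esub> \<Phi> ?u)" using D(7)[OF a(1) u] ax x by simp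
    also have "\<dots> = \<Phi> (act a j L d)"
      using module_homsD(3)[OF f a(1) car[OF u]] d D(7)[OF a(1) d(1)] by simp
    also have "\<dots> = \<Phi> (\<lambda>t. d 0 * x t)" by (subst d0) (simp only: act_smult ax)
    also have "\<dots> = \<iota> (d 0) \<odot>\<^bsub>M\<^esub> m" using D(7)[OF scalar_closed x(1)] act_scalar[OF x(1)] x(2) by simp
    finally show "f m = \<iota> (d 0) \<odot>\<^bsub>M\<^esub> m" .
  qed
qed

lemma scalar_endo:
  assumes M: "interval_module \<Phi> M j L"
  shows "(\<lambda>m\<in>carrier M. \<iota> c \<odot>\<^bsub>M\<^esub> m) \<in> module_homs A M M"
proof (rule module_homsI)
  note D = interval_moduleD[OF M]
  have sc: "\<iota> c \<odot>\<^bsub>M\<^esub> \<Phi> x = \<Phi> (\<lambda>t. c * x t)" if "x \<in> vecs L" for x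
    using D(7)[OF scalar_closed that] act_scalar[OF that] by simp
  have cv: "(\<lambda>t. c * x t) \<in> vecs L" if "x \<in> vecs L" for x using that by (simp add: vecs_def)
  fix m assume "m \<in> carrier M"
  then obtain x where x: "x \<in> vecs L" "m = \<Phi> x" using D(4) by auto
  then show "(\<lambda>m\<in>carrier M. \<iota> c \<odot>\<^bsub>M\<^esub> m) m \<in> carrier M" using D(4) sc cv by simp
  {
    fix a assume a: "a \<in> carrier A"
    then show "(\<lambda>m\<in>carrier M. \<iota> c \<odot>\<^bsub>M\<^esub> m) (a \<odot>\<^bsub>M\<^esub> m) = a \<odot>\<^bsub>M\<^esub> (\<lambda>m\<in>carrier M. \<iota> c \<odot>\<^bsub>M\<^esub> m) m"
      using x D(4) D(7)[OF a] sc cv act_vecs by (simp add: act_smult)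
  }
  fix m' assume "m' \<in> carrier M"
  then obtain y where y: "y \<in> vecs L" "m' = \<Phi> y" using D(4) by auto
  have "(\<lambda>t. x t + y t) \<in> vecs L" using x y vecs_add by blast
  with y show "(\<lambda>m\<in>carrier M. \<iota> c \<odot>\<^bsub>M\<^esub> m) (m \<oplus>\<^bsub>M\<^esub> m') =
      (\<lambda>m\<in>carrier M. \<iota> c \<odot>\<^bsub>M\<^esub> m) m \<oplus>\<^bsub>M\<^esub> (\<lambda>m\<in>carrier M. \<iota> c \<odot>\<^bsub>M\<^esub> m) m'"
    using x D(4) D(6) sc cv by (simp add: distrib_left)
qed

text \<open>The sequence of vertices repeats after \<open>n\<close> arrows, so moving every
  coordinate \<open>n\<close> depths down commutes with the action by \<open>act_shift\<close>. For
  \<open>L \<le> n\<close> the map is zero; beyond that it is a nonscalar endomorphism.\<close>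

lemma shift_endo:
  assumes M: "interval_module \<Phi> M j L"
  shows "\<exists>f\<in>module_homs A M M \<inter> extensional (carrier M).
    \<forall>x\<in>vecs L. f (\<Phi> x) = \<Phi> (\<lambda>t. if n \<le> t \<and> t < L then x (t - n) else 0)"
proof -
  note D = interval_moduleD[OF M]
  define sh :: "(nat \<Rightarrow> 'k) \<Rightarrow> nat \<Rightarrow> 'k" where
    "sh x t = (if n \<le> t \<and> t < L then x (t - n) else 0)" for x t
  have shv: "sh x \<in> vecs L" for x by (simp add: sh_def vecs_def)
  define f where "f = (\<lambda>m\<in>carrier M. \<Phi> (sh (inv_into (vecs L) \<Phi> m)))"
  have f: "f (\<Phi> x) = \<Phi> (sh x)" if "x \<in> vecs L" for x
    using that D(3,4) by (simp add: f_def)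
  have j1: "j \<ge> 1" using D(1) by simp
  have jn: "va j n = j" using vertex_after_period[OF j1, of n 0] vertex_after_0[OF D(1)] by simp
  have act_sh: "act a j L (sh x) = sh (act a j L x)" for a x
  proof
    fix t
    show "act a j L (sh x) t = sh (act a j L x) t"
    proof (cases "n \<le> t \<and> t < L")
      case True
      have "act a j L (sh x) t = act a (va j n) L x (t - n)"
        by (rule act_shift) (use j1 True in \<open>auto simp: sh_def\<close>)
      then show ?thesis using True jn by (simp add: sh_def)
    next
      case False
      then show ?thesis by (auto simp: sh_def act_def)
    qed
  qed
  have "f \<in> module_homs A M M"
  proof (rule module_homsI)
    fix m assume "m \<in> carrier M"
    then obtain x where x: "x \<in> vecs L" "m = \<Phi> x" using D(4) by auto
    then show "f m \<in> carrier M" using f D(4) shv by simp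
    show "f (a \<odot>\<^bsub>M\<^esub> m) = a \<odot>\<^bsub>M\<^esub> f m" if "a \<in> carrier A" for a
      using x f D(7)[OF that] act_vecs shv by (simp add: act_sh)
    fix m' assume "m' \<in> carrier M"
    then obtain y where y: "y \<in> vecs L" "m' = \<Phi> y" using D(4) by auto
    have "sh (\<lambda>t. x t + y t) = (\<lambda>t. sh x t + sh y t)" by (auto simp: sh_def)
    moreover have "(\<lambda>t. x t + y t) \<in> vecs L" using x y vecs_add by blast
    ultimately show "f (m \<oplus>\<^bsub>M\<^esub> m') = f m \<oplus>\<^bsub>M\<^esub> f m'" using x y f D(6) shv by simp
  qed
  moreover have "f \<in> extensional (carrier M)" by (simp add: f_def)
  ultimately show ?thesis using f unfolding sh_def by blast
qed

lemma interval_End_iff: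
  assumes M: "interval_module \<Phi> M j L" and L: "0 < L"
  shows "End_iso_field A \<iota> M \<longleftrightarrow> L \<le> n"
proof
  note D = interval_moduleD[OF M]
  let ?u = "unit_vec 0 :: nat \<Rightarrow> 'k" and ?K = "ring_of_type_algebra :: 'k ring"
  have u: "?u \<in> vecs L" by (rule unit_vec_vecs[OF L(1)])
  have uc: "\<Phi> ?u \<in> carrier M" using u D(4) by simp
  have sc: "\<iota> c \<odot>\<^bsub>M\<^esub> \<Phi> x = \<Phi> (\<lambda>t. c * x t)" if "x \<in> vecs L" for c x
    using D(7)[OF scalar_closed that] act_scalar[OF that] by simp
  have cv: "(\<lambda>t. c * x t) \<in> vecs L" if "x \<in> vecs L" for c :: 'k and x using that by (simp add: vecs_def)
  {
    assume "End_iso_field A \<iota> M"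
    then obtain \<phi> where \<phi>: "\<phi> \<in> ring_iso ?K (End_ring A M)"
      and lin: "\<And>c d m. m \<in> carrier M \<Longrightarrow> \<phi> (c * d) m = \<iota> c \<odot>\<^bsub>M\<^esub> \<phi> d m"
      by (auto simp: End_iso_field_def)
    show "L \<le> n"
    proof (rule ccontr)
      assume "\<not> L \<le> n"
      obtain f where f: "f \<in> module_homs A M M \<inter> extensional (carrier M)"
        and fx: "\<And>x. x \<in> vecs L \<Longrightarrow> f (\<Phi> x) = \<Phi> (\<lambda>t. if n \<le> t \<and> t < L then x (t - n) else 0)"
        using shift_endo[OF M] by blast
      have "f \<in> \<phi> ` UNIV"
        using \<phi> f by (auto simp: ring_iso_def bij_betw_def End_ring_def ring_of_type_algebra_def)
      then obtain c where c: "f = \<phi> c" by blast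
      have one: "\<phi> 1 = (\<lambda>m\<in>carrier M. m)"
        using \<phi> by (simp add: ring_iso_def ring_hom_def End_ring_def ring_of_type_algebra_def)
      \<comment> \<open>Linearity over the field forces \<open>\<phi> c\<close> to be multiplication
        by \<open>c\<close>, which keeps the generator at depth 0, while the shift moves it to depth
        \<open>n < L\<close>.\<close>
      have "f (\<Phi> ?u) = \<Phi> (\<lambda>t. c * ?u t)"
        using lin[OF uc, of c 1] one uc c sc[OF u] by simp
      then have "(\<lambda>t. if n \<le> t \<and> t < L then ?u (t - n) else 0) = (\<lambda>t. c * ?u t)"
        using fx[OF u] by (intro inj_onD[OF D(3)] cv[OF u]) (simp_all add: vecs_def)
      from fun_cong[OF this, of n] show False
        using \<open>\<not> L \<le> n\<close> n_pos by (simp add: unit_vec_def)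
    qed
  }
  {
    assume Ln: "L \<le> n"
    define \<phi> where "\<phi> c = (\<lambda>m\<in>carrier M. \<iota> c \<odot>\<^bsub>M\<^esub> m)" for c
    have scc: "\<iota> c \<odot>\<^bsub>M\<^esub> m \<in> carrier M" if "m \<in> carrier M" for c m
      using that sc cv D(4) by auto
    have scm: "\<iota> (c * d) \<odot>\<^bsub>M\<^esub> m = \<iota> c \<odot>\<^bsub>M\<^esub> (\<iota> d \<odot>\<^bsub>M\<^esub> m)" if "m \<in> carrier M" for c d m
      using that sc cv D(4) by (auto simp: mult.assoc)
    have sca: "\<iota> (c + d) \<odot>\<^bsub>M\<^esub> m = (\<iota> c \<odot>\<^bsub>M\<^esub> m) \<oplus>\<^bsub>M\<^esub> (\<iota> d \<odot>\<^bsub>M\<^esub> m)" if "m \<in> carrier M" for c d m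
      using that sc cv D(4,6) by (auto simp: distrib_right)
    have sc1: "\<iota> 1 \<odot>\<^bsub>M\<^esub> m = m" if "m \<in> carrier M" for m
      using that sc D(4) by auto
    have "\<phi> \<in> ring_iso ?K (End_ring A M)"
      unfolding ring_iso_def mem_Collect_eq
    proof (intro conjI)
      show "\<phi> \<in> ring_hom ?K (End_ring A M)"
        unfolding ring_hom_def mem_Collect_eq
        by (intro conjI ballI Pi_I)
          (use scalar_endo[OF M] in \<open>auto simp: End_ring_def ring_of_type_algebra_def \<phi>_def compose_def
             fun_eq_iff scc scm sca sc1\<close>)
      show "bij_betw \<phi> (carrier ?K) (carrier (End_ring A M))"
        unfolding bij_betw_def
      proof (intro conjI inj_onI equalityI subsetI)
        fix c d assume "\<phi> c = \<phi> d"
        then have "\<phi> c (\<Phi> ?u) = \<phi> d (\<Phi> ?u)" by simp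
        then have "\<Phi> (\<lambda>t. c * ?u t) = \<Phi> (\<lambda>t. d * ?u t)" using uc sc[OF u] by (simp add: \<phi>_def)
        then have "(\<lambda>t. c * ?u t) = (\<lambda>t. d * ?u t)" using inj_onD[OF D(3)] cv[OF u] by blast
        from fun_cong[OF this, of 0] show "c = d" by (simp add: unit_vec_def)
      next
        fix f assume "f \<in> \<phi> ` carrier ?K"
        then show "f \<in> carrier (End_ring A M)"
          using scalar_endo[OF M] by (auto simp: End_ring_def \<phi>_def)
      next
        fix f assume "f \<in> carrier (End_ring A M)"
        then have f: "f \<in> module_homs A M M" "f \<in> extensional (carrier M)" by (auto simp: End_ring_def)
        obtain c where "\<forall>m\<in>carrier M. f m = \<iota> c \<odot>\<^bsub>M\<^esub> m"
          using interval_endo_scalar[OF M L Ln f(1)] by blast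
        then have "f = \<phi> c" using f(2) by (intro extensionalityI[of f "carrier M"]) (auto simp: \<phi>_def)
        then show "f \<in> \<phi> ` carrier ?K" by (auto simp: ring_of_type_algebra_def)
      qed
    qed
    moreover have "\<phi> (c * d) m = \<iota> c \<odot>\<^bsub>M\<^esub> \<phi> d m" if "m \<in> carrier M" for c d m
      using that scm by (simp add: \<phi>_def)
    ultimately show "End_iso_field A \<iota> M" unfolding End_iso_field_def by blast
  }
qed

text \<open>Nonzero interval modules are determined by top and length, so a layer starting at depth
  \<open>k\<close> must have the Weyl length of the vertex there. Hence the greedy process is the
  only possible source of a good filtration.\<close>

lemma interval_good_iff:
  assumes M: "interval_module \<Phi> M j L"
    and pos: "\<And>y. y \<in> {1..n} \<Longrightarrow> 0 < weyl_length n len r y"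
  shows "good_module A e {1..n} r M \<longleftrightarrow> weyl_depth n len r j L"
proof
  note D = interval_moduleD[OF M]
  let ?w = "weyl_length n len r" and ?F = "\<lambda>k. \<Phi> ` deep_vecs k L"
  have layer: "(\<exists>y\<in>{1..n}. module_iso A (subquot M (?F k) (?F l)) (weyl_module A e {1..n} r y)) \<longleftrightarrow>
      l = k + ?w (va j k)" if kl: "k \<le> l" "l \<le> L" for k l
  proof -
    obtain \<Psi> where S: "interval_module \<Psi> (subquot M (?F k) (?F l)) (va j k) (l - k)"
      using interval_subquot[OF M kl] by blast
    have "module_iso A (subquot M (?F k) (?F l)) (weyl_module A e {1..n} r y) \<longleftrightarrow>
        va j k = y \<and> l - k = ?w y" if y: "y \<in> {1..n}" for y
    proof -
      obtain \<Psi>' where W: "interval_module \<Psi>' (weyl_module A e {1..n} r y) y (?w y)"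
        using weyl_module_interval[OF y] by blast
      show ?thesis by (rule interval_iso_iff[OF S W pos[OF y]])
    qed
    then show ?thesis using vertex_after_range[OF n_pos, of j k] kl by auto
  qed
  {
    assume "good_module A e {1..n} r M"
    then obtain Ns where Ns: "module_filtration A M Ns" and iso: "\<And>i. Suc i < length Ns \<Longrightarrow>
        \<exists>y\<in>{1..n}. module_iso A (subquot M (Ns ! Suc i) (Ns ! i)) (weyl_module A e {1..n} r y)"
      by (auto simp: good_module_def)
    have ne: "Ns \<noteq> []" using Ns by (simp add: module_filtration_def)
    \<comment> \<open>Filtrations are listed from zero up, whereas layers are split off from the
      top; the induction therefore runs backwards from the last entry, the whole module.\<close>
    have step: "weyl_depth n len r j k" if "i < length Ns" "k \<le> L" "Ns ! (length Ns - 1 - i) = ?F k" for i k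
      using that
    proof (induction i arbitrary: k)
      case 0
      then have "?F k = ?F 0" using Ns ne D(4) by (simp add: module_filtration_def last_conv_nth deep_vecs_0)
      then have "k = 0" using interval_image_subset_iff[OF M, of 0 k] 0 by simp
      then show ?case by (simp add: weyl_depth.zero)
    next
      case (Suc i)
      define p where "p = length Ns - 1 - Suc i"
      have p: "Suc p = length Ns - 1 - i" "Suc p < length Ns" using Suc.prems by (auto simp: p_def)
      have "submodule (Ns ! Suc p) A M" using Ns p by (simp add: module_filtration_def)
      then obtain k' where k': "k' \<le> L" "Ns ! Suc p = ?F k'" using interval_submodule_iff[OF M] by blast
      have "weyl_depth n len r j k'" using Suc.IH[of k'] Suc.prems k' p by simp
      moreover have pk: "Ns ! p = ?F k" using Suc.prems(3) by (simp add: p_def)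
      have "Ns ! p \<subseteq> Ns ! Suc p" using Ns p(2) by (simp add: module_filtration_def)
      then have "k' \<le> k" using interval_image_subset_iff[OF M, of k k'] k' pk Suc.prems(2) by simp
      then have "k = k' + ?w (va j k')" using layer[of k' k] iso[OF p(2)] k' pk Suc.prems(2) by simp
      ultimately show ?case using weyl_depth.step by metis
    qed
    have "Ns ! 0 = ?F L"
      using Ns ne D(5) by (simp add: module_filtration_def hd_conv_nth deep_vecs_full)
    then show "weyl_depth n len r j L" using step[of "length Ns - 1" L] ne by simp
  }
  {
    \<comment> \<open>Each further layer prepends a smaller submodule to a partial filtration that
      starts at depth \<open>k\<close> and ends with the whole module; at depth \<open>L\<close> it
      starts with zero.\<close>
    have build: "k \<le> L \<Longrightarrow> \<exists>Ns. Ns \<noteq> [] \<and> hd Ns = ?F k \<and> last Ns = carrier M \<and> (\<forall>N\<in>set Ns. submodule N A M) \<and>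
        (\<forall>i. Suc i < length Ns \<longrightarrow> Ns ! i \<subseteq> Ns ! Suc i \<and>
          (\<exists>y\<in>{1..n}. module_iso A (subquot M (Ns ! Suc i) (Ns ! i)) (weyl_module A e {1..n} r y)))"
      if "weyl_depth n len r j k" for k
      using that
    proof induction
      case zero
      have "submodule (carrier M) A M" 
        unfolding interval_submodule_iff[OF M] D(4) by (intro exI[of _ 0]) (simp add: deep_vecs_0)
      then show ?case using D(4) by (intro exI[of _ "[carrier M]"]) (simp add: deep_vecs_0)
    next
      case (step k)
      let ?l = "k + ?w (va j k)"
      have kL: "k \<le> L" using step.prems by simp
      obtain Ns where Ns: "Ns \<noteq> []" "hd Ns = ?F k" "last Ns = carrier M" "\<forall>N\<in>set Ns. submodule N A M"
        "\<forall>i. Suc i < length Ns \<longrightarrow> Ns ! i \<subseteq> Ns ! Suc i \<and>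
          (\<exists>y\<in>{1..n}. module_iso A (subquot M (Ns ! Suc i) (Ns ! i)) (weyl_module A e {1..n} r y))"
        using step.IH[OF kL] by (elim exE conjE) rule
      let ?Ns = "?F ?l # Ns"
      have N0: "Ns ! 0 = ?F k" using Ns by (simp add: hd_conv_nth)
      have "?Ns ! i \<subseteq> ?Ns ! Suc i \<and>
          (\<exists>y\<in>{1..n}. module_iso A (subquot M (?Ns ! Suc i) (?Ns ! i)) (weyl_module A e {1..n} r y))"
        if i: "Suc i < length ?Ns" for i
      proof (cases i)
        case 0
        then show ?thesis using N0 layer[of k ?l] step.prems interval_image_subset_iff[OF M, of ?l k] by simp
      next
        case (Suc i')
        then show ?thesis using Ns(5)[rule_format, of i'] i by simp
      qed
      moreover have "submodule (?F ?l) A M"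
        unfolding interval_submodule_iff[OF M] using step.prems by blast
      ultimately show ?case using Ns(1-4) by (intro exI[of _ ?Ns]) auto
    qed
    assume "weyl_depth n len r j L"
    from build[OF this] obtain Ns where "Ns \<noteq> []" "hd Ns = ?F L" "last Ns = carrier M"
      "\<forall>N\<in>set Ns. submodule N A M" "\<forall>i. Suc i < length Ns \<longrightarrow> Ns ! i \<subseteq> Ns ! Suc i \<and>
          (\<exists>y\<in>{1..n}. module_iso A (subquot M (Ns ! Suc i) (Ns ! i)) (weyl_module A e {1..n} r y))"
      by blast
    moreover have "?F L = {\<zero>\<^bsub>M\<^esub>}" using D(5) by (simp add: deep_vecs_full)
    ultimately show "good_module A e {1..n} r M"
      unfolding good_module_def module_filtration_def by (intro exI[of _ Ns]) simp
  }
qed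

lemma q_ordering_iff:
  "q_ordering A \<iota> e {1..n} r \<longleftrightarrow> linear_order_on {1..n} r \<and>
    (\<forall>x\<in>{1..n}. weyl_length n len r x \<le> n \<and> weyl_depth n len r x (len x))"
proof -
  have "End_iso_field A \<iota> (weyl_module A e {1..n} r x) \<and> good_module A e {1..n} r (proj_module A e x) \<longleftrightarrow>
      weyl_length n len r x \<le> n \<and> weyl_depth n len r x (len x)"
    if r: "linear_order_on {1..n} r" and x: "x \<in> {1..n}" for x
  proof -
    have pos: "0 < weyl_length n len r y" if y: "y \<in> {1..n}" for y
    proof -
      have "(y, y) \<in> r" using r y by (auto simp: order_on_defs refl_on_def)
      then have "1 \<le> weyl_length n len r y"
        using len_pos[OF y] vertex_after_0[OF y] by (intro weyl_length_greatest) auto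
      then show ?thesis by simp
    qed
    obtain \<Psi> where W: "interval_module \<Psi> (weyl_module A e {1..n} r x) x (weyl_length n len r x)"
      using weyl_module_interval[OF x] by blast
    obtain \<Phi> where P: "interval_module \<Phi> (proj_module A e x) x (len x)"
      using proj_module_interval[OF x] by blast
    show ?thesis using interval_End_iff[OF W pos[OF x]] interval_good_iff[OF P pos] by simp
  qed
  then show ?thesis unfolding q_ordering_def by blast
qed

end

section \<open>The path algebra and its quotients\<close>

lemma path_algebra_sel:
  "carrier (path_algebra Q n) = {f. finite {p. f p \<noteq> 0} \<and> {p. f p \<noteq> 0} \<subseteq> qpaths Q n}"
  "(f \<otimes>\<^bsub>path_algebra Q n\<^esub> g) (i, m) = (\<Sum>r\<le>m. f (vertex_after n i r, m - r) * g (i, r))"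
  "\<one>\<^bsub>path_algebra Q n\<^esub> (i, m) = (if i \<in> {1..n} \<and> m = 0 then 1 else 0)"
  "\<zero>\<^bsub>path_algebra Q n\<^esub> = (\<lambda>_. 0)"
  "f \<oplus>\<^bsub>path_algebra Q n\<^esub> g = (\<lambda>p. f p + g p)"
  by (simp_all add: path_algebra_def)

lemma path_mult_nonzero:
  assumes "(f \<otimes>\<^bsub>path_algebra Q n\<^esub> g) (i, m) \<noteq> (0 :: 'k::field)"
  shows "\<exists>r\<le>m. f (vertex_after n i r, m - r) \<noteq> 0 \<and> g (i, r) \<noteq> 0"
proof (rule ccontr)
  assume no: "\<not> ?thesis"
  have "(\<Sum>r\<le>m. f (vertex_after n i r, m - r) * g (i, r)) = 0"
    by (rule sum.neutral) (use no in auto)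
  then show False using assms by (simp add: path_algebra_sel)
qed

lemma path_algebra_support:
  assumes "f \<in> carrier (path_algebra Q n)" "f (i, m) \<noteq> (0 :: 'k::field)"
  shows "(i, m) \<in> qpaths Q n" "i \<in> {1..n}"
proof -
  show "(i, m) \<in> qpaths Q n" using assms by (auto simp: path_algebra_sel)
  then show "i \<in> {1..n}" by (rule qpaths_fst)
qed

lemma qpaths_concat:
  assumes "(i, r) \<in> qpaths Q n" "(vertex_after n i r, s) \<in> qpaths Q n"
  shows "(i, r + s) \<in> qpaths Q n"
  using assms by (cases Q) (auto simp: vertex_after_linear)

lemma path_mult_closed:
  assumes f: "f \<in> carrier (path_algebra Q n)"
    and g: "g \<in> carrier (path_algebra Q n :: (qpath \<Rightarrow> 'k::field) ring)"
  shows "f \<otimes>\<^bsub>path_algebra Q n\<^esub> g \<in> carrier (path_algebra Q n)"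
proof -
  let ?h = "f \<otimes>\<^bsub>path_algebra Q n\<^esub> g"
  have "{p. ?h p \<noteq> 0} \<subseteq> (\<lambda>(p, q). (fst q, snd p + snd q)) ` ({p. f p \<noteq> 0} \<times> {p. g p \<noteq> 0})"
  proof
    fix p assume "p \<in> {p. ?h p \<noteq> 0}"
    then obtain r where "r \<le> snd p" "f (vertex_after n (fst p) r, snd p - r) \<noteq> 0" "g (fst p, r) \<noteq> 0"
      using path_mult_nonzero[of Q n f g "fst p" "snd p"] by auto
    then show "p \<in> (\<lambda>(p, q). (fst q, snd p + snd q)) ` ({p. f p \<noteq> 0} \<times> {p. g p \<noteq> 0})"
      by (intro image_eqI[of _ _ "((vertex_after n (fst p) r, snd p - r), (fst p, r))"]) auto
  qed
  moreover have "finite ({p. f p \<noteq> 0} \<times> {p. g p \<noteq> 0})"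
    using f g by (simp add: path_algebra_sel)
  ultimately have "finite {p. ?h p \<noteq> 0}" by (meson finite_imageI finite_subset)
  moreover have "{p. ?h p \<noteq> 0} \<subseteq> qpaths Q n"
  proof clarify
    fix i m assume "?h (i, m) \<noteq> 0"
    then obtain r where "r \<le> m" "f (vertex_after n i r, m - r) \<noteq> 0" "g (i, r) \<noteq> 0"
      using path_mult_nonzero by blast
    then show "(i, m) \<in> qpaths Q n"
      using qpaths_concat[of i r Q n "m - r"] path_algebra_support(1)[OF f]
        path_algebra_support(1)[OF g] by force
  qed
  ultimately show ?thesis by (simp add: path_algebra_sel)
qed

lemma path_mult_assoc:
  assumes h: "h \<in> carrier (path_algebra Q n :: (qpath \<Rightarrow> 'k::field) ring)"
  shows "(f \<otimes>\<^bsub>path_algebra Q n\<^esub> g) \<otimes>\<^bsub>path_algebra Q n\<^esub> h =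
    f \<otimes>\<^bsub>path_algebra Q n\<^esub> (g \<otimes>\<^bsub>path_algebra Q n\<^esub> h)" (is "?lhs = ?rhs")
proof
  fix p :: qpath
  obtain i m where p: "p = (i, m)" by (cases p)
  let ?v = "vertex_after n"
  have h0: "h (i, r) = 0" if "\<not> 1 \<le> i" for r
    using path_algebra_support(2)[OF h, of i r] that by auto
  \<comment> \<open>The contribution in which \<open>h\<close> takes the first \<open>r\<close>
    arrows, \<open>g\<close> the next \<open>s\<close> and \<open>f\<close> the rest; both
    bracketings sum it over \<open>r + s \<le> m\<close>.\<close>
  define T where "T r s = f (?v i (r + s), m - r - s) * g (?v i r, s) * h (i, r)" for r s
  have "?lhs p = (\<Sum>r\<le>m. \<Sum>s\<le>m - r. T r s)"
    unfolding p path_algebra_sel sum_distrib_right T_def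
    by (intro sum.cong refl) (use h0 vertex_after_add in \<open>cases "1 \<le> i"; simp\<close>)
  also have "\<dots> = (\<Sum>(r, s)\<in>Sigma {..m} (\<lambda>r. {..m - r}). T r s)"
    by (rule sum.Sigma) auto
  also have "Sigma {..m} (\<lambda>r. {..m - r}) = {(r, s). r + s \<le> m}" by auto
  also have "(\<Sum>(r, s)\<in>{(r, s). r + s \<le> m}. T r s) = (\<Sum>t\<le>m. \<Sum>r\<le>t. T r (t - r))"
    by (rule sum.triangle_reindex_eq)
  also have "\<dots> = ?rhs p"
    unfolding p path_algebra_sel sum_distrib_left T_def
    by (intro sum.cong refl) (simp add: mult.assoc)
  finally show "?lhs p = ?rhs p" .
qed

lemma path_one_closed:
  "\<one>\<^bsub>path_algebra Q n\<^esub> \<in> carrier (path_algebra Q n :: (qpath \<Rightarrow> 'k::field) ring)"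
proof -
  have "{p. \<one>\<^bsub>path_algebra Q n :: (qpath \<Rightarrow> 'k) ring\<^esub> p \<noteq> 0} \<subseteq> {1..n} \<times> {0}"
    by (auto simp: path_algebra_sel split: if_splits)
  moreover have "{1..n} \<times> {0} \<subseteq> qpaths Q n" by (cases Q) auto
  ultimately show ?thesis
    unfolding path_algebra_sel(1) using finite_subset[of _ "{1..n} \<times> {0 :: nat}"] by blast
qed

lemma path_algebra_ring:
  assumes n: "n \<ge> 1"
  shows "ring (path_algebra Q n :: (qpath \<Rightarrow> 'k::field) ring)" (is "ring ?R")
proof (rule ringI)
  have fin: "finite {p. f p + g p \<noteq> 0}" if "finite {p. f p \<noteq> 0}" "finite {p. g p \<noteq> 0}" for f g :: "qpath \<Rightarrow> 'k"
    by (rule finite_subset[of _ "{p. f p \<noteq> 0} \<union> {p. g p \<noteq> 0}"]) (use that in auto)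
  show "abelian_group ?R"
  proof (rule abelian_groupI)
    fix f g :: "qpath \<Rightarrow> 'k" assume f: "f \<in> carrier ?R" and g: "g \<in> carrier ?R"
    have "p \<in> qpaths Q n" if "f p + g p \<noteq> 0" for p
      using that f g by (cases "f p = 0") (auto simp: path_algebra_sel(1))
    then have "{p. f p + g p \<noteq> 0} \<subseteq> qpaths Q n" by blast
    then show "f \<oplus>\<^bsub>?R\<^esub> g \<in> carrier ?R" using f g fin by (simp add: path_algebra_sel)
    show "\<exists>h\<in>carrier ?R. h \<oplus>\<^bsub>?R\<^esub> f = \<zero>\<^bsub>?R\<^esub>"
      using f by (intro bexI[of _ "\<lambda>p. - f p"]) (simp_all add: path_algebra_sel)
  qed (simp_all add: path_algebra_sel fun_eq_iff add_ac)
  show "monoid ?R"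
  proof (rule monoidI)
    fix f :: "qpath \<Rightarrow> 'k" assume f: "f \<in> carrier ?R"
    show "\<one>\<^bsub>?R\<^esub> \<otimes>\<^bsub>?R\<^esub> f = f"
    proof
      fix p :: qpath
      obtain i m where p: "p = (i, m)" by (cases p)
      have "(\<Sum>r\<le>m. \<one>\<^bsub>?R\<^esub> (vertex_after n i r, m - r) * f (i, r)) = (\<Sum>r\<le>m. if r = m then f (i, m) else 0)"
        using vertex_after_range[OF n, of i] by (intro sum.cong) (auto simp: path_algebra_sel)
      then show "(\<one>\<^bsub>?R\<^esub> \<otimes>\<^bsub>?R\<^esub> f) p = f p" by (simp add: p path_algebra_sel)
    qed
    show "f \<otimes>\<^bsub>?R\<^esub> \<one>\<^bsub>?R\<^esub> = f"
    proof
      fix p :: qpath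
      obtain i m where p: "p = (i, m)" by (cases p)
      have "(\<Sum>r\<le>m. f (vertex_after n i r, m - r) * \<one>\<^bsub>?R\<^esub> (i, r)) = (\<Sum>r\<le>m. if r = 0 then f (i, m) else 0)"
        using vertex_after_0[of i n] path_algebra_support(2)[OF f, of i]
        by (intro sum.cong) (auto simp: path_algebra_sel)
      then show "(f \<otimes>\<^bsub>?R\<^esub> \<one>\<^bsub>?R\<^esub>) p = f p" by (simp add: p path_algebra_sel)
    qed
  qed (simp_all add: path_mult_closed path_one_closed path_mult_assoc)
  fix f g h :: "qpath \<Rightarrow> 'k"
  show "(f \<oplus>\<^bsub>?R\<^esub> g) \<otimes>\<^bsub>?R\<^esub> h = f \<otimes>\<^bsub>?R\<^esub> h \<oplus>\<^bsub>?R\<^esub> g \<otimes>\<^bsub>?R\<^esub> h"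
    by (rule ext) (auto simp: path_algebra_sel distrib_right sum.distrib)
  show "h \<otimes>\<^bsub>?R\<^esub> (f \<oplus>\<^bsub>?R\<^esub> g) = h \<otimes>\<^bsub>?R\<^esub> f \<oplus>\<^bsub>?R\<^esub> h \<otimes>\<^bsub>?R\<^esub> g"
    by (rule ext) (auto simp: path_algebra_sel distrib_left sum.distrib)
qed

section \<open>Ideals spanned by paths\<close>

lemma path_algebra_idealI:
  fixes J :: "(qpath \<Rightarrow> 'k::field) set"
  assumes n: "n \<ge> 1"
    and subJ: "J \<subseteq> carrier (path_algebra Q n)" and zeroJ: "(\<lambda>_. 0) \<in> J"
    and addJ: "\<And>f g. f \<in> J \<Longrightarrow> g \<in> J \<Longrightarrow> (\<lambda>p. f p + g p) \<in> J"
    and negJ: "\<And>f. f \<in> J \<Longrightarrow> (\<lambda>p. - f p) \<in> J"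
    and leftJ: "\<And>f g. f \<in> J \<Longrightarrow> g \<in> carrier (path_algebra Q n) \<Longrightarrow> g \<otimes>\<^bsub>path_algebra Q n\<^esub> f \<in> J"
    and rightJ: "\<And>f g. f \<in> J \<Longrightarrow> g \<in> carrier (path_algebra Q n) \<Longrightarrow> f \<otimes>\<^bsub>path_algebra Q n\<^esub> g \<in> J"
  shows "ideal J (path_algebra Q n)"
proof (rule idealI)
  let ?R = "path_algebra Q n :: (qpath \<Rightarrow> 'k) ring"
  interpret ring ?R by (rule path_algebra_ring[OF n])
  show "ring ?R" by (rule path_algebra_ring[OF n])
  show "subgroup J (add_monoid ?R)"
  proof (rule add.subgroupI)
    show "J \<noteq> {}" using zeroJ by blast
    show "\<ominus>\<^bsub>?R\<^esub> f \<in> J" if "f \<in> J" for f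
    proof -
      have "(\<lambda>p. - f p) \<oplus>\<^bsub>?R\<^esub> f = \<zero>\<^bsub>?R\<^esub>" by (simp add: path_algebra_sel)
      then have "\<ominus>\<^bsub>?R\<^esub> f = (\<lambda>p. - f p)" using minus_equality that negJ subJ by blast
      then show ?thesis using negJ[OF that] by simp
    qed
    show "f \<oplus>\<^bsub>?R\<^esub> g \<in> J" if "f \<in> J" "g \<in> J" for f g
      using addJ[OF that] by (simp add: path_algebra_sel)
  qed (use subJ in simp)
qed (use leftJ rightJ in auto)

definition path_monom :: "'k::zero \<Rightarrow> qpath \<Rightarrow> qpath \<Rightarrow> 'k" where
  "path_monom c p q = (if q = p then c else 0)"

lemma path_elem_monom: "path_elem p = path_monom 1 p"
  by (simp add: path_elem_def path_monom_def fun_eq_iff)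

lemma path_monom_closed: "p \<in> qpaths Q n \<Longrightarrow> path_monom (c :: 'k::field) p \<in> carrier (path_algebra Q n)"
proof -
  assume "p \<in> qpaths Q n"
  moreover have "{q. path_monom c p q \<noteq> 0} \<subseteq> {p}" by (auto simp: path_monom_def)
  ultimately show ?thesis by (auto simp: path_algebra_sel intro: finite_subset)
qed

lemma path_monom_mult:
  "path_monom c (vertex_after n i s, r) \<otimes>\<^bsub>path_algebra Q n\<^esub> path_monom d (i, s) =
    path_monom (c * d :: 'k::field) (i, s + r)"
proof
  fix p :: qpath
  obtain i' m where p: "p = (i', m)" by (cases p)
  have "(\<Sum>t\<le>m. path_monom c (vertex_after n i s, r) (vertex_after n i' t, m - t) * path_monom d (i, s) (i', t)) =
      (\<Sum>t\<le>m. if t = s then path_monom (c * d) (i, s + r) p else 0)"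
    by (rule sum.cong) (auto simp: path_monom_def p)
  also have "\<dots> = path_monom (c * d) (i, s + r) p"
    by (auto simp: path_monom_def p)
  finally show "(path_monom c (vertex_after n i s, r) \<otimes>\<^bsub>path_algebra Q n\<^esub> path_monom d (i, s)) p =
      path_monom (c * d) (i, s + r) p" by (simp add: p path_algebra_sel)
qed

text \<open>The monomial ideal with generators \<open>G\<close>, described by forbidden
  coefficients, so that two such ideals agree as soon as their nonzero paths do.\<close>

definition zero_paths_span :: "quiver \<Rightarrow> nat \<Rightarrow> qpath set \<Rightarrow> (qpath \<Rightarrow> 'k::field) set" where
  "zero_paths_span Q n G =
    {f \<in> carrier (path_algebra Q n). \<forall>p. nonzero_path Q n G p \<longrightarrow> f p = 0}"

lemma zero_paths_span_ideal:
  assumes n: "n \<ge> 1"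
  shows "ideal (zero_paths_span Q n G :: (qpath \<Rightarrow> 'k::field) set) (path_algebra Q n)"
proof (rule path_algebra_idealI[OF n])
  let ?R = "path_algebra Q n :: (qpath \<Rightarrow> 'k) ring" and ?Z = "zero_paths_span Q n G :: (qpath \<Rightarrow> 'k) set"
  interpret ring ?R by (rule path_algebra_ring[OF n])
  show "?Z \<subseteq> carrier ?R" by (auto simp: zero_paths_span_def)
  show "(\<lambda>_. 0) \<in> ?Z" by (simp add: zero_paths_span_def path_algebra_sel)
  show "(\<lambda>p. f p + g p) \<in> ?Z" if "f \<in> ?Z" "g \<in> ?Z" for f g
    using that add.m_closed[of f g] by (simp add: zero_paths_span_def path_algebra_sel(5))
  show "(\<lambda>p. - f p) \<in> ?Z" if "f \<in> ?Z" for f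
    using that by (simp add: zero_paths_span_def path_algebra_sel(1))
  fix f g assume f: "f \<in> ?Z" and g: "g \<in> carrier ?R"
  have fR: "f \<in> carrier ?R" using f by (simp add: zero_paths_span_def)
  have "(g \<otimes>\<^bsub>?R\<^esub> f) p = 0" if nz: "nonzero_path Q n G p" for p
  proof (rule ccontr)
    assume "(g \<otimes>\<^bsub>?R\<^esub> f) p \<noteq> 0"
    then obtain r where "r \<le> snd p" "f (fst p, r) \<noteq> 0"
      using path_mult_nonzero[of Q n g f "fst p" "snd p"] by auto
    then show False
      using nonzero_path_prefix[of Q n G "fst p" "snd p" r] nz f by (simp add: zero_paths_span_def)
  qed
  then show "g \<otimes>\<^bsub>?R\<^esub> f \<in> ?Z" using g fR by (simp add: zero_paths_span_def)
  have "(f \<otimes>\<^bsub>?R\<^esub> g) p = 0" if nz: "nonzero_path Q n G p" for p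
  proof (rule ccontr)
    assume "(f \<otimes>\<^bsub>?R\<^esub> g) p \<noteq> 0"
    then obtain r where "r \<le> snd p" "f (vertex_after n (fst p) r, snd p - r) \<noteq> 0"
      using path_mult_nonzero[of Q n f g "fst p" "snd p"] by auto
    then show False
      using nonzero_path_subpath[of Q n G "fst p" "snd p" r "snd p - r"] nz f
      by (simp add: zero_paths_span_def)
  qed
  then show "f \<otimes>\<^bsub>?R\<^esub> g \<in> ?Z" using g fR by (simp add: zero_paths_span_def)
qed

lemma path_elem_subset:
  "G \<subseteq> qpaths Q n \<Longrightarrow> path_elem ` G \<subseteq> carrier (path_algebra Q n :: (qpath \<Rightarrow> 'k::field) ring)"
  unfolding image_subset_iff path_elem_monom by (blast intro: path_monom_closed)

lemma path_elem_in_path_ideal: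
  assumes "n \<ge> 1" "G \<subseteq> qpaths Q n" "g \<in> G"
  shows "path_elem g \<in> (path_ideal Q n G :: (qpath \<Rightarrow> 'k::field) set)"
proof -
  interpret ring "path_algebra Q n :: (qpath \<Rightarrow> 'k) ring" by (rule path_algebra_ring[OF assms(1)])
  have "path_elem ` G \<subseteq> (path_ideal Q n G :: (qpath \<Rightarrow> 'k) set)"
    unfolding path_ideal_def by (rule genideal_self[OF path_elem_subset[OF assms(2)]])
  then show ?thesis using assms(3) by (rule subsetD[OF _ imageI])
qed

text \<open>Generators are zero paths, which gives one inclusion. For the other, a zero path is a
  generator extended on both sides, so its multiples lie in the generated ideal; a general element
  is a finite sum of these, handled by removing one path of the support at a time.\<close>

lemma path_ideal_eq:
  assumes n: "n \<ge> 1" and G: "G \<subseteq> qpaths Q n"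
  shows "path_ideal Q n G = (zero_paths_span Q n G :: (qpath \<Rightarrow> 'k::field) set)"
proof
  let ?R = "path_algebra Q n :: (qpath \<Rightarrow> 'k) ring" and ?Z = "zero_paths_span Q n G :: (qpath \<Rightarrow> 'k) set"
  interpret ring ?R by (rule path_algebra_ring[OF n])
  have "path_elem g \<in> ?Z" if g: "g \<in> G" for g
  proof -
    obtain i m where im: "g = (i, m)" by (cases g)
    have "vertex_after n i 0 = i" using g G im qpaths_fst[of i m Q n] vertex_after_0 by blast
    then have "\<not> nonzero_path Q n G g"
      using g im unfolding nonzero_path_def by (metis add_0 fst_conv snd_conv order_refl)
    then show ?thesis
      using g G path_monom_closed[of g Q n 1] by (auto simp: zero_paths_span_def path_elem_monom path_monom_def)
  qed
  then show "path_ideal Q n G \<subseteq> ?Z"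
    unfolding path_ideal_def by (intro genideal_minimal zero_paths_span_ideal[OF n]) auto
  interpret J: ideal "path_ideal Q n G" ?R
    unfolding path_ideal_def by (rule genideal_ideal) (rule path_elem_subset[OF G])
  note gen = path_elem_in_path_ideal[OF n G]
  have monom: "path_monom c p \<in> path_ideal Q n G"
    if pq: "p \<in> qpaths Q n" and z: "\<not> nonzero_path Q n G p" for c :: 'k and p
  proof -
    obtain i m where im: "p = (i, m)" by (cases p)
    then obtain r s where rs: "r + s \<le> m" "(vertex_after n i r, s) \<in> G"
      using pq z by (auto simp: nonzero_path_def)
    have i: "i \<in> {1..n}" using pq im qpaths_fst by blast
    have "(i, r) \<in> qpaths Q n"
      using qpaths_subpath[of i m Q n 0 r] pq im rs vertex_after_0[OF i] by simp
    then have "path_elem (vertex_after n i r, s) \<otimes>\<^bsub>?R\<^esub> path_monom 1 (i, r) \<in> path_ideal Q n G"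
      using J.I_r_closed gen[OF rs(2)] path_monom_closed by blast
    then have 1: "path_monom (1 :: 'k) (i, r + s) \<in> path_ideal Q n G"
      by (simp add: path_elem_monom path_monom_mult)
    have "(vertex_after n i (r + s), m - (r + s)) \<in> qpaths Q n"
      using qpaths_subpath[of i m Q n "r + s" "m - (r + s)"] pq im rs by simp
    then have "path_monom c (vertex_after n i (r + s), m - (r + s)) \<otimes>\<^bsub>?R\<^esub> path_monom 1 (i, r + s)
        \<in> path_ideal Q n G"
      using J.I_l_closed 1 path_monom_closed by blast
    then show ?thesis using rs im by (simp add: path_monom_mult)
  qed
  show "?Z \<subseteq> path_ideal Q n G"
  proof
    fix f :: "qpath \<Rightarrow> 'k" assume f: "f \<in> ?Z"
    have all: "finite S \<Longrightarrow> f \<in> ?Z \<Longrightarrow> {p. f p \<noteq> 0} = S \<Longrightarrow> f \<in> path_ideal Q n G" for S f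
    proof (induction S arbitrary: f rule: finite_induct)
      case empty
      then have "f = \<zero>\<^bsub>?R\<^esub>" by (auto simp: path_algebra_sel fun_eq_iff)
      then show ?case using J.zero_closed by simp
    next
      case (insert p S)
      let ?g = "f(p := 0)"
      have "{q. ?g q \<noteq> 0} = S" using insert.prems insert.hyps by auto
      moreover have "?g \<in> ?Z" using insert.prems insert.hyps calculation
        by (auto simp: zero_paths_span_def path_algebra_sel(1))
      ultimately have g: "?g \<in> path_ideal Q n G" using insert.IH by blast
      have "f p \<noteq> 0" using insert.prems by blast
      then have "path_monom (f p) p \<in> path_ideal Q n G"
        using insert.prems(1) by (cases p, intro monom) (auto simp: zero_paths_span_def path_algebra_sel(1))
      then have "?g \<oplus>\<^bsub>?R\<^esub> path_monom (f p) p \<in> path_ideal Q n G" using g J.a_closed by blast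
      moreover have "?g \<oplus>\<^bsub>?R\<^esub> path_monom (f p) p = f"
        by (auto simp: path_algebra_sel path_monom_def fun_eq_iff)
      ultimately show ?case by simp
    qed
    have "finite {p. f p \<noteq> 0}" using f by (simp add: zero_paths_span_def path_algebra_sel(1))
    then show "f \<in> path_ideal Q n G" by (rule all[OF _ f refl])
  qed
qed

lemma zero_paths_coset:
  assumes n: "n \<ge> 1" and f: "f \<in> carrier (path_algebra Q n :: (qpath \<Rightarrow> 'k::field) ring)"
  shows "zero_paths_span Q n G +>\<^bsub>path_algebra Q n\<^esub> f =
    {g \<in> carrier (path_algebra Q n). \<forall>p. nonzero_path Q n G p \<longrightarrow> g p = f p}" (is "_ = ?C")
proof (intro equalityI subsetI)
  let ?R = "path_algebra Q n :: (qpath \<Rightarrow> 'k) ring"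
  interpret ring ?R by (rule path_algebra_ring[OF n])
  {
    fix g assume "g \<in> zero_paths_span Q n G +>\<^bsub>?R\<^esub> f"
    then obtain h where h: "h \<in> zero_paths_span Q n G" "g = h \<oplus>\<^bsub>?R\<^esub> f"
      by (auto simp: a_r_coset_def r_coset_def)
    then have "g \<in> carrier ?R" using f by (simp add: zero_paths_span_def)
    moreover have "g p = f p" if "nonzero_path Q n G p" for p
      using h that by (cases p) (simp add: zero_paths_span_def path_algebra_sel(5))
    ultimately show "g \<in> ?C" by blast
  }
  fix g assume g: "g \<in> ?C"
  let ?h = "\<lambda>p. g p - f p"
  have "(\<lambda>p. - f p) \<in> carrier ?R" using f by (simp add: path_algebra_sel(1))
  then have "g \<oplus>\<^bsub>?R\<^esub> (\<lambda>p. - f p) \<in> carrier ?R" using g by blast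
  then have "?h \<in> zero_paths_span Q n G" using g by (simp add: zero_paths_span_def path_algebra_sel(5))
  moreover have "g = ?h \<oplus>\<^bsub>?R\<^esub> f" by (simp add: path_algebra_sel)
  ultimately show "g \<in> zero_paths_span Q n G +>\<^bsub>?R\<^esub> f"
    by (auto simp: a_r_coset_def r_coset_def)
qed

section \<open>The quotient as an algebra with path coefficients\<close>

context path_relations
begin

text \<open>The choice of representative does not matter for cosets of the path ideal, whose members
  agree on nonzero paths; the value 0 on zero paths makes the function canonical.\<close>

definition coset_coeff :: "(qpath \<Rightarrow> 'k::field) set \<Rightarrow> qpath \<Rightarrow> 'k" where
  "coset_coeff C p = (if nzp p then (SOME f. f \<in> C) p else 0)"

lemma quotient_coefficients:
  defines "R \<equiv> path_algebra Q n :: (qpath \<Rightarrow> 'k::field) ring"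
  defines "I \<equiv> path_ideal Q n G :: (qpath \<Rightarrow> 'k) set"
  shows "path_coefficients (R Quot I) (\<lambda>c. I +>\<^bsub>R\<^esub> (\<lambda>p. c * \<one>\<^bsub>R\<^esub> p))
    (\<lambda>j. I +>\<^bsub>R\<^esub> path_elem (j, 0)) n len coset_coeff"
proof -
  interpret ring R unfolding R_def by (rule path_algebra_ring[OF n_ge_1])
  have I: "I = zero_paths_span Q n G"
    unfolding I_def by (rule path_ideal_eq[OF n_ge_1 relations_subset])
  interpret ideal I R unfolding I R_def by (rule zero_paths_span_ideal[OF n_ge_1])
  have coset: "I +>\<^bsub>R\<^esub> f = {g \<in> carrier R. \<forall>p. nzp p \<longrightarrow> g p = f p}" if "f \<in> carrier R" for f
    using zero_paths_coset[OF n_ge_1, of f Q G] that unfolding I R_def by simp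
  have cc: "coset_coeff (I +>\<^bsub>R\<^esub> f) p = (if nzp p then f p else 0)" if f: "f \<in> carrier R" for f p
  proof -
    have "f \<in> I +>\<^bsub>R\<^esub> f" using f coset by simp
    then have "(SOME g. g \<in> I +>\<^bsub>R\<^esub> f) \<in> I +>\<^bsub>R\<^esub> f" by (rule someI[of "\<lambda>g. g \<in> I +>\<^bsub>R\<^esub> f"])
    then have "(SOME g. g \<in> I +>\<^bsub>R\<^esub> f) p = f p" if "nzp p"
      unfolding coset[OF f] using that by blast
    then show ?thesis by (simp add: coset_coeff_def)
  qed
  have car: "carrier (R Quot I) = (\<lambda>f. I +>\<^bsub>R\<^esub> f) ` carrier R"
    by (auto simp: FactRing_def A_RCOSETS_def RCOSETS_def a_r_coset_def)
  have nz: "nzp p \<Longrightarrow> p \<in> qpaths Q n" for p by (simp add: nonzero_path_def)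
  \<comment> \<open>Finite dimension of the quotient: it makes every function vanishing on zero
    paths finitely supported, hence an element of the path algebra.\<close>
  have fin: "finite {p. nzp p}"
  proof (rule finite_subset)
    show "{p. nzp p} \<subseteq> Sigma {1..n} (\<lambda>i. {..<len i})"
      using nz qpaths_fst nzp_iff by fastforce
  qed auto
  show ?thesis
  proof
    show "n \<ge> 1" by (rule n_ge_1)
    show "1 \<le> len i" if "i \<in> {1..n}" for i using len_pos that .
    show "len i = 0" if "i \<notin> {1..n}" for i using len_outside that .
    show "len i \<le> k + len (va i k)" if "k < len i" for k i using len_step that .
    show "bij_betw coset_coeff (carrier (R Quot I)) {f. \<forall>i m. len i \<le> m \<longrightarrow> f (i, m) = 0}"
      unfolding bij_betw_def
    proof (intro conjI)
      show "inj_on coset_coeff (carrier (R Quot I))"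
      proof (rule inj_onI)
        fix C D assume "C \<in> carrier (R Quot I)" "D \<in> carrier (R Quot I)"
        then obtain f g where f: "f \<in> carrier R" "C = I +>\<^bsub>R\<^esub> f" and g: "g \<in> carrier R" "D = I +>\<^bsub>R\<^esub> g"
          unfolding car by blast
        assume eq: "coset_coeff C = coset_coeff D"
        have "f p = g p" if "nzp p" for p
          using fun_cong[OF eq, of p] cc f g that by simp
        then show "C = D" unfolding f(2) g(2) coset[OF f(1)] coset[OF g(1)] by auto
      qed
      show "coset_coeff ` carrier (R Quot I) = {f. \<forall>i m. len i \<le> m \<longrightarrow> f (i, m) = 0}"
      proof (intro equalityI subsetI)
        fix h assume "h \<in> coset_coeff ` carrier (R Quot I)"
        then obtain f where "f \<in> carrier R" "h = coset_coeff (I +>\<^bsub>R\<^esub> f)" unfolding car by blast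
        then show "h \<in> {f. \<forall>i m. len i \<le> m \<longrightarrow> f (i, m) = 0}" using cc by (auto simp: nzp_iff)
      next
        fix h :: "qpath \<Rightarrow> 'k" assume h: "h \<in> {f. \<forall>i m. len i \<le> m \<longrightarrow> f (i, m) = 0}"
        then have sub: "{p. h p \<noteq> 0} \<subseteq> {p. nzp p}" using nzp_iff by (auto simp: not_le[symmetric])
        then have hR: "h \<in> carrier R"
          using finite_subset[OF sub fin] nz by (auto simp: R_def path_algebra_sel(1))
        have "coset_coeff (I +>\<^bsub>R\<^esub> h) = h" using cc[OF hR] sub by (auto simp: fun_eq_iff)
        then show "h \<in> coset_coeff ` carrier (R Quot I)" unfolding car using hR by (metis imageI)
      qed
    qed
    {
      fix C D assume "C \<in> carrier (R Quot I)" "D \<in> carrier (R Quot I)"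
      then obtain f g where f: "f \<in> carrier R" "C = I +>\<^bsub>R\<^esub> f" and g: "g \<in> carrier R" "D = I +>\<^bsub>R\<^esub> g"
        unfolding car by blast
      have s: "C \<oplus>\<^bsub>R Quot I\<^esub> D = I +>\<^bsub>R\<^esub> (f \<oplus>\<^bsub>R\<^esub> g)"
        using a_rcos_sum[OF f(1) g(1)] f g by (simp add: FactRing_def)
      then show "C \<oplus>\<^bsub>R Quot I\<^esub> D \<in> carrier (R Quot I)" unfolding car using f g by blast
      show "coset_coeff (C \<oplus>\<^bsub>R Quot I\<^esub> D) p = coset_coeff C p + coset_coeff D p" for p
        unfolding s unfolding f(2) g(2) cc[OF f(1)] cc[OF g(1)] cc[OF add.m_closed[OF f(1) g(1)]]
        by (simp add: R_def path_algebra_sel(5))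
      have p: "C \<otimes>\<^bsub>R Quot I\<^esub> D = I +>\<^bsub>R\<^esub> (f \<otimes>\<^bsub>R\<^esub> g)"
        using rcoset_mult_add[OF f(1) g(1)] f g by (simp add: FactRing_def)
      then show "C \<otimes>\<^bsub>R Quot I\<^esub> D \<in> carrier (R Quot I)" unfolding car using f g by blast
      fix m i assume m: "m < len i"
      have fg: "f \<otimes>\<^bsub>R\<^esub> g \<in> carrier R" using f g by simp
      have nzm: "nzp (i, m)" using m nzp_iff by simp
      have "coset_coeff (C \<otimes>\<^bsub>R Quot I\<^esub> D) (i, m) = (f \<otimes>\<^bsub>R\<^esub> g) (i, m)"
        unfolding p cc[OF fg] using nzm by simp
      also have "\<dots> = (\<Sum>r\<le>m. f (va i r, m - r) * g (i, r))"
        unfolding R_def path_algebra_sel by simp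
      also have "\<dots> = (\<Sum>r\<le>m. coset_coeff C (va i r, m - r) * coset_coeff D (i, r))"
      proof (intro sum.cong refl)
        fix r assume "r \<in> {..m}"
        then have "nzp (va i r, m - r)" "nzp (i, r)"
          using nonzero_path_subpath[OF nzm, of r "m - r"] nonzero_path_prefix[OF nzm, of r] by auto
        then show "f (va i r, m - r) * g (i, r) = coset_coeff C (va i r, m - r) * coset_coeff D (i, r)"
          unfolding f(2) g(2) cc[OF f(1)] cc[OF g(1)] by simp
      qed
      finally show "coset_coeff (C \<otimes>\<^bsub>R Quot I\<^esub> D) (i, m) =
          (\<Sum>r\<le>m. coset_coeff C (va i r, m - r) * coset_coeff D (i, r))" .
    }
    have zc: "\<zero>\<^bsub>R\<^esub> \<in> carrier R" by simp
    have z: "\<zero>\<^bsub>R Quot I\<^esub> = I +>\<^bsub>R\<^esub> \<zero>\<^bsub>R\<^esub>"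
      using a_coset_add_zero[OF a_subset] by (simp add: FactRing_def)
    then show "\<zero>\<^bsub>R Quot I\<^esub> \<in> carrier (R Quot I)" unfolding car using zc by blast
    show "coset_coeff \<zero>\<^bsub>R Quot I\<^esub> p = 0" for p
      unfolding z cc[OF zc] by (simp add: R_def path_algebra_sel(4))
    {
      fix c :: 'k
      have "{p. c * \<one>\<^bsub>R\<^esub> p \<noteq> 0} \<subseteq> {p. \<one>\<^bsub>R\<^esub> p \<noteq> 0}" by auto
      then have c: "(\<lambda>p. c * \<one>\<^bsub>R\<^esub> p) \<in> carrier R"
        using path_one_closed[of Q n] finite_subset unfolding R_def path_algebra_sel(1) by blast
      then show "I +>\<^bsub>R\<^esub> (\<lambda>p. c * \<one>\<^bsub>R\<^esub> p) \<in> carrier (R Quot I)" unfolding car by blast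
      show "coset_coeff (I +>\<^bsub>R\<^esub> (\<lambda>p. c * \<one>\<^bsub>R\<^esub> p)) (i, m) = (if m = 0 then c else 0)"
        if i: "i \<in> {1..n}" for i m
        unfolding cc[OF c] using i len_pos[OF i] by (auto simp: R_def path_algebra_sel nzp_iff)
    }
    fix j assume j: "j \<in> {1..n}"
    have nj: "nzp (j, 0)" using len_pos[OF j] by (simp add: nzp_iff)
    have e: "path_elem (j, 0) \<in> carrier R"
      unfolding R_def path_elem_monom by (rule path_monom_closed[OF nz[OF nj]])
    then show "I +>\<^bsub>R\<^esub> path_elem (j, 0) \<in> carrier (R Quot I)" unfolding car by blast
    show "coset_coeff (I +>\<^bsub>R\<^esub> path_elem (j, 0)) p = (if p = (j, 0) then 1 else 0)" for p
      unfolding cc[OF e] using nj by (simp add: path_elem_def)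
  qed
qed

lemma q_number_eq:
  "q_number Q n (path_ideal Q n G :: (qpath \<Rightarrow> 'k::field) set) =
    card {r. linear_order_on {1..n} r \<and> (\<forall>g\<in>G. peak_at_end n r g)}"
  unfolding q_number_def path_coefficients.q_ordering_iff[OF quotient_coefficients]
  by (rule arg_cong[of _ _ card]) (use weyl_depth_iff_relations in blast)

end

section \<open>Path length, powers of the arrow ideal, and admissibility\<close>

definition deg_ge :: "quiver \<Rightarrow> nat \<Rightarrow> nat \<Rightarrow> (qpath \<Rightarrow> 'k::field) set" where
  "deg_ge Q n k = {f \<in> carrier (path_algebra Q n). \<forall>i m. m < k \<longrightarrow> f (i, m) = 0}"

lemma deg_ge_mult:
  assumes f: "f \<in> deg_ge Q n k" and g: "g \<in> (deg_ge Q n l :: (qpath \<Rightarrow> 'k::field) set)"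
  shows "f \<otimes>\<^bsub>path_algebra Q n\<^esub> g \<in> deg_ge Q n (k + l)"
proof -
  have "(f \<otimes>\<^bsub>path_algebra Q n\<^esub> g) (i, m) = 0" if m: "m < k + l" for i m
  proof (rule ccontr)
    assume "(f \<otimes>\<^bsub>path_algebra Q n\<^esub> g) (i, m) \<noteq> 0"
    then obtain r where "r \<le> m" "f (vertex_after n i r, m - r) \<noteq> 0" "g (i, r) \<noteq> 0"
      using path_mult_nonzero by blast
    moreover from this have "\<not> m - r < k" "\<not> r < l" using f g by (auto simp: deg_ge_def)
    ultimately show False using m by simp
  qed
  then show ?thesis using f g path_mult_closed by (auto simp: deg_ge_def)
qed

lemma deg_ge_ideal:
  assumes n: "n \<ge> 1"
  shows "ideal (deg_ge Q n k :: (qpath \<Rightarrow> 'k::field) set) (path_algebra Q n)"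
proof (rule path_algebra_idealI[OF n])
  let ?R = "path_algebra Q n :: (qpath \<Rightarrow> 'k) ring" and ?Z = "deg_ge Q n k :: (qpath \<Rightarrow> 'k) set"
  interpret ring ?R by (rule path_algebra_ring[OF n])
  show "?Z \<subseteq> carrier ?R" by (auto simp: deg_ge_def)
  show "(\<lambda>_. 0) \<in> ?Z" by (simp add: deg_ge_def path_algebra_sel)
  show "(\<lambda>p. f p + g p) \<in> ?Z" if "f \<in> ?Z" "g \<in> ?Z" for f g
    using that add.m_closed[of f g] by (simp add: deg_ge_def path_algebra_sel(5))
  show "(\<lambda>p. - f p) \<in> ?Z" if "f \<in> ?Z" for f
    using that by (simp add: deg_ge_def path_algebra_sel(1))
  fix f g assume f: "f \<in> ?Z" and g: "g \<in> carrier ?R"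
  have g0: "g \<in> deg_ge Q n 0" using g by (simp add: deg_ge_def)
  show "g \<otimes>\<^bsub>?R\<^esub> f \<in> ?Z" using deg_ge_mult[OF g0 f] by simp
  show "f \<otimes>\<^bsub>?R\<^esub> g \<in> ?Z" using deg_ge_mult[OF f g0] by simp
qed

lemma arrow_subset:
  "path_elem ` {p \<in> qpaths Q n. snd p = 1} \<subseteq> (deg_ge Q n 1 :: (qpath \<Rightarrow> 'k::field) set)"
  using path_monom_closed[of _ Q n "1 :: 'k"] by (auto simp: deg_ge_def path_elem_monom) (simp add: path_monom_def)

text \<open>Each factor from the arrow ideal adds at least one arrow. With \<open>k = 2\<close> this
  bounds the length of the generators of an admissible ideal from below.\<close>

lemma arrow_ideal_power_deg:
  assumes n: "n \<ge> 1"
  shows "arrow_ideal_power Q n k \<subseteq> (deg_ge Q n k :: (qpath \<Rightarrow> 'k::field) set)"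
proof (induction k)
  case 0
  then show ?case by (auto simp: deg_ge_def)
next
  case (Suc k)
  let ?R = "path_algebra Q n :: (qpath \<Rightarrow> 'k) ring"
  interpret ring ?R by (rule path_algebra_ring[OF n])
  have arrow: "arrow_ideal Q n \<subseteq> (deg_ge Q n 1 :: (qpath \<Rightarrow> 'k) set)"
    unfolding arrow_ideal_def by (rule genideal_minimal[OF deg_ge_ideal[OF n] arrow_subset])
  interpret D: ideal "deg_ge Q n (Suc k) :: (qpath \<Rightarrow> 'k) set" ?R by (rule deg_ge_ideal[OF n])
  show ?case
  proof
    fix f :: "qpath \<Rightarrow> 'k" assume "f \<in> arrow_ideal_power Q n (Suc k)"
    then have "f \<in> ideal_prod ?R (arrow_ideal Q n) (arrow_ideal_power Q n k)" by simp
    then show "f \<in> deg_ge Q n (Suc k)"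
    proof induction
      case (prod f g)
      then show ?case using deg_ge_mult[of f Q n 1 g k] arrow Suc by auto
    qed (rule D.a_closed)
  qed
qed

text \<open>On the cyclic quiver paths of every length exist, so no power of the arrow ideal
  vanishes and an admissible ideal cannot be zero.\<close>

lemma cyclic_path_in_power:
  assumes n: "n \<ge> 1" and i: "i \<in> {1..n}"
  shows "path_elem (i, k) \<in> (arrow_ideal_power Cyclic n k :: (qpath \<Rightarrow> 'k::field) set)"
proof (induction k)
  case 0
  show ?case using i path_monom_closed[of "(i, 0)" Cyclic n] by (simp add: path_elem_monom)
next
  case (Suc k)
  let ?R = "path_algebra Cyclic n :: (qpath \<Rightarrow> 'k) ring"
  interpret ring ?R by (rule path_algebra_ring[OF n])
  have sub: "path_elem ` {p \<in> qpaths Cyclic n. snd p = 1} \<subseteq> carrier ?R"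
    by (rule path_elem_subset) auto
  have "path_elem (vertex_after n i k, 1) \<in> (arrow_ideal Cyclic n :: (qpath \<Rightarrow> 'k) set)"
    unfolding arrow_ideal_def using genideal_self[OF sub] vertex_after_range[OF n, of i k] by auto
  then have "path_elem (vertex_after n i k, 1) \<otimes>\<^bsub>?R\<^esub> path_elem (i, k) \<in> arrow_ideal_power Cyclic n (Suc k)"
    using Suc by (simp add: ideal_prod.prod)
  then show ?case by (simp add: path_elem_monom path_monom_mult)
qed

lemma path_ideal_nonempty:
  assumes n: "n \<ge> 1" and G: "G \<subseteq> qpaths Q n"
  shows "path_ideal Q n G = {\<zero>\<^bsub>path_algebra Q n :: (qpath \<Rightarrow> 'k::field) ring\<^esub>} \<longleftrightarrow> G = {}"
proof
  let ?R = "path_algebra Q n :: (qpath \<Rightarrow> 'k) ring"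
  interpret ring ?R by (rule path_algebra_ring[OF n])
  show "path_ideal Q n G = {\<zero>\<^bsub>?R\<^esub>}" if "G = {}"
  proof -
    have "path_ideal Q n G \<subseteq> {\<zero>\<^bsub>?R\<^esub>}"
      unfolding path_ideal_def that by (rule genideal_minimal[OF zeroideal]) simp
    moreover have "ideal (path_ideal Q n G) ?R"
      unfolding path_ideal_def by (rule genideal_ideal) (rule path_elem_subset[OF G])
    then have "\<zero>\<^bsub>?R\<^esub> \<in> path_ideal Q n G"
      by (rule additive_subgroup.zero_closed[OF ideal.axioms(1)])
    ultimately show ?thesis by blast
  qed
  show "G = {}" if eq: "path_ideal Q n G = {\<zero>\<^bsub>?R\<^esub>}"
  proof (rule ccontr)
    assume "G \<noteq> {}"
    then obtain g where "g \<in> G" by blast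
    then have "path_elem g \<in> (path_ideal Q n G :: (qpath \<Rightarrow> 'k) set)"
      by (rule path_elem_in_path_ideal[OF n G])
    then have "(path_elem g :: qpath \<Rightarrow> 'k) = (\<lambda>_. 0)" using eq by (simp add: path_algebra_sel)
    from fun_cong[OF this, of g] show False by (simp add: path_elem_def)
  qed
qed

text \<open>Minimality enters through nonzero paths: if one generator properly contained another,
  deleting the larger would leave the same nonzero paths and therefore the same ideal.\<close>

lemma admissible_path_relations:
  assumes n: "n \<ge> 2" and I: "admissible_ideal Q n (I :: (qpath \<Rightarrow> 'k::field) set)"
    and G: "minimal_path_generators Q n I G"
  shows "path_relations Q n G"
proof
  let ?R = "path_algebra Q n :: (qpath \<Rightarrow> 'k) ring"
  have n1: "n \<ge> 1" using n by simp
  interpret ring ?R by (rule path_algebra_ring[OF n1])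
  have sub: "G \<subseteq> qpaths Q n" and IG: "I = path_ideal Q n G"
    and min: "\<And>G'. G' \<subset> G \<Longrightarrow> I \<noteq> path_ideal Q n G'"
    using G by (auto simp: minimal_path_generators_def)
  show "n \<ge> 2" by (rule n)
  show "G \<subseteq> qpaths Q n" by (rule sub)
  show "2 \<le> snd g" if g: "g \<in> G" for g
  proof -
    have "path_elem g \<in> I"
      unfolding IG by (rule path_elem_in_path_ideal[OF n1 sub g])
    then have "path_elem g \<in> (deg_ge Q n 2 :: (qpath \<Rightarrow> 'k) set)"
      using I arrow_ideal_power_deg[OF n1, of Q 2] unfolding admissible_ideal_def by blast
    then have "(path_elem g :: qpath \<Rightarrow> 'k) (fst g, snd g) = 0" if "snd g < 2"
      using that unfolding deg_ge_def by blast
    then show ?thesis by (cases "snd g < 2") (simp_all add: path_elem_def)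
  qed
  show "s = m" if im: "(i, m) \<in> G" and rs: "r + s \<le> m" and sG: "(vertex_after n i r, s) \<in> G" for i m r s
  proof (rule ccontr)
    assume "s \<noteq> m"
    let ?G = "G - {(i, m)}"
    have i: "i \<ge> 1" using im sub qpaths_fst[of i m Q n] by auto
    \<comment> \<open>An occurrence of the deleted generator would bring along the smaller one
      inside it, which is still present.\<close>
    have less: "nonzero_path Q n G p" if nz: "nonzero_path Q n ?G p" for p
    proof -
      have "fst p \<ge> 1" using nz qpaths_fst[of "fst p" "snd p" Q n] by (auto simp: nonzero_path_def)
      note add = vertex_after_add[OF this, of n]
      have "(vertex_after n (fst p) a, b) \<notin> G" if ab: "a + b \<le> snd p" for a b
      proof
        assume abG: "(vertex_after n (fst p) a, b) \<in> G"
        have no: "(vertex_after n (fst p) a', b') \<notin> ?G" if "a' + b' \<le> snd p" for a' b'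
          using nz that by (simp add: nonzero_path_def)
        have eq: "vertex_after n (fst p) a = i" "b = m" using no[OF ab] abG by auto
        have "(vertex_after n (fst p) (a + r), s) \<in> ?G" using sG \<open>s \<noteq> m\<close> add[of a r] eq by simp
        moreover have "a + r + s \<le> snd p" using ab rs eq by simp
        ultimately show False using no by blast
      qed
      then show ?thesis using nz by (simp add: nonzero_path_def)
    qed
    have "nonzero_path Q n ?G p \<longleftrightarrow> nonzero_path Q n G p" for p
      by (rule iffI, erule less) (simp add: nonzero_path_def)
    then have "zero_paths_span Q n ?G = (zero_paths_span Q n G :: (qpath \<Rightarrow> 'k) set)"
      by (simp add: zero_paths_span_def)
    moreover have "path_ideal Q n ?G = (zero_paths_span Q n ?G :: (qpath \<Rightarrow> 'k) set)"
      by (rule path_ideal_eq[OF n1]) (use sub in blast)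
    ultimately have "I = path_ideal Q n ?G" unfolding IG path_ideal_eq[OF n1 sub] by simp
    then show False using min[of ?G] im by blast
  qed
  show "G \<noteq> {}" if Q: "Q = Cyclic"
  proof
    assume "G = {}"
    then have I0: "I = {\<zero>\<^bsub>?R\<^esub>}" unfolding IG using path_ideal_nonempty[OF n1 sub] by simp
    obtain k where "arrow_ideal_power Q n k \<subseteq> I" using I by (auto simp: admissible_ideal_def)
    then have "path_elem (1, k) \<in> I" using cyclic_path_in_power[OF n1, of 1 k] n1 Q by auto
    then have "(path_elem (1, k) :: qpath \<Rightarrow> 'k) = (\<lambda>_. 0)" unfolding I0 by (simp add: path_algebra_sel)
    from fun_cong[OF this, of "(1, k)"] show False by (simp add: path_elem_def)
  qed
qed

section \<open>Counting linear orders\<close>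

lemma linear_order_onI:
  assumes "r \<subseteq> V \<times> V" "\<And>a. a \<in> V \<Longrightarrow> (a, a) \<in> r"
    "\<And>a b c. (a, b) \<in> r \<Longrightarrow> (b, c) \<in> r \<Longrightarrow> (a, c) \<in> r"
    "\<And>a b. (a, b) \<in> r \<Longrightarrow> (b, a) \<in> r \<Longrightarrow> a = b"
    "\<And>a b. a \<in> V \<Longrightarrow> b \<in> V \<Longrightarrow> (a, b) \<in> r \<or> (b, a) \<in> r"
  shows "linear_order_on V r"
  using assms
  by (auto simp: order_on_defs refl_on_def total_on_def intro!: transI antisymI)

lemma linear_order_onE:
  assumes "linear_order_on V r"
  shows "r \<subseteq> V \<times> V" "a \<in> V \<Longrightarrow> (a, a) \<in> r"
    "(a, b) \<in> r \<Longrightarrow> (b, c) \<in> r \<Longrightarrow> (a, c) \<in> r"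
    "(a, b) \<in> r \<Longrightarrow> (b, a) \<in> r \<Longrightarrow> a = b"
    "a \<in> V \<Longrightarrow> b \<in> V \<Longrightarrow> (a, b) \<in> r \<or> (b, a) \<in> r"
proof -
  have r: "r \<subseteq> V \<times> V" "refl_on V r" "trans r" "antisym r" "total_on V r"
    using assms by (auto simp: order_on_defs)
  show "r \<subseteq> V \<times> V" by (rule r)
  show refl: "a \<in> V \<Longrightarrow> (a, a) \<in> r" for a using r(2) by (simp add: refl_on_def)
  show "(a, b) \<in> r \<Longrightarrow> (b, c) \<in> r \<Longrightarrow> (a, c) \<in> r" by (rule transD[OF r(3)])
  show "(a, b) \<in> r \<Longrightarrow> (b, a) \<in> r \<Longrightarrow> a = b" by (rule antisymD[OF r(4)])
  show "a \<in> V \<Longrightarrow> b \<in> V \<Longrightarrow> (a, b) \<in> r \<or> (b, a) \<in> r"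
    using r(5) refl by (cases "a = b") (auto simp: total_on_def)
qed

lemma linear_order_restrict:
  assumes "linear_order_on V r" "W \<subseteq> V"
  shows "linear_order_on W (r \<inter> W \<times> W)"
proof (rule linear_order_onI)
  note L = linear_order_onE[OF assms(1)]
  show "r \<inter> W \<times> W \<subseteq> W \<times> W" by blast
  show "(a, a) \<in> r \<inter> W \<times> W" if "a \<in> W" for a using that L(2) assms(2) by auto
  show "(a, c) \<in> r \<inter> W \<times> W" if "(a, b) \<in> r \<inter> W \<times> W" "(b, c) \<in> r \<inter> W \<times> W" for a b c
    using that L(3)[of a b c] by simp
  show "a = b" if "(a, b) \<in> r \<inter> W \<times> W" "(b, a) \<in> r \<inter> W \<times> W" for a b
    using that L(4)[of a b] by simp
  show "(a, b) \<in> r \<inter> W \<times> W \<or> (b, a) \<in> r \<inter> W \<times> W" if "a \<in> W" "b \<in> W" for a b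
    using that L(5)[of a b] assms(2) by auto
qed

lemma linear_order_finite_min:
  assumes r: "linear_order_on V r" and U: "finite U" "U \<noteq> {}" "U \<subseteq> V"
  shows "\<exists>z\<in>U. \<forall>b\<in>U. (z, b) \<in> r"
  using U
proof (induction U rule: finite_ne_induct)
  case (singleton a)
  then show ?case using linear_order_onE(2)[OF r] by auto
next
  case (insert a U)
  then obtain z where z: "z \<in> U" "\<forall>b\<in>U. (z, b) \<in> r" by auto
  note L = linear_order_onE[OF r]
  show ?case
  proof (cases "(a, z) \<in> r")
    case True
    then have "(a, b) \<in> r" if "b \<in> U" for b using z(2) that L(3)[of a z b] by blast
    then show ?thesis using L(2)[of a] insert.prems by blast
  next
    case False
    then have "(z, a) \<in> r" using L(5)[of a z] z(1) insert.prems by blast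
    then show ?thesis using z by blast
  qed
qed

text \<open>Inserts \<open>x\<close> into the order \<open>s\<close> of \<open>W\<close> immediately below \<open>z\<close>, or at the top if \<open>z = x\<close>.\<close>
definition insert_below :: "'a \<Rightarrow> 'a set \<Rightarrow> 'a rel \<Rightarrow> 'a \<Rightarrow> 'a rel" where
  "insert_below x W s z =
    s \<union> {(x, b) | b. (z, b) \<in> s \<or> b = x} \<union> {(a, x) | a. a \<in> W \<and> (z, a) \<notin> s}"

lemma insert_below_linear:
  assumes s: "linear_order_on W s" and x: "x \<notin> W"
  shows "linear_order_on (insert x W) (insert_below x W s z)"
proof (rule linear_order_onI)
  note L = linear_order_onE[OF s]
  have nx: "(x, b) \<notin> s" "(b, x) \<notin> s" for b using L(1) x by auto
  let ?r = "insert_below x W s z"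
  have mem: "(a, b) \<in> ?r \<longleftrightarrow> (if a = x then (z, b) \<in> s \<or> b = x
      else if b = x then a \<in> W \<and> (z, a) \<notin> s else (a, b) \<in> s)" for a b
    using nx by (auto simp: insert_below_def)
  show "?r \<subseteq> insert x W \<times> insert x W" using L(1) by (auto simp: insert_below_def)
  show "(a, a) \<in> ?r" if "a \<in> insert x W" for a using that L(2) by (auto simp: mem)
  show "(a, c) \<in> ?r" if "(a, b) \<in> ?r" "(b, c) \<in> ?r" for a b c
  proof -
    consider "a = x" | "a \<noteq> x" "b = x" | "a \<noteq> x" "b \<noteq> x" "c = x" | "a \<noteq> x" "b \<noteq> x" "c \<noteq> x" by blast
    then show ?thesis
    proof cases
      case 1
      then show ?thesis using that L(3)[of z b c] by (auto simp: mem split: if_splits)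
    next
      case 2
      then have a: "a \<in> W" "(z, a) \<notin> s" using that by (auto simp: mem)
      show ?thesis
      proof (cases "c = x")
        case True
        then show ?thesis using 2 a by (simp add: mem)
      next
        case False
        then have zc: "(z, c) \<in> s" using that 2 by (simp add: mem)
        then have "z \<in> W" "c \<in> W" using L(1) by auto
        then have "(a, z) \<in> s" using a L(5) by blast
        then show ?thesis using 2 False zc L(3)[of a z c] by (simp add: mem)
      qed
    next
      case 3
      then have ab: "(a, b) \<in> s" "(z, b) \<notin> s" using that by (simp_all add: mem)
      then have "a \<in> W" "(z, a) \<notin> s" using L(1) L(3)[of z a b] by auto
      then show ?thesis using 3 by (simp add: mem)
    next
      case 4
      then show ?thesis using that L(3)[of a b c] by (simp add: mem)
    qed
  qed
  show "a = b" if "(a, b) \<in> ?r" "(b, a) \<in> ?r" for a b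
    using that L(4)[of a b] by (auto simp: mem split: if_splits)
  show "(a, b) \<in> ?r \<or> (b, a) \<in> ?r" if "a \<in> insert x W" "b \<in> insert x W" for a b
    using that L(5)[of a b] by (auto simp: mem)
qed

lemma insert_below_restrict:
  assumes "s \<subseteq> W \<times> W" "x \<notin> W"
  shows "insert_below x W s z \<inter> W \<times> W = s"
  using assms by (auto simp: insert_below_def)

text \<open>The position \<open>z\<close> is recovered as the least element of \<open>W\<close>
  above \<open>x\<close>, or as \<open>x\<close> itself when there is none; in the latter case no
  pair of the restricted order starts at \<open>z\<close>.\<close>

lemma insert_below_surj:
  assumes r: "linear_order_on (insert x W) r" and W: "finite W" "x \<notin> W"
  shows "\<exists>z\<in>insert x W. r = insert_below x W (r \<inter> W \<times> W) z"
proof -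
  note L = linear_order_onE[OF r]
  let ?s = "r \<inter> W \<times> W"
  define U where "U = {b \<in> W. (x, b) \<in> r}"
  have "\<exists>z\<in>insert x W. \<forall>b. (z, b) \<in> ?s \<longleftrightarrow> b \<in> U"
  proof (cases "U = {}")
    case True
    then show ?thesis using W by (intro bexI[of _ x]) auto
  next
    case False
    then obtain z where z: "z \<in> U" "\<forall>b\<in>U. (z, b) \<in> r"
      using linear_order_finite_min[OF r, of U] W(1) by (auto simp: U_def)
    have "(z, b) \<in> ?s \<longleftrightarrow> b \<in> U" for b
      using z L(3)[of x z b] by (auto simp: U_def)
    then show ?thesis using z by (intro bexI[of _ z]) (auto simp: U_def)
  qed
  then obtain z where z: "z \<in> insert x W" "\<And>b. (z, b) \<in> ?s \<longleftrightarrow> b \<in> U" by blast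
  have "(a, b) \<in> r \<longleftrightarrow> (a, b) \<in> insert_below x W ?s z" for a b
  proof -
    have mem: "(a, b) \<in> insert_below x W ?s z \<longleftrightarrow>
        (a, b) \<in> ?s \<or> a = x \<and> (b \<in> U \<or> b = x) \<or> b = x \<and> a \<in> W \<and> a \<notin> U"
      unfolding insert_below_def using z(2) by auto
    show ?thesis
      unfolding mem using L(1) L(2)[of x] L(4)[of a x] L(5)[of a x] W(2) by (auto simp: U_def)
  qed
  then have "r = insert_below x W ?s z" by auto
  then show ?thesis using z(1) by blast
qed

text \<open>An ordering of \<open>insert x W\<close> is an ordering of \<open>W\<close> together
  with a position for \<open>x\<close>, of which there are \<open>card W + 1\<close>, exactly one
  being the top. The property \<open>P\<close> sees only the part on \<open>W\<close>.\<close>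

lemma card_linear_orders_insert:
  assumes W: "finite W" "x \<notin> W"
    and P: "\<And>r. P r \<longleftrightarrow> P (r \<inter> W \<times> W)"
  shows "card {r. linear_order_on (insert x W) r \<and> P r} =
      card (insert x W) * card {s. linear_order_on W s \<and> P s}"
    and "card {r. linear_order_on (insert x W) r \<and> P r \<and> (\<forall>y\<in>insert x W. (y, x) \<in> r)} =
      card {s. linear_order_on W s \<and> P s}"
proof -
  let ?S = "{s. linear_order_on W s \<and> P s}" and ?f = "\<lambda>(s, z). insert_below x W s z"
  have sub: "s \<subseteq> W \<times> W" if "s \<in> ?S" for s using that linear_order_onE(1) by blast
  have rest: "insert_below x W s z \<inter> W \<times> W = s" if "s \<in> ?S" for s z
    by (rule insert_below_restrict[OF sub[OF that] W(2)])
  have img: "insert_below x W s z \<in> {r. linear_order_on (insert x W) r \<and> P r}" if "s \<in> ?S" for s z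
    using that insert_below_linear[of W s x z] W P[of "insert_below x W s z"] rest[OF that] by simp
  have pre: "\<exists>s\<in>?S. \<exists>z\<in>insert x W. r = insert_below x W s z"
    if "linear_order_on (insert x W) r" "P r" for r
    using insert_below_surj[OF that(1) W] linear_order_restrict[OF that(1), of W] that(2) P[of r]
    by blast
  have inj: "s = s' \<and> z = z'" if s: "s \<in> ?S" "s' \<in> ?S" and z: "z \<in> insert x W" "z' \<in> insert x W"
    and eq: "insert_below x W s z = insert_below x W s' z'" for s s' z z'
  proof -
    have ss: "s = s'" using rest[OF s(1), of z] rest[OF s(2), of z'] eq by simp
    note L = linear_order_onE[of W s]
    \<comment> \<open>The elements of \<open>W\<close> above \<open>x\<close> are those from
      \<open>z\<close> upwards, or none if \<open>z = x\<close>; this set determines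
      \<open>z\<close>.\<close>
    have up: "(z, b) \<in> s \<longleftrightarrow> (z', b) \<in> s" for b
    proof -
      have "(z'', b) \<in> s \<longleftrightarrow> b \<in> W \<and> (x, b) \<in> insert_below x W s z''" for z''
        using sub[OF s(1)] W(2) by (auto simp: insert_below_def)
      then show ?thesis using eq ss by metis
    qed
    have lin: "linear_order_on W s" using s(1) by simp
    have "z = z'"
    proof (cases "z \<in> W \<or> z' \<in> W")
      case True
      then show ?thesis
        using up[of z] up[of z'] linear_order_onE(1,2,4)[OF lin] by blast
    next
      case False
      then show ?thesis using z by blast
    qed
    then show ?thesis using ss by blast
  qed
  have "bij_betw ?f (?S \<times> insert x W) {r. linear_order_on (insert x W) r \<and> P r}"
    unfolding bij_betw_def
  proof (intro conjI)
    show "inj_on ?f (?S \<times> insert x W)" using inj by (auto intro!: inj_onI)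
    show "?f ` (?S \<times> insert x W) = {r. linear_order_on (insert x W) r \<and> P r}"
      using img pre by fastforce
  qed
  from bij_betw_same_card[OF this]
  show "card {r. linear_order_on (insert x W) r \<and> P r} = card (insert x W) * card ?S"
    by (simp add: card_cartesian_product mult.commute)
  have "bij_betw (\<lambda>s. insert_below x W s x) ?S
      {r. linear_order_on (insert x W) r \<and> P r \<and> (\<forall>y\<in>insert x W. (y, x) \<in> r)}" (is "bij_betw ?g _ ?T")
    unfolding bij_betw_def
  proof (intro conjI equalityI subsetI)
    show "inj_on ?g ?S" using inj by (auto intro!: inj_onI)
    fix r
    {
      assume "r \<in> ?g ` ?S"
      then obtain s where s: "s \<in> ?S" "r = ?g s" by blast
      have "(y, x) \<in> r" if "y \<in> insert x W" for y
        using that sub[OF s(1)] W(2) unfolding s(2) by (auto simp: insert_below_def)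
      then show "r \<in> ?T" using img[OF s(1), of x] s(2) by simp
    }
    assume r: "r \<in> ?T"
    then obtain s z where s: "s \<in> ?S" "z \<in> insert x W" "r = insert_below x W s z" using pre by blast
    have "z = x"
    proof (rule ccontr)
      assume "z \<noteq> x"
      then have zW: "z \<in> W" using s by simp
      then have "(z, z) \<in> s" using s(1) linear_order_onE(2)[of W s z] by simp
      then have "(x, z) \<in> r" "(z, x) \<notin> r"
        using s zW W(2) sub[OF s(1)] by (auto simp: insert_below_def)
      then show False using r zW by blast
    qed
    then show "r \<in> ?g ` ?S" using s by blast
  qed
  from bij_betw_same_card[OF this]
  show "card ?T = card ?S" by simp
qed

lemma card_linear_orders:
  assumes "finite V" shows "card {r. linear_order_on V r} = fact (card V)"
  using assms
proof (induction V rule: finite_induct)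
  case empty
  have "{r. linear_order_on ({} :: 'a set) r} = {{}}" using linear_order_onE(1) by fastforce
  then show ?case by simp
next
  case (insert x W)
  then show ?case using card_linear_orders_insert(1)[of W x "\<lambda>_. True"] by simp
qed

section \<open>Orderings sorted by their largest vertex\<close>

definition good_orders :: "nat \<Rightarrow> qpath set \<Rightarrow> nat rel set" where
  "good_orders n G = {r. linear_order_on {1..n} r \<and> (\<forall>g\<in>G. peak_at_end n r g)}"

definition is_top :: "nat \<Rightarrow> nat \<Rightarrow> nat rel \<Rightarrow> bool" where
  "is_top n x r \<longleftrightarrow> (\<forall>y\<in>{1..n}. (y, x) \<in> r)"

text \<open>Generators avoiding \<open>x\<close> only constrain the ordering of the remaining
  vertices, so all \<open>n\<close> positions of \<open>x\<close> are equally frequent.\<close>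

lemma card_good_orders_top:
  assumes n: "n \<ge> 1" and x: "x \<in> {1..n}"
    and G: "\<And>g t. g \<in> G \<Longrightarrow> t \<le> snd g \<Longrightarrow> vertex_after n (fst g) t \<noteq> x"
  shows "card (good_orders n G) = n * card {r \<in> good_orders n G. is_top n x r}"
proof -
  define W where "W = {1..n} - {x}"
  have V: "insert x W = {1..n}" and W: "finite W" "x \<notin> W" using x by (auto simp: W_def)
  have "peak_at_end n r g \<longleftrightarrow> peak_at_end n (r \<inter> W \<times> W) g" if g: "g \<in> G" for r g
  proof -
    have "vertex_after n (fst g) t \<in> W" if "t \<le> snd g" for t
      using G[OF g that] vertex_after_range[OF n] by (simp add: W_def)
    then show ?thesis unfolding peak_at_end_def by (meson IntD1 IntI SigmaI less_imp_le)
  qed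
  then have P: "(\<forall>g\<in>G. peak_at_end n r g) \<longleftrightarrow> (\<forall>g\<in>G. peak_at_end n (r \<inter> W \<times> W) g)" for r by blast
  note C = card_linear_orders_insert[where P = "\<lambda>r. \<forall>g\<in>G. peak_at_end n r g", OF W P, unfolded V]
  have "{r \<in> good_orders n G. is_top n x r} =
      {r. linear_order_on {1..n} r \<and> (\<forall>g\<in>G. peak_at_end n r g) \<and> (\<forall>y\<in>{1..n}. (y, x) \<in> r)}"
    by (auto simp: good_orders_def is_top_def)
  then show ?thesis using C by (simp add: good_orders_def)
qed

lemma finite_good_orders: "finite (good_orders n G)"
proof (rule finite_subset)
  show "good_orders n G \<subseteq> Pow ({1..n} \<times> {1..n})"
    by (auto simp: good_orders_def dest!: linear_order_onE(1))
qed simp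

lemma card_good_orders_by_top:
  assumes n: "n \<ge> 1"
  shows "card (good_orders n G) = (\<Sum>x\<in>{1..n}. card {r \<in> good_orders n G. is_top n x r})"
proof -
  have "good_orders n G = (\<Union>x\<in>{1..n}. {r \<in> good_orders n G. is_top n x r})"
  proof (intro equalityI subsetI)
    fix r assume r: "r \<in> good_orders n G"
    then have "linear_order_on {1..n} (r\<inverse>)" by (simp add: good_orders_def)
    then obtain x where "x \<in> {1..n}" "\<forall>b\<in>{1..n}. (x, b) \<in> r\<inverse>"
      using linear_order_finite_min[of "{1..n}" "r\<inverse>" "{1..n}"] n by auto
    then show "r \<in> (\<Union>x\<in>{1..n}. {r \<in> good_orders n G. is_top n x r})"
      using r by (auto simp: is_top_def)
  qed auto
  also have "card \<dots> = (\<Sum>x\<in>{1..n}. card {r \<in> good_orders n G. is_top n x r})"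
  proof (rule card_UN_disjoint)
    show "\<forall>x\<in>{1..n}. finite {r \<in> good_orders n G. is_top n x r}" using finite_good_orders by simp
    have "x = y" if "is_top n x r" "is_top n y r" "r \<in> good_orders n G" "x \<in> {1..n}" "y \<in> {1..n}" for x y r
      using that linear_order_onE(4)[of "{1..n}" r x y] by (simp add: is_top_def good_orders_def)
    then show "\<forall>x\<in>{1..n}. \<forall>y\<in>{1..n}. x \<noteq> y \<longrightarrow>
        {r \<in> good_orders n G. is_top n x r} \<inter> {r \<in> good_orders n G. is_top n y r} = {}" by blast
  qed simp
  finally show ?thesis .
qed

lemma set_Hod: "set_mset (Hod n g) = vertex_after n (fst g) ` {..snd g}"
  by (auto simp: Hod_def)

text \<open>Removing one occurrence of each end leaves the positions strictly between 0 and
  \<open>snd g\<close>. On the cyclic quiver the vertex of an end may recur there and then still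
  counts as interior.\<close>

lemma set_Int_mset:
  assumes "fst g \<in> {1..n}" "snd g \<ge> 1"
  shows "set_mset (Int_mset n g) = vertex_after n (fst g) ` {0<..<snd g}"
proof -
  have "{0..snd g} = insert 0 (insert (snd g) {0<..<snd g})" using assms(2) by auto
  then have "Hod n g = {#hook g, denouement n g#} + image_mset (vertex_after n (fst g)) (mset_set {0<..<snd g})"
    using assms vertex_after_0[OF assms(1)] by (simp add: Hod_def hook_def denouement_def)
  then show ?thesis by (simp add: Int_mset_def)
qed

section \<open>The recursion over the Q-set\<close>

context path_relations
begin

lemma relation_props:
  assumes "g \<in> G" shows "fst g \<in> {1..n}" "2 \<le> snd g"
  using assms relations_subset qpaths_fst[of "fst g" "snd g" Q n] relations_length by auto

lemma Q_set_iff: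
  "x \<in> Q_set n G \<longleftrightarrow> x \<in> {1..n} \<and> (\<forall>g\<in>G. \<forall>t. 0 < t \<and> t < snd g \<longrightarrow> va (fst g) t \<noteq> x)"
proof -
  have "set_mset (Int_mset n g) = va (fst g) ` {0<..<snd g}" if "g \<in> G" for g
    using relation_props[OF that] by (intro set_Int_mset) auto
  then have "(\<Union>g\<in>G. set_mset (Int_mset n g)) = (\<Union>g\<in>G. va (fst g) ` {0<..<snd g})"
    by (rule SUP_cong[OF refl])
  moreover have "x \<in> (\<Union>g\<in>G. va (fst g) ` {0<..<snd g}) \<longleftrightarrow>
      (\<exists>g\<in>G. \<exists>t. 0 < t \<and> t < snd g \<and> va (fst g) t = x)"
    unfolding UN_iff image_iff Bex_def greaterThanLessThan_iff by metis
  ultimately show ?thesis unfolding Q_set_def by (simp only: Diff_iff) blast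
qed

lemma card_good_orders_top_outside:
  assumes "x \<in> {1..n}" "x \<notin> Q_set n G"
  shows "card {r \<in> good_orders n G. is_top n x r} = 0"
proof -
  obtain g t where g: "g \<in> G" "0 < t" "t < snd g" "va (fst g) t = x"
    using assms Q_set_iff by blast
  have "\<not> peak_at_end n r g" if "is_top n x r" for r
    using that g(2-4) vertex_after_range[OF n_ge_1, of "fst g"]
    unfolding peak_at_end_def is_top_def by blast
  then have "{r \<in> good_orders n G. is_top n x r} = {}" using g(1) by (auto simp: good_orders_def)
  then show ?thesis by (simp only: card.empty)
qed

lemma card_good_orders_top_inside:
  assumes x: "x \<in> Q_set n G"
  defines "G' \<equiv> G - {g \<in> G. hook g = x \<or> denouement n g = x}"
  shows "n * card {r \<in> good_orders n G. is_top n x r} = card (good_orders n G')"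
proof -
  have xn: "x \<in> {1..n}" and int: "\<And>g t. g \<in> G \<Longrightarrow> 0 < t \<Longrightarrow> t < snd g \<Longrightarrow> va (fst g) t \<noteq> x"
    using x Q_set_iff by auto
  have "va (fst g) t \<noteq> x" if g: "g \<in> G'" and t: "t \<le> snd g" for g t
  proof -
    have gG: "g \<in> G" "hook g \<noteq> x" "denouement n g \<noteq> x" using g by (auto simp: G'_def)
    consider "t = 0" | "0 < t" "t < snd g" | "t = snd g" using t by linarith
    then show ?thesis
      using gG int[OF gG(1)] vertex_after_0[OF relation_props(1)[OF gG(1)]]
      by cases (auto simp: hook_def denouement_def)
  qed
  then have "card (good_orders n G') = n * card {r \<in> good_orders n G'. is_top n x r}"
    by (rule card_good_orders_top[OF n_ge_1 xn])
  moreover have "{r \<in> good_orders n G. is_top n x r} = {r \<in> good_orders n G'. is_top n x r}"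
  proof -
    \<comment> \<open>The largest vertex lies on \<open>g\<close> but at no interior position, so it
      is strictly above all interior vertices and \<open>g\<close> imposes no restriction.\<close>
    have "peak_at_end n r g" if r: "linear_order_on {1..n} r" "is_top n x r"
      and g: "g \<in> G" "hook g = x \<or> denouement n g = x" for r g
      unfolding peak_at_end_def
    proof (intro allI impI)
      fix p assume p: "0 < p \<and> p < snd g"
      have "(va (fst g) p, x) \<in> r" using r(2) vertex_after_range[OF n_ge_1] by (auto simp: is_top_def)
      then have no: "(x, va (fst g) p) \<notin> r"
        using linear_order_onE(4)[OF r(1)] int[OF g(1)] p by blast
      have "\<exists>t\<le>snd g. va (fst g) t = x"
        using g(2) vertex_after_0[OF relation_props(1)[OF g(1)]]
        unfolding hook_def denouement_def by (metis le0 order_refl)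
      then show "\<exists>t\<le>snd g. (va (fst g) t, va (fst g) p) \<notin> r" using no by metis
    qed
    then show ?thesis by (auto simp: good_orders_def G'_def)
  qed
  ultimately show ?thesis by simp
qed

text \<open>Joins the criterion to the convention: a nonempty subset inherits the conditions on
  relations and gives a nonzero ideal, while the empty one imposes nothing and leaves all
  \<open>fact n\<close> orderings.\<close>

lemma q_number_conv_subset:
  assumes G': "G' \<subseteq> G"
  shows "q_number_conv Q n (path_ideal Q n G' :: (qpath \<Rightarrow> 'k::field) set) = card (good_orders n G')"
proof (cases "G' = {}")
  case True
  have "good_orders n {} = {r. linear_order_on {1..n} r}" by (simp add: good_orders_def)
  moreover have "path_ideal Q n {} = {\<zero>\<^bsub>path_algebra Q n :: (qpath \<Rightarrow> 'k) ring\<^esub>}"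
    using path_ideal_nonempty[OF n_ge_1, of "{}" Q] by simp
  ultimately show ?thesis
    using True card_linear_orders[of "{1..n}"] by (simp add: q_number_conv_def)
next
  case False
  have rel: "path_relations Q n G'"
  proof
    show "n \<ge> 2" by (rule n_ge_2)
    show "G' \<subseteq> qpaths Q n" using relations_subset G' by blast
    show "snd g \<ge> 2" if "g \<in> G'" for g using that relations_length G' by blast
    show "s = m" if "(i, m) \<in> G'" "r + s \<le> m" "(vertex_after n i r, s) \<in> G'" for i m r s
      using relations_antichain[of i m r s] that G' by blast
    show "G' \<noteq> {}" by (rule False)
  qed
  have "path_ideal Q n G' \<noteq> {\<zero>\<^bsub>path_algebra Q n :: (qpath \<Rightarrow> 'k) ring\<^esub>}"
    using path_ideal_nonempty[OF n_ge_1 path_relations.relations_subset[OF rel]] False by simp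
  then show ?thesis by (simp add: q_number_conv_def path_relations.q_number_eq[OF rel] good_orders_def)
qed

text \<open>A vertex of the Q-set that lies on a generator is not interior to it, hence is one of
  its ends. Conversely ends lie in the hood, which separates the first class from the other
  two.\<close>

lemma Q_set_partition:
  "Q_set n G = Q_set0 n G \<union> Q_set1 n G \<union> Q_set2 n G"
  "Q_set0 n G \<inter> (Q_set1 n G \<union> Q_set2 n G) = {}" "Q_set1 n G \<inter> Q_set2 n G = {}"
proof -
  have ends: "hook g \<in># Hod n g" "denouement n g \<in># Hod n g" if "g \<in> G" for g
    using vertex_after_0[OF relation_props(1)[OF that]]
    by (force simp: set_Hod hook_def denouement_def)+
  have "x \<in> hook ` G \<or> x \<in> denouement n ` G" if x: "x \<in> Q_set n G" and g: "g \<in> G" "x \<in># Hod n g" for x g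
  proof -
    obtain t where t: "t \<le> snd g" "x = va (fst g) t" using g(2) by (auto simp: set_Hod)
    then have "t = 0 \<or> t = snd g" using x g(1) Q_set_iff by (metis le_neq_implies_less neq0_conv)
    then have "x = hook g \<or> x = denouement n g"
      using t vertex_after_0[OF relation_props(1)[OF g(1)]] by (auto simp: hook_def denouement_def)
    then show ?thesis using g(1) by blast
  qed
  then show "Q_set n G = Q_set0 n G \<union> Q_set1 n G \<union> Q_set2 n G"
    unfolding Q_set0_def Q_set1_def Q_set2_def by blast
  show "Q_set0 n G \<inter> (Q_set1 n G \<union> Q_set2 n G) = {}"
    unfolding Q_set0_def Q_set1_def Q_set2_def using ends by blast
  show "Q_set1 n G \<inter> Q_set2 n G = {}"
    unfolding Q_set1_def Q_set2_def by blast
qed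

lemma q_number_recursion:
  fixes I :: "(qpath \<Rightarrow> 'k::field) set"
  assumes I: "I = path_ideal Q n G"
  shows "n * q_number Q n I = (\<Sum>x\<in>Q_set0 n G. q_number Q n I)
    + (\<Sum>x\<in>Q_set1 n G. q_number_conv Q n (ideal_hat Q n I G x))
    + (\<Sum>x\<in>Q_set2 n G. q_number_conv Q n (ideal_hat Q n I G x))"
proof -
  let ?top = "\<lambda>x. card {r \<in> good_orders n G. is_top n x r}"
  let ?q = "\<lambda>x. q_number_conv Q n (ideal_hat Q n I G x)"
  have q: "q_number Q n I = card (good_orders n G)"
    unfolding I q_number_eq good_orders_def by simp
  have q1: "(\<Sum>x\<in>Q_set1 n G. n * ?top x) = (\<Sum>x\<in>Q_set1 n G. ?q x)"
    and q2: "(\<Sum>x\<in>Q_set2 n G. n * ?top x) = (\<Sum>x\<in>Q_set2 n G. ?q x)"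
  proof -
    have "n * ?top x = ?q x" if x: "x \<in> Q_set1 n G \<union> Q_set2 n G" for x
    proof -
      have "x \<in> Q_set n G" "x \<notin> Q_set0 n G" using Q_set_partition x by blast+
      then show ?thesis
        using card_good_orders_top_inside[of x] by (simp add: ideal_hat_def q_number_conv_subset)
    qed
    then show "(\<Sum>x\<in>Q_set1 n G. n * ?top x) = (\<Sum>x\<in>Q_set1 n G. ?q x)"
      and "(\<Sum>x\<in>Q_set2 n G. n * ?top x) = (\<Sum>x\<in>Q_set2 n G. ?q x)"
      by (auto intro!: sum.cong)
  qed
  have sub: "Q_set n G \<subseteq> {1..n}" by (auto simp: Q_set_def)
  then have fin: "finite (Q_set n G)" by (rule finite_subset) simp
  have "?top x = 0" if "x \<in> {1..n} - Q_set n G" for x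
    using that card_good_orders_top_outside by blast
  then have "card (good_orders n G) = (\<Sum>x\<in>Q_set n G. ?top x)"
    unfolding card_good_orders_by_top[OF n_ge_1] using sub by (intro sum.mono_neutral_right) auto
  then have "n * q_number Q n I = (\<Sum>x\<in>Q_set n G. n * ?top x)"
    unfolding q by (simp add: sum_distrib_left)
  also have "\<dots> = (\<Sum>x\<in>Q_set0 n G. n * ?top x) + (\<Sum>x\<in>Q_set1 n G. n * ?top x) + (\<Sum>x\<in>Q_set2 n G. n * ?top x)"
  proof -
    have f: "finite (Q_set0 n G)" "finite (Q_set1 n G)" "finite (Q_set2 n G)"
      using fin Q_set_partition(1) by auto
    have d: "Q_set0 n G \<inter> Q_set1 n G = {}" "(Q_set0 n G \<union> Q_set1 n G) \<inter> Q_set2 n G = {}"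
      using Q_set_partition(2,3) by auto
    show ?thesis
      unfolding Q_set_partition(1) by (subst sum.union_disjoint; use f d in \<open>simp add: sum.union_disjoint\<close>)
  qed
  \<comment> \<open>No generator starts or ends at such a vertex, so removing those that do changes
    nothing and the full count reappears.\<close>
  also have "(\<Sum>x\<in>Q_set0 n G. n * ?top x) = (\<Sum>x\<in>Q_set0 n G. q_number Q n I)"
  proof (rule sum.cong[OF refl])
    fix x assume x: "x \<in> Q_set0 n G"
    then have "x \<notin> Q_set1 n G \<union> Q_set2 n G" "x \<in> Q_set n G" using Q_set_partition by blast+
    then have "{g \<in> G. hook g = x \<or> denouement n g = x} = {}"
      unfolding Q_set1_def Q_set2_def by blast
    then show "n * ?top x = q_number Q n I"
      using card_good_orders_top_inside[OF \<open>x \<in> Q_set n G\<close>] by (simp only: q Diff_empty)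
  qed
  finally show ?thesis by (simp only: q1 q2)
qed

end

theorem theorem4p3:
  fixes Q :: quiver and n :: nat
    and I :: "(qpath \<Rightarrow> 'k::alg_closed_field) set" and G :: "qpath set"
  assumes "n \<ge> 2"
    and "admissible_ideal Q n I"
    and "minimal_path_generators Q n I G"
  shows "real (q_number Q n I) =
    1 / real n * ((\<Sum>x\<in>Q_set0 n G. real (q_number Q n I))
      + (\<Sum>x\<in>Q_set1 n G. real (q_number_conv Q n (ideal_hat Q n I G x)))
      + (\<Sum>x\<in>Q_set2 n G. real (q_number_conv Q n (ideal_hat Q n I G x))))"
proof -
  interpret path_relations Q n G by (rule admissible_path_relations[OF assms])
  have "I = path_ideal Q n G" using assms(3) by (simp add: minimal_path_generators_def)
  from arg_cong[OF q_number_recursion[OF this], of real] show ?thesis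
    using assms(1) by (simp add: field_simps)
qed

end
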